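(* Let $n, k, r$ be positive integers with $n \geq k \geq 3$ and $t \geq r \geq 3$, where $t=\lfloor (n-1)/2\rfloor$. Let $H$ be an $n$-vertex $r$-uniform hypergraph. If (a) $k \leq r+1$ and $\delta(H) \geq k-1$, or (b) $r+2\leq k<t+2$ and $\delta(H) \geq \binom{k-2}{r-1}+1$, or (c) $k\geq t+2$ and $\delta(H) \geq \binom{t}{r-1} + 1$, then $H$ contains a Berge cycle of length $k$ or longer.
   Context: A hypergraph is a family of (distinct) subsets, called edges, of a vertex set; it is $r$-uniform if every edge has exactly $r$ vertices. $\delta(H)$ denotes the minimum number of edges containing a vertex. A Berge cycle of length $\ell$ is a list $v_1, e_1, v_2, \ldots, v_\ell, e_\ell, v_1$ of $\ell$ distinct vertices and $\ell$ distinct edges with $\{v_i, v_{i+1}\} \subseteq e_i$ for all $i$ (indices modulo $\ell$). *)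

theory Defs
  imports Main "HOL.Binomial"
begin

definition hypergraph :: "'a set \<Rightarrow> 'a set set \<Rightarrow> bool" where
  "hypergraph V E \<longleftrightarrow> finite V \<and> (\<forall>e\<in>E. e \<subseteq> V)"

definition uniform :: "nat \<Rightarrow> 'a set set \<Rightarrow> bool" where
  "uniform r E \<longleftrightarrow> (\<forall>e\<in>E. card e = r)"

definition degree :: "'a set set \<Rightarrow> 'a \<Rightarrow> nat" where
  "degree E v = card {e \<in> E. v \<in> e}"

(* Meaningful only for finite nonempty V. *)
definition min_degree :: "'a set \<Rightarrow> 'a set set \<Rightarrow> nat" where
  "min_degree V E = Min (degree E ` V)"

(* The 0-based entries vs ! i and es ! i are the (i+1)-st vertex and edge of the
   cycle; its length is the common length of the two lists. *)
definition berge_cycle :: "'a set \<Rightarrow> 'a set set \<Rightarrow> 'a list \<Rightarrow> 'a set list \<Rightarrow> bool" where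
  "berge_cycle V E vs es \<longleftrightarrow>
     vs \<noteq> [] \<and> length es = length vs \<and>
     distinct vs \<and> set vs \<subseteq> V \<and>
     distinct es \<and> set es \<subseteq> E \<and>
     (\<forall>i < length vs. {vs ! i, vs ! (Suc i mod length vs)} \<subseteq> es ! i)"

end

theory Submission
  imports Defs
begin

text \<open>
  For (a) and (b), take a longest Berge path and look at the \<open>k - 1\<close> vertices at its start. If there is no Berge
  cycle of length \<open>k\<close>, every edge outside the path that meets the first vertex stays inside this set, and so it
  does after each rotation of the path inside the set. For \<open>k \<ge> r + 2\<close>, the minimum degree exceeds the
  number of \<open>r\<close>-subsets of the set through a vertex, and a suitable rotation lets an edge escape from the set.

  For (c), case (b) gives a longest Berge cycle of length \<open>c \<ge> t + 2\<close>. Suppose that a vertex is left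
  outside. Two attachments of an outside path with \<open>l\<close> vertices to the cycle have distance at least
  \<open>l + 1\<close>, and no unused edge contains the successors of two neighbours of an outside vertex. If every
  unused edge has at most one outside vertex, counting the edges at an outside vertex leaves few extremal configurations,
  which are destroyed by exchanging an outside vertex with a cycle vertex. Otherwise take a longest path of
  unused edges outside the cycle; the attachments of its two ends cannot be as numerous as the degree requires.
\<close>

section \<open>Berge paths as lists\<close>

fun bp :: "'a list \<Rightarrow> 'a set list \<Rightarrow> bool" where
  "bp [x] [] = True"
| "bp (x # y # vs) (e # es) = (x \<in> e \<and> y \<in> e \<and> bp (y # vs) es)"
| "bp _ _ = False"

lemma bp_length: "bp vs es \<Longrightarrow> length vs = Suc (length es)"
  by (induction vs es rule: bp.induct) auto

lemma bp_not_Nil: "bp vs es \<Longrightarrow> vs \<noteq> []"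
  by (auto dest: bp_length)

lemma bp_append:
  "bp p es1 \<Longrightarrow> bp q es2 \<Longrightarrow> last p \<in> e \<Longrightarrow> hd q \<in> e \<Longrightarrow> bp (p @ q) (es1 @ e # es2)"
proof (induction p es1 rule: bp.induct)
  case (1 x)
  then show ?case by (cases q) (auto dest: bp_not_Nil)
qed auto

lemma bp_rev: "bp vs es \<Longrightarrow> bp (rev vs) (rev es)"
proof (induction vs es rule: bp.induct)
  case (2 x y vs e es)
  then have "bp (rev (y # vs) @ [x]) (rev es @ e # [])"
    by (intro bp_append) auto
  then show ?case by simp
qed auto

lemma bp_nth: "bp vs es \<Longrightarrow> i < length es \<Longrightarrow> vs ! i \<in> es ! i \<and> vs ! Suc i \<in> es ! i"
proof (induction vs es arbitrary: i rule: bp.induct)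
  case (2 x y vs e es)
  then show ?case by (cases i) auto
qed auto

lemma bp_iff_nth:
  "bp vs es \<longleftrightarrow> length vs = Suc (length es) \<and>
     (\<forall>i < length es. vs ! i \<in> es ! i \<and> vs ! Suc i \<in> es ! i)"
proof
  assume "length vs = Suc (length es) \<and> (\<forall>i < length es. vs ! i \<in> es ! i \<and> vs ! Suc i \<in> es ! i)"
  then show "bp vs es"
  proof (induction vs es rule: bp.induct)
    case (2 x y vs e es)
    have "x \<in> e" "y \<in> e" using 2(2) by auto
    moreover have "bp (y # vs) es"
      using 2(2) by (intro 2(1)) fastforce
    ultimately show ?case by simp
  qed (auto)
qed (auto dest: bp_length bp_nth)

lemma bp_update:
  "bp vs es \<Longrightarrow> vs ! i \<in> x \<Longrightarrow> vs ! Suc i \<in> x \<Longrightarrow> bp vs (es[i := x])"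
  unfolding bp_iff_nth by (metis length_list_update nth_list_update_eq nth_list_update_neq)

lemma bp_take: "bp vs es \<Longrightarrow> i \<le> length es \<Longrightarrow> bp (take (Suc i) vs) (take i es)"
  by (auto simp: bp_iff_nth)

lemma bp_drop: "bp vs es \<Longrightarrow> i \<le> length es \<Longrightarrow> bp (drop i vs) (drop i es)"
  by (auto simp: bp_iff_nth)

text \<open>Posa's rotation: the initial segment is reversed and \<open>x\<close> joins the old head
  to the vertex after position \<open>i\<close>. The new head is \<open>vs ! i\<close>, and if the
  edges are distinct and \<open>x\<close> differs from \<open>es ! i\<close>, then
  \<open>es ! i\<close> is released: an edge at the new head that is no longer on the path.\<close>

lemma bp_rotate:
  assumes "bp vs es" "i < length es" "hd vs \<in> x" "vs ! Suc i \<in> x"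
  shows "bp (rev (take (Suc i) vs) @ drop (Suc i) vs) (rev (take i es) @ x # drop (Suc i) es)"
proof (rule bp_append)
  have l: "length vs = Suc (length es)" using assms(1) by (rule bp_length)
  show "bp (rev (take (Suc i) vs)) (rev (take i es))"
    using assms by (intro bp_rev bp_take) auto
  show "bp (drop (Suc i) vs) (drop (Suc i) es)"
    using assms by (intro bp_drop) auto
  show "last (rev (take (Suc i) vs)) \<in> x"
    using assms(3) l by (cases vs) (auto simp: last_rev)
  show "hd (drop (Suc i) vs) \<in> x"
    using assms l by (simp add: hd_drop_conv_nth)
qed

lemma berge_cycle_of_bp:
  assumes "bp vs es" "distinct vs" "set vs \<subseteq> V" "distinct es" "set es \<subseteq> E"
    and "e \<in> E" "e \<notin> set es" "hd vs \<in> e" "last vs \<in> e"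
  shows "berge_cycle V E vs (es @ [e])"
proof -
  have l: "length vs = Suc (length es)" using assms(1) by (rule bp_length)
  have "{vs ! i, vs ! (Suc i mod length vs)} \<subseteq> (es @ [e]) ! i" if "i < length vs" for i
  proof (cases "i < length es")
    case True
    then show ?thesis using bp_nth[OF assms(1) True] l by (auto simp: nth_append)
  next
    case False
    then have i: "i = length es" using that l by auto
    have "vs ! 0 = hd vs" "vs ! i = last vs"
      using l i bp_not_Nil[OF assms(1)] by (auto simp: hd_conv_nth last_conv_nth)
    then show ?thesis using assms l i by (auto simp: nth_append)
  qed
  then show ?thesis unfolding berge_cycle_def using assms l by auto
qed

lemma rotate_last: "Suc i < length vs \<Longrightarrow> last (rev (take (Suc i) vs) @ drop (Suc i) vs) = last vs"
  by (simp add: last_append)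

lemma rotate_hd: "i < length vs \<Longrightarrow> hd (rev (take (Suc i) vs) @ drop (Suc i) vs) = vs ! i"
  by (simp add: take_Suc_conv_app_nth)

lemma rotate_set: "set (rev (take (Suc i) vs) @ drop (Suc i) vs) = set vs"
  by (metis append_take_drop_id set_append set_rev)

lemma rotate_distinct: "distinct vs \<Longrightarrow> distinct (rev (take (Suc i) vs) @ drop (Suc i) vs)"
  by (simp add: set_take_disj_set_drop_if_distinct)

lemma rotate_set_edges:
  "i < length es \<Longrightarrow> set (rev (take i es) @ x # drop (Suc i) es) = insert x (set es - {es ! i})"
  if "distinct es"
proof -
  assume i: "i < length es"
  have "distinct (take i es @ es ! i # drop (Suc i) es)"
    using that i by (simp add: id_take_nth_drop[symmetric])
  moreover have "set es = set (take i es @ es ! i # drop (Suc i) es)"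
    using i by (simp add: id_take_nth_drop[symmetric])
  ultimately show ?thesis by auto
qed

lemma rotate_distinct_edges:
  "distinct es \<Longrightarrow> i < length es \<Longrightarrow> x \<notin> set es - {es ! i} \<Longrightarrow>
     distinct (rev (take i es) @ x # drop (Suc i) es)"
proof -
  assume a: "distinct es" "i < length es" "x \<notin> set es - {es ! i}"
  have d: "distinct (take i es @ es ! i # drop (Suc i) es)"
    using a by (simp add: id_take_nth_drop[symmetric])
  moreover have "set es = set (take i es @ es ! i # drop (Suc i) es)"
    using a by (simp add: id_take_nth_drop[symmetric])
  ultimately show ?thesis using a(3) by auto
qed

lemma update_set_edges: "distinct es \<Longrightarrow> i < length es \<Longrightarrow> set (es[i := x]) = insert x (set es - {es ! i})"
  by (simp add: set_update_distinct)

lemma update_distinct_edges: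
  "distinct es \<Longrightarrow> x \<notin> set es - {es ! i} \<Longrightarrow> distinct (es[i := x])"
  by (metis distinct_list_update)

section \<open>Binomial inequalities\<close>

lemma choose_ge_self: "1 \<le> k \<Longrightarrow> k < n \<Longrightarrow> n \<le> n choose k"
proof (induction n arbitrary: k)
  case (Suc n)
  show ?case
  proof (cases "k = n")
    case False
    then have "n \<le> n choose k" using Suc by auto
    moreover have "1 \<le> n choose (k - 1)" using Suc.prems by (simp add: Suc_le_eq zero_less_binomial_iff)
    moreover have "Suc n choose k = (n choose (k - 1)) + (n choose k)"
      using Suc.prems by (cases k) auto
    ultimately show ?thesis by simp
  qed (auto)
qed auto

lemma choose_ge_choose_two: "2 \<le> k \<Longrightarrow> k + 2 \<le> n \<Longrightarrow> n choose 2 \<le> n choose k"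
proof (induction n arbitrary: k)
  case (Suc n)
  show ?case
  proof (cases "k + 2 = Suc n")
    case True
    then have "Suc n choose k = Suc n choose 2"
      using binomial_symmetric[of k "Suc n"] arg_cong[of "Suc n - k" 2 "(choose) (Suc n)"] by auto
    then show ?thesis by simp
  next
    case False
    have "Suc n choose k = (n choose (k - 1)) + (n choose k)"
      using Suc.prems by (cases k) auto
    moreover have "Suc n choose 2 = n + (n choose 2)"
      by (simp add: numeral_2_eq_2)
    moreover have "n \<le> n choose (k - 1)" using Suc.prems by (intro choose_ge_self) auto
    moreover have "n choose 2 \<le> n choose k" using Suc False by simp
    ultimately show ?thesis by simp
  qed
qed auto

lemma choose_pascal: "1 \<le> n \<Longrightarrow> 1 \<le> k \<Longrightarrow> n choose k = (n - 1 choose (k - 1)) + (n - 1 choose k)"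
  by (cases n; cases k) auto

lemma choose_two_double: "2 * (n choose 2) = n * (n - 1)"
  by (cases n) (auto simp: choose_two)

lemma card_subsets_containing:
  assumes "finite W" "x \<in> W" "1 \<le> r"
  shows "card {a. a \<subseteq> W \<and> x \<in> a \<and> card a = r} = (card W - 1 choose (r - 1))"
proof -
  have "bij_betw (insert x) {a. a \<subseteq> W - {x} \<and> card a = r - 1} {a. a \<subseteq> W \<and> x \<in> a \<and> card a = r}"
  proof (rule bij_betw_byWitness[where f' = "\<lambda>a. a - {x}"])
    show "insert x ` {a. a \<subseteq> W - {x} \<and> card a = r - 1} \<subseteq> {a. a \<subseteq> W \<and> x \<in> a \<and> card a = r}"
    proof
      fix b assume "b \<in> insert x ` {a. a \<subseteq> W - {x} \<and> card a = r - 1}"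
      then obtain a where a: "b = insert x a" "a \<subseteq> W - {x}" "card a = r - 1" by auto
      then have "finite a" "x \<notin> a" using assms(1) by (auto intro: finite_subset)
      then show "b \<in> {a. a \<subseteq> W \<and> x \<in> a \<and> card a = r}" using a assms by auto
    qed
    show "(\<lambda>a. a - {x}) ` {a. a \<subseteq> W \<and> x \<in> a \<and> card a = r} \<subseteq> {a. a \<subseteq> W - {x} \<and> card a = r - 1}"
      by auto
  qed auto
  then have "card {a. a \<subseteq> W \<and> x \<in> a \<and> card a = r} = card {a. a \<subseteq> W - {x} \<and> card a = r - 1}"
    by (simp add: bij_betw_same_card)
  also have "\<dots> = (card W - 1 choose (r - 1))"
    using assms by (simp add: n_subsets)
  finally show ?thesis .
qed

section \<open>Escaping from a vertex set along Berge paths\<close>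

text \<open>Rearrangements of the path on \<open>W\<close> that fit back into a longer path: the
  last vertex is kept, and the edges are old ones (\<open>F\<close>) or lie inside \<open>W\<close>,
  so they cannot collide with later path edges, which leave \<open>W\<close>.\<close>

definition adm :: "'a set set \<Rightarrow> 'a set \<Rightarrow> 'a \<Rightarrow> 'a set \<Rightarrow> 'a set set \<Rightarrow> 'a list \<Rightarrow> 'a set list \<Rightarrow> bool" where
  "adm E W z x0 F vs es \<longleftrightarrow> bp vs es \<and> distinct vs \<and> set vs = W \<and> last vs = z \<and>
     distinct es \<and> set es \<subseteq> E \<and> x0 \<notin> set es \<and> set es \<subseteq> F \<union> Pow W"

text \<open>
  In \<open>trap\<close>, the edge \<open>x0\<close> is the one that continues a longer path beyond \<open>z\<close>, so it must stay out of every
  rearrangement of the path on \<open>W\<close>.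
\<close>

locale trapped =
  fixes E :: "'a set set" and W :: "'a set" and z :: 'a and x0 :: "'a set" and F :: "'a set set"
    and r m :: nat
  assumes finE: "finite E"
    and unif: "e \<in> E \<Longrightarrow> card e = r"
    and finW: "finite W" and cardW: "card W = Suc m"
    and r3: "3 \<le> r" and rm: "r \<le> m"
    and deg: "x \<in> W \<Longrightarrow> (m choose (r - 1)) + 1 \<le> card {e \<in> E. x \<in> e}"
    and trap: "adm E W z x0 F vs es \<Longrightarrow> g \<in> E \<Longrightarrow> g \<notin> set es \<Longrightarrow> g \<noteq> x0 \<Longrightarrow> hd vs \<in> g \<Longrightarrow> g \<subseteq> W"
begin

abbreviation "admi \<equiv> adm E W z x0 F"

definition wedges :: "'a \<Rightarrow> 'a set set" where
  "wedges x = {e \<in> E. x \<in> e \<and> e \<subseteq> W \<and> e \<noteq> x0}"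

text \<open>By \<open>trap\<close>, an edge at the head that leaves \<open>W\<close> is
  \<open>x0\<close> or an edge of the path. The latter are recorded by position, because the
  argument needs the vertex that follows each of them.\<close>

definition bad :: "'a list \<Rightarrow> 'a set list \<Rightarrow> nat set" where
  "bad vs es = {i. i < m \<and> hd vs \<in> es ! i \<and> \<not> es ! i \<subseteq> W}"

definition alls :: "'a \<Rightarrow> 'a set set" where
  "alls x = {a. a \<subseteq> W \<and> x \<in> a \<and> card a = r}"

lemma admD:
  assumes "admi vs es"
  shows "bp vs es" "distinct vs" "set vs = W" "last vs = z" "distinct es" "set es \<subseteq> E"
    "x0 \<notin> set es" "set es \<subseteq> F \<union> Pow W" "length vs = Suc m" "length es = m" "hd vs = vs ! 0"
    "hd vs \<in> W"
proof -
  show a: "bp vs es" "distinct vs" "set vs = W" "last vs = z" "distinct es" "set es \<subseteq> E"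
    "x0 \<notin> set es" "set es \<subseteq> F \<union> Pow W" using assms unfolding adm_def by auto
  show l: "length vs = Suc m" using a cardW by (metis distinct_card)
  show "length es = m" using l bp_length[OF a(1)] by simp
  show "hd vs = vs ! 0" using l by (cases vs) auto
  show "hd vs \<in> W" using a l by (cases vs) auto
qed

lemma adm_edge:
  assumes "admi vs es" "i < m"
  shows "es ! i \<in> E" "es ! i \<noteq> x0" "vs ! i \<in> es ! i" "vs ! Suc i \<in> es ! i"
    "vs ! i \<in> W" "vs ! Suc i \<in> W" "vs ! i \<noteq> vs ! Suc i" "card (es ! i) = r" "finite (es ! i)"
    "es ! i \<in> set es"
proof -
  note d = admD[OF assms(1)]
  show s: "es ! i \<in> set es" using d assms by auto
  then show e: "es ! i \<in> E" "es ! i \<noteq> x0" using d by auto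
  show "vs ! i \<in> es ! i" "vs ! Suc i \<in> es ! i" using bp_nth[OF d(1)] d assms by auto
  show "vs ! i \<in> W" "vs ! Suc i \<in> W" using d(3)[symmetric] d(9) assms(2) by auto
  show "vs ! i \<noteq> vs ! Suc i" using d assms by (simp add: nth_eq_iff_index_eq)
  show "card (es ! i) = r" using unif e by auto
  then show "finite (es ! i)" using r3 by (intro card_ge_0_finite) auto
qed

lemma adm_rotate:
  assumes a: "admi vs es" and i: "i < m" and x: "hd vs \<in> x" "vs ! Suc i \<in> x" "x \<in> E" "x \<noteq> x0"
    "x \<in> F \<union> Pow W" "x \<notin> set es - {es ! i}"
  shows "admi (rev (take (Suc i) vs) @ drop (Suc i) vs) (rev (take i es) @ x # drop (Suc i) es)"
proof -
  note d = admD[OF a]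
  have "set (rev (take i es) @ x # drop (Suc i) es) \<subseteq> insert x (set es)"
    using rotate_set_edges[OF d(5), of i x] i d by auto
  moreover have "i < length es" "Suc i < length vs" using i d by auto
  ultimately show ?thesis
    unfolding adm_def rotate_set
    using bp_rotate[OF d(1), of i x] rotate_distinct[OF d(2)] rotate_last[of i vs]
      rotate_distinct_edges[OF d(5), of i x] d(3,4,6,7,8) x by blast
qed

lemma adm_update:
  assumes a: "admi vs es" and i: "i < m" and x: "vs ! i \<in> x" "vs ! Suc i \<in> x" "x \<in> E" "x \<noteq> x0"
    "x \<in> F \<union> Pow W" "x \<notin> set es - {es ! i}"
  shows "admi vs (es[i := x])"
proof -
  note d = admD[OF a]
  have "set (es[i := x]) \<subseteq> insert x (set es)"
    by (rule set_update_subset_insert)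
  then show ?thesis
    unfolding adm_def
    using bp_update[OF d(1), of i x] update_distinct_edges[OF d(5), of x i] d i x by auto
qed

lemma not_in_update:
  assumes "admi vs es" "i < m" "x \<noteq> es ! i"
  shows "es ! i \<notin> set (es[i := x])"
  using admD[OF assms(1)] assms by (simp add: update_set_edges)

lemma wedgesD: "a \<in> wedges x \<Longrightarrow> a \<in> E" "a \<in> wedges x \<Longrightarrow> x \<in> a" "a \<in> wedges x \<Longrightarrow> a \<subseteq> W"
  "a \<in> wedges x \<Longrightarrow> a \<noteq> x0" "a \<in> wedges x \<Longrightarrow> card a = r"
  unfolding wedges_def using unif by auto

lemma finite_alls: "finite (alls x)"
  unfolding alls_def using finW by simp

lemma wedges_sub: "wedges x \<subseteq> alls x"
  unfolding wedges_def alls_def using unif by auto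

lemma card_alls: "x \<in> W \<Longrightarrow> card (alls x) = m choose (r - 1)"
  unfolding alls_def using card_subsets_containing[OF finW, of x r] cardW r3 by simp

lemma card_wedges_le: "x \<in> W \<Longrightarrow> card (wedges x) \<le> m choose (r - 1)"
  using card_mono[OF finite_alls wedges_sub] card_alls by metis

lemma finite_wedges: "finite (wedges x)"
  by (rule finite_subset[OF wedges_sub finite_alls])

lemma finite_bad: "finite (bad vs es)"
  unfolding bad_def by simp

lemma deg_split:
  assumes a: "admi vs es"
  shows "(m choose (r - 1)) + 1 \<le> card (wedges (hd vs)) + card (bad vs es)
           + (if x0 \<in> E \<and> hd vs \<in> x0 then 1 else 0)"
proof -
  note d = admD[OF a]
  have "{e \<in> E. hd vs \<in> e} \<subseteq> wedges (hd vs) \<union> (!) es ` bad vs es \<union> {e. e = x0 \<and> x0 \<in> E \<and> hd vs \<in> x0}"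
  proof
    fix e assume e: "e \<in> {e \<in> E. hd vs \<in> e}"
    show "e \<in> wedges (hd vs) \<union> (!) es ` bad vs es \<union> {e. e = x0 \<and> x0 \<in> E \<and> hd vs \<in> x0}"
    proof (cases "e \<subseteq> W \<or> e = x0")
      case False
      then have "e \<in> set es" using trap[OF a, of e] e by auto
      then obtain i where "i < m" "es ! i = e" using d by (metis in_set_conv_nth)
      then have "i \<in> bad vs es" using e False unfolding bad_def by auto
      then show ?thesis using \<open>es ! i = e\<close> by auto
    qed (use e in \<open>auto simp: wedges_def\<close>)
  qed
  then have "card {e \<in> E. hd vs \<in> e} \<le> card (wedges (hd vs) \<union> (!) es ` bad vs es \<union> {e. e = x0 \<and> x0 \<in> E \<and> hd vs \<in> x0})"
    by (intro card_mono) (auto simp: finite_wedges finite_bad)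
  also have "\<dots> \<le> card (wedges (hd vs) \<union> (!) es ` bad vs es) + card {e. e = x0 \<and> x0 \<in> E \<and> hd vs \<in> x0}"
    by (rule card_Un_le)
  also have "\<dots> \<le> card (wedges (hd vs)) + card (bad vs es) + card {e. e = x0 \<and> x0 \<in> E \<and> hd vs \<in> x0}"
    using card_Un_le[of "wedges (hd vs)" "(!) es ` bad vs es"] card_image_le[OF finite_bad, of "(!) es" vs es]
    by linarith
  also have "card {e. e = x0 \<and> x0 \<in> E \<and> hd vs \<in> x0} = (if x0 \<in> E \<and> hd vs \<in> x0 then 1 else 0)"
    by (cases "x0 \<in> E \<and> hd vs \<in> x0") auto
  finally show ?thesis using deg[OF d(12)] by simp
qed

lemma avoid:
  assumes a: "admi vs es" and i: "i \<in> bad vs es" and w: "w \<in> wedges (hd vs)" "w \<notin> set es"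
  shows "vs ! Suc i \<notin> w"
proof
  assume v: "vs ! Suc i \<in> w"
  note d = admD[OF a]
  have i': "i < m" "hd vs \<in> es ! i" "\<not> es ! i \<subseteq> W" using i unfolding bad_def by auto
  note dw = wedgesD[OF w(1)]
  have n: "admi (rev (take (Suc i) vs) @ drop (Suc i) vs) (rev (take i es) @ w # drop (Suc i) es)"
    using dw w v i' by (intro adm_rotate[OF a]) auto
  have "es ! i \<notin> set (rev (take i es) @ w # drop (Suc i) es)"
    using rotate_set_edges[OF d(5), of i w] i' d dw by auto
  moreover have "hd (rev (take (Suc i) vs) @ drop (Suc i) vs) \<in> es ! i"
    using rotate_hd[of i vs] i' d adm_edge[OF a i'(1)] by simp
  ultimately have "es ! i \<subseteq> W" using trap[OF n] adm_edge[OF a i'(1)] by blast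
  then show False using i' by simp
qed

text \<open>Rotating with the path's own edge \<open>es ! i\<close> releases nothing and keeps the
  edge set. It moves the degree count to the head \<open>vs ! i\<close>, whose bad edges can still
  be read off the old path.\<close>

lemma rotate_own:
  assumes a: "admi vs es" and i: "i < m" "hd vs \<in> es ! i"
  defines "vs' \<equiv> rev (take (Suc i) vs) @ drop (Suc i) vs"
    and "es' \<equiv> rev (take i es) @ es ! i # drop (Suc i) es"
  shows "admi vs' es'" "hd vs' = vs ! i" "set es' = set es"
    "bad vs' es' = {} \<longleftrightarrow> (\<forall>l < m. vs ! i \<in> es ! l \<longrightarrow> es ! l \<subseteq> W)"
    "card (bad vs' es') = card {l. l < m \<and> vs ! i \<in> es ! l \<and> \<not> es ! l \<subseteq> W}"
proof -
  note d = admD[OF a]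
  have F: "es ! i \<in> F \<union> Pow W" using adm_edge(10)[OF a i(1)] d(8) by blast
  show n: "admi vs' es'" unfolding vs'_def es'_def
    using adm_edge[OF a i(1)] i F by (intro adm_rotate[OF a]) auto
  show h: "hd vs' = vs ! i" unfolding vs'_def using rotate_hd[of i vs] i d by simp
  show s: "set es' = set es" unfolding es'_def
    using rotate_set_edges[OF d(5), of i "es ! i"] i d by auto
  have im: "(!) es' ` bad vs' es' = {e \<in> set es. vs ! i \<in> e \<and> \<not> e \<subseteq> W}"
    unfolding bad_def h s[symmetric] using admD(10)[OF n] by (force simp: in_set_conv_nth)
  have im2: "(!) es ` {l. l < m \<and> vs ! i \<in> es ! l \<and> \<not> es ! l \<subseteq> W} = {e \<in> set es. vs ! i \<in> e \<and> \<not> e \<subseteq> W}"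
    using d(10) by (force simp: in_set_conv_nth)
  have inj: "inj_on ((!) es') (bad vs' es')" unfolding bad_def
    using admD(5,10)[OF n] by (auto simp: inj_on_def nth_eq_iff_index_eq)
  have inj2: "inj_on ((!) es) {l. l < m \<and> vs ! i \<in> es ! l \<and> \<not> es ! l \<subseteq> W}"
    using d(5,10) by (auto simp: inj_on_def nth_eq_iff_index_eq)
  show c: "card (bad vs' es') = card {l. l < m \<and> vs ! i \<in> es ! l \<and> \<not> es ! l \<subseteq> W}"
    using card_image[OF inj] card_image[OF inj2] im im2 by simp
  show "bad vs' es' = {} \<longleftrightarrow> (\<forall>l < m. vs ! i \<in> es ! l \<longrightarrow> es ! l \<subseteq> W)"
  proof -
    have "bad vs' es' = {} \<longleftrightarrow> (!) es' ` bad vs' es' = {}" by simp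
    also have "\<dots> \<longleftrightarrow> (\<forall>l < m. vs ! i \<in> es ! l \<longrightarrow> es ! l \<subseteq> W)"
      unfolding im im2[symmetric] by auto
    finally show ?thesis .
  qed
qed

text \<open>Path edges at the head inside \<open>W\<close> and those leaving it are different
  positions. For \<open>r = m\<close> a separate bound for each kind would be too weak.\<close>

lemma used_bad_le:
  assumes a: "admi vs es"
  shows "card (wedges (hd vs) \<inter> set es) + card (bad vs es) \<le> card {i. i < m \<and> hd vs \<in> es ! i}"
proof -
  note d = admD[OF a]
  define G where "G = {i. i < m \<and> es ! i \<in> wedges (hd vs)}"
  have "wedges (hd vs) \<inter> set es \<subseteq> (!) es ` G"
    unfolding G_def using d by (auto simp: in_set_conv_nth)
  then have "card (wedges (hd vs) \<inter> set es) \<le> card G"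
    using surj_card_le[of G] unfolding G_def by auto
  moreover have "card G + card (bad vs es) = card (G \<union> bad vs es)"
    unfolding G_def bad_def by (intro card_Un_disjoint[symmetric]) (auto simp: wedges_def)
  moreover have "card (G \<union> bad vs es) \<le> card {i. i < m \<and> hd vs \<in> es ! i}"
    unfolding G_def bad_def by (intro card_mono) (auto simp: wedges_def)
  ultimately show ?thesis by linarith
qed

text \<open>By \<open>avoid\<close>, these edges miss the successors of all bad positions, which are
  distinct and differ from the head.\<close>

lemma unused_le:
  assumes a: "admi vs es"
  shows "card (wedges (hd vs) - set es) \<le> m - card (bad vs es) choose (r - 1)"
proof -
  note d = admD[OF a]
  define S where "S = (\<lambda>i. vs ! Suc i) ` bad vs es"
  have inj: "inj_on (\<lambda>i. vs ! Suc i) (bad vs es)"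
    unfolding bad_def using d by (auto simp: inj_on_def nth_eq_iff_index_eq)
  have SW: "S \<subseteq> W - {hd vs}"
    unfolding S_def bad_def d(11) using d adm_edge(6)[OF a] by (auto simp: nth_eq_iff_index_eq)
  have cS: "card S = card (bad vs es)" unfolding S_def by (rule card_image[OF inj])
  have fS: "finite S" using SW finW by (meson finite_Diff finite_subset)
  have "wedges (hd vs) - set es \<subseteq> {b. b \<subseteq> W - S \<and> hd vs \<in> b \<and> card b = r}"
    using avoid[OF a] wedgesD unfolding S_def by blast
  then have "card (wedges (hd vs) - set es) \<le> card {b. b \<subseteq> W - S \<and> hd vs \<in> b \<and> card b = r}"
    using finW by (intro card_mono) auto
  also have "\<dots> = card (W - S) - 1 choose (r - 1)"
    using SW d(12) finW r3 by (intro card_subsets_containing) auto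
  also have "card (W - S) - 1 = m - card (bad vs es)"
    using SW cardW cS fS by (subst card_Diff_subset) auto
  finally show ?thesis .
qed

lemma total_le:
  assumes a: "admi vs es"
  shows "(m choose (r - 1)) + 1 \<le> card (wedges (hd vs) - set es) + card (wedges (hd vs) \<inter> set es)
     + card (bad vs es) + (if x0 \<in> E \<and> hd vs \<in> x0 then 1 else 0)"
proof -
  have "card (wedges (hd vs)) = card (wedges (hd vs) - set es) + card (wedges (hd vs) \<inter> set es)"
    by (metis finite_wedges card_Int_Diff add.commute)
  then show ?thesis using deg_split[OF a] by simp
qed

section \<open>Path edges through the head never leave the vertex set\<close>

lemma incid_le: "card {i. i < m \<and> P i} \<le> m"
  using card_mono[of "{..<m}" "{i. i < m \<and> P i}"] by auto

lemma bad_mid: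
  assumes a: "admi vs es" and r: "4 \<le> r" "r < m"
  shows "bad vs es = {}"
proof (rule ccontr)
  assume "bad vs es \<noteq> {}"
  then have b: "1 \<le> card (bad vs es)" using finite_bad by (simp add: Suc_le_eq card_gt_0_iff)
  have "m - card (bad vs es) choose (r - 1) \<le> m - 1 choose (r - 1)"
    using b by (intro binomial_right_mono) auto
  then have "(m choose (r - 1)) + 1 \<le> (m - 1 choose (r - 1)) + m + 1"
    using total_le[OF a] unused_le[OF a] used_bad_le[OF a] incid_le[of "\<lambda>i. hd vs \<in> es ! i"]
    by (simp split: if_splits)
  moreover have "m choose (r - 1) = (m - 1 choose (r - 2)) + (m - 1 choose (r - 1))"
    using choose_pascal[of m "r - 1"] r by (simp add: numeral_2_eq_2 numeral_eq_Suc)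
  moreover have "m - 1 choose 2 \<le> m - 1 choose (r - 2)"
    using r by (intro choose_ge_choose_two) auto
  moreover have "m + 1 \<le> m - 1 choose 2"
  proof -
    obtain q where q: "m = q + 5" using r le_Suc_ex[of 5 m] by (auto simp: add.commute)
    have "2 * (m - 1 choose 2) = (q + 4) * (q + 3)"
      unfolding choose_two_double q by (simp add: algebra_simps)
    then show ?thesis using q by (auto simp: algebra_simps)
  qed
  ultimately show False by linarith
qed


text \<open>For \<open>i \<ge> 1\<close>, a path edge \<open>es ! i\<close> through the head is the
  triple \<open>{vs ! 0, vs ! i, vs ! Suc i}\<close>, so only position 0 can be bad. Then
  \<open>es ! 1\<close> is the only possible member of \<open>wedges (vs ! 0)\<close> through
  \<open>vs ! 1\<close>, and counting leaves \<open>m = 3\<close>. There, explicit paths on four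
  vertices release \<open>es ! 0\<close>.\<close>

lemma bad_three:
  assumes a: "admi vs es" and r: "r = 3"
  shows "bad vs es = {}"
proof (rule ccontr)
  assume nb: "bad vs es \<noteq> {}"
  note d = admD[OF a]
  have l: "vs ! i = vs ! j \<longleftrightarrow> i = j" if "i \<le> m" "j \<le> m" for i j
    using d that by (simp add: nth_eq_iff_index_eq)
  have tri: "es ! i = {vs ! 0, vs ! i, vs ! Suc i}" if "i < m" "1 \<le> i" "vs ! 0 \<in> es ! i" for i
  proof -
    have "{vs ! 0, vs ! i, vs ! Suc i} \<subseteq> es ! i" using adm_edge[OF a that(1)] that by auto
    moreover have "card {vs ! 0, vs ! i, vs ! Suc i} = 3" using that l[of 0 i] l[of 0 "Suc i"] l[of i "Suc i"] by simp
    ultimately show ?thesis using adm_edge(8,9)[OF a that(1)] r by (metis card_subset_eq)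
  qed
  have b0: "bad vs es = {0}"
  proof -
    have "i = 0" if "i \<in> bad vs es" for i
    proof (rule ccontr)
      assume "i \<noteq> 0"
      then have "es ! i = {vs ! 0, vs ! i, vs ! Suc i}" using tri[of i] that d(11) unfolding bad_def by auto
      then have "es ! i \<subseteq> W" using adm_edge(5,6)[OF a, of i] that d(11,12) unfolding bad_def by auto
      then show False using that unfolding bad_def by auto
    qed
    then show ?thesis using nb by auto
  qed
  then have e0: "vs ! 0 \<in> es ! 0" "\<not> es ! 0 \<subseteq> W" "0 < m" using d(11) unfolding bad_def by auto
  have v1W: "vs ! 1 \<in> W" "vs ! 1 \<noteq> vs ! 0" "vs ! 0 \<in> W" using adm_edge[OF a e0(3)] by auto
  let ?G = "{b. b \<subseteq> W - {vs ! 1} \<and> vs ! 0 \<in> b \<and> card b = r}"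
  have cG: "card ?G = m - 1 choose 2"
    using card_subsets_containing[of "W - {vs ! 1}" "vs ! 0" r] v1W finW cardW r by (simp add: numeral_2_eq_2)
  have fG: "finite ?G" using finW by simp
  have sub: "wedges (vs ! 0) \<subseteq> insert (es ! 1) ?G"
  proof
    fix w assume w: "w \<in> wedges (vs ! 0)"
    note dw = wedgesD[OF w]
    show "w \<in> insert (es ! 1) ?G"
    proof (cases "vs ! 1 \<in> w")
      case True
      then have "w \<in> set es" using avoid[OF a, of 0 w] b0 w d(11) by auto
      then obtain i where i: "i < m" "w = es ! i" using d(10) by (metis in_set_conv_nth)
      have "i \<noteq> 0" using i dw e0 by metis
      then have "w = {vs ! 0, vs ! i, vs ! Suc i}" using tri[of i] i dw by auto
      then have "vs ! 1 = vs ! i \<or> vs ! 1 = vs ! Suc i" using True v1W by auto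
      then have "i = 1" using l[of 1 i] l[of 1 "Suc i"] i \<open>i \<noteq> 0\<close> by auto
      then show ?thesis using i by simp
    qed (use dw in auto)
  qed
  have tot: "(m choose 2) + 1 \<le> card (wedges (vs ! 0)) + 2"
    using deg_split[OF a] b0 d(11) r by (simp split: if_splits)
  have "card (wedges (vs ! 0)) \<le> card (insert (es ! 1) ?G)"
    using sub fG by (intro card_mono) auto
  also have "\<dots> \<le> (m - 1 choose 2) + 1" using cG fG by (simp add: card_insert_if)
  finally have wl: "card (wedges (vs ! 0)) \<le> (m - 1 choose 2) + 1" .
  have "m choose 2 = (m - 1) + (m - 1 choose 2)"
    using choose_pascal[of m 2] e0 by simp
  then have m3: "m = 3" using tot wl rm r by simp
  have "(m choose 2) = 3" "m - 1 choose 2 = 1" using m3 by (simp_all add: choose_two)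
  then have w2: "card (wedges (vs ! 0)) = 2" using tot wl by simp
  have G1: "?G = {W - {vs ! 1}}"
  proof -
    have "W - {vs ! 1} \<in> ?G" using v1W cardW finW m3 r by auto
    moreover have "card ?G = 1" using cG \<open>m - 1 choose 2 = 1\<close> by simp
    ultimately show ?thesis by (metis (no_types, lifting) card_1_singletonE singletonD)
  qed
  define h where "h = W - {vs ! 1}"
  have "wedges (vs ! 0) \<subseteq> {es ! 1, h}" using sub unfolding G1 h_def .
  moreover have "card {es ! 1, h} \<le> 2" by (simp add: card_insert_if)
  ultimately have w12: "wedges (vs ! 0) = {es ! 1, h}" using w2 by (intro card_seteq) auto
  have ne: "es ! 1 \<noteq> h" using w2 w12 by auto
  have e1: "es ! 1 \<in> wedges (vs ! 0)" and hw: "h \<in> wedges (vs ! 0)" using w12 by auto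
  have 12: "(1::nat) < m" "(2::nat) < m" using m3 by auto
  have t1: "es ! 1 = {vs ! 0, vs ! 1, vs ! 2}" using tri[of 1] wedgesD(2)[OF e1] 12 by (simp add: numeral_2_eq_2)
  have vs4: "vs = [vs ! 0, vs ! 1, vs ! 2, vs ! 3]"
    using d(9) m3 by (intro nth_equalityI) (auto simp: less_Suc_eq numeral_eq_Suc)
  have es3: "es = [es ! 0, es ! 1, es ! 2]"
    using d(10) m3 by (intro nth_equalityI) (auto simp: less_Suc_eq numeral_eq_Suc)
  have W4: "W = {vs ! 0, vs ! 1, vs ! 2, vs ! 3}" using d(3) vs4 by (metis empty_set list.simps(15))
  have h3: "h = {vs ! 0, vs ! 2, vs ! 3}" unfolding h_def W4
    using l[of 1 0] l[of 1 2] l[of 1 3] m3 by auto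
  have bpv: "bp [vs ! 0, vs ! 1, vs ! 2, vs ! 3] [es ! 0, es ! 1, es ! 2]" using d(1) vs4 es3 by metis
  have dv: "distinct [vs ! 0, vs ! 1, vs ! 2, vs ! 3]" using d(2) vs4 by metis
  have de: "distinct [es ! 0, es ! 1, es ! 2]" using d(5) es3 by metis
  have lz: "vs ! 3 = z" using d(4) vs4 by (metis last.simps list.distinct(1))
  have Wh: "es ! 0 \<noteq> w" if "w \<in> wedges x" for w x using that wedgesD(3) e0(2) by auto
  have E: "es ! 0 \<in> E" "es ! 1 \<in> E" "es ! 2 \<in> E" "es ! 0 \<noteq> x0" "es ! 1 \<noteq> x0" "es ! 2 \<noteq> x0"
    "es ! 2 \<in> F \<union> Pow W"
    using adm_edge(1,2)[OF a, of 0] adm_edge(1,2)[OF a, of 1] adm_edge(1,2)[OF a, of 2] adm_edge(10)[OF a, of 2]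
      d(8) m3 by auto
  show False
  proof (cases "h \<in> set es")
    case False
    have hn: "h \<noteq> es ! 2" using False adm_edge(10)[OF a 12(2)] by auto
    \<comment> \<open>The first two vertices change places; \<open>es ! 1\<close> and the free
      triple \<open>h\<close> do the work of \<open>es ! 0\<close> and \<open>es ! 1\<close>, so
      \<open>es ! 0\<close> is released at the new head.\<close>
    have "admi [vs ! 1, vs ! 0, vs ! 2, vs ! 3] [es ! 1, h, es ! 2]"
      unfolding adm_def
    proof (intro conjI)
      show "bp [vs ! 1, vs ! 0, vs ! 2, vs ! 3] [es ! 1, h, es ! 2]" using bpv t1 h3 by simp
      show "distinct [vs ! 1, vs ! 0, vs ! 2, vs ! 3]" using dv by auto
      show "set [vs ! 1, vs ! 0, vs ! 2, vs ! 3] = W" unfolding W4 by auto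
      show "last [vs ! 1, vs ! 0, vs ! 2, vs ! 3] = z" using lz by simp
      show "distinct [es ! 1, h, es ! 2]" using ne hn de by simp
      show "set [es ! 1, h, es ! 2] \<subseteq> E" using E wedgesD(1)[OF hw] by simp
      show "x0 \<notin> set [es ! 1, h, es ! 2]" using E wedgesD(4)[OF hw] by auto
      show "set [es ! 1, h, es ! 2] \<subseteq> F \<union> Pow W" using E wedgesD(3)[OF hw] wedgesD(3)[OF e1] by auto
    qed
    then have "es ! 0 \<subseteq> W" by (rule trap) (use bpv de E Wh[OF hw] in auto)
    then show False using e0 by simp
  next
    case True
    then have h2: "h = es ! 2" using Wh[OF hw] ne es3 by (metis empty_iff insert_iff list.set)
    \<comment> \<open>Since \<open>h\<close> is on the path, a further free edge is needed. After
      the rotation with \<open>es ! 2\<close> the head \<open>vs ! 2\<close> has no bad edge, so all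
      three triples of \<open>W\<close> through it are present;
      \<open>{vs ! 1, vs ! 2, vs ! 3}\<close> is the free one.\<close>
    have "vs ! 0 \<in> es ! 2" using h2 h3 by auto
    note ro = rotate_own[OF a 12(2), unfolded d(11), OF this]
    let ?vs = "rev (take (Suc 2) vs) @ drop (Suc 2) vs" and ?es = "rev (take 2 es) @ es ! 2 # drop (Suc 2) es"
    have n2: "vs ! 2 \<notin> es ! 0"
    proof
      assume "vs ! 2 \<in> es ! 0"
      then have "{vs ! 0, vs ! 1, vs ! 2} \<subseteq> es ! 0" using bpv by auto
      moreover have "card {vs ! 0, vs ! 1, vs ! 2} = 3" using dv by auto
      ultimately have "es ! 0 = {vs ! 0, vs ! 1, vs ! 2}"
        using adm_edge(8,9)[OF a e0(3)] r by (metis card_subset_eq)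
      then show False using e0 W4 by auto
    qed
    have "bad ?vs ?es = {}" unfolding ro(4)
      using n2 t1 h2 h3 W4 m3 by (auto simp: less_Suc_eq numeral_eq_Suc)
    then have "3 \<le> card (wedges (vs ! 2))"
      using deg_split[OF ro(1)] ro(2) r \<open>(m choose 2) = 3\<close> by (simp split: if_splits)
    then have "wedges (vs ! 2) = alls (vs ! 2)"
      using card_alls[of "vs ! 2"] W4 r \<open>(m choose 2) = 3\<close> by (intro card_seteq[OF finite_alls wedges_sub]) auto
    moreover have "{vs ! 1, vs ! 2, vs ! 3} \<in> alls (vs ! 2)" unfolding alls_def using W4 dv r by auto
    ultimately have k: "{vs ! 1, vs ! 2, vs ! 3} \<in> wedges (vs ! 2)" by simp
    have ns: "{vs ! 1, vs ! 2, vs ! 3} \<noteq> es ! 1" "{vs ! 1, vs ! 2, vs ! 3} \<noteq> es ! 2"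
      using t1 h2 h3 dv by auto
    have "admi [vs ! 0, vs ! 1, vs ! 2, vs ! 3] [es ! 1, {vs ! 1, vs ! 2, vs ! 3}, es ! 2]"
      (is "admi ?v [_, ?k, _]")
      unfolding adm_def
    proof (intro conjI)
      show "bp ?v [es ! 1, ?k, es ! 2]" using bpv t1 by simp
      show "distinct ?v" using dv by auto
      show "set ?v = W" unfolding W4 by auto
      show "last ?v = z" using lz by simp
      show "distinct [es ! 1, ?k, es ! 2]" using ns de by auto
      show "set [es ! 1, ?k, es ! 2] \<subseteq> E" using E wedgesD(1)[OF k] by simp
      show "x0 \<notin> set [es ! 1, ?k, es ! 2]" using E wedgesD(4)[OF k] by auto
      show "set [es ! 1, ?k, es ! 2] \<subseteq> F \<union> Pow W" using E wedgesD(3)[OF k] wedgesD(3)[OF e1] by auto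
    qed
    then have "es ! 0 \<subseteq> W" by (rule trap) (use bpv de E Wh[OF k] in auto)
    then show False using e0 by simp
  qed
qed

lemma bad_large:
  assumes a: "admi vs es" and r: "r = m" "4 \<le> m"
  shows "bad vs es = {}"
proof (rule ccontr)
  assume nb: "bad vs es \<noteq> {}"
  note d = admD[OF a]
  have l: "vs ! i = vs ! j \<longleftrightarrow> i = j" if "i \<le> m" "j \<le> m" for i j
    using d that by (simp add: nth_eq_iff_index_eq)
  have vW: "vs ! i \<in> W" if "i \<le> m" for i using d(3)[symmetric] d(9) that by auto
  have cm: "m choose (r - 1) = m" using r by (cases m) auto
  have co: "w = W - {x}" if "w \<subseteq> W" "card w = r" "x \<in> W" "x \<notin> w" for w x
    using that cardW finW r by (intro card_subset_eq) auto
  have eW: "e = (\<lambda>i. vs ! i) ` {..<m}" if "e \<in> E" "\<forall>i < m. vs ! i \<in> e" for e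
  proof -
    have "inj_on (\<lambda>i. vs ! i) {..<m}" using l by (auto simp: inj_on_def)
    then have "card ((\<lambda>i. vs ! i) ` {..<m}) = m" by (simp add: card_image)
    moreover have "(\<lambda>i. vs ! i) ` {..<m} \<subseteq> e" using that by auto
    moreover have "card e = m" "finite e" using unif[OF that(1)] r by (auto intro: card_ge_0_finite)
    ultimately show ?thesis by (metis card_subset_eq)
  qed
  have eW2: "e \<subseteq> W" if "e \<in> E" "\<forall>i < m. vs ! i \<in> e" for e
    using eW[OF that] vW by auto
  show False
  proof (cases "wedges (hd vs) - set es = {}")
    case True
    have s: "m + 1 \<le> card (wedges (hd vs) \<inter> set es) + card (bad vs es) + 1"
    proof -
      have "card (wedges (hd vs) - set es) = 0" by (simp only: True card.empty)
      then show ?thesis using total_le[OF a] cm by (simp split: if_splits)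
    qed
    have ball: "hd vs \<in> es ! i" if "i < m" for i
    proof -
      have "card {i. i < m \<and> hd vs \<in> es ! i} = card {..<m}"
        using s used_bad_le[OF a] incid_le[of "\<lambda>i. hd vs \<in> es ! i"] by simp
      moreover have "{i. i < m \<and> hd vs \<in> es ! i} \<subseteq> {..<m}" by auto
      ultimately have "{i. i < m \<and> hd vs \<in> es ! i} = {..<m}" by (intro card_subset_eq) auto
      then show ?thesis using that by auto
    qed
    have nv0: "vs ! 0 \<notin> w" if "w \<in> wedges x" "w \<notin> set es" for w x
    proof
      assume "vs ! 0 \<in> w"
      then have "w \<in> wedges (hd vs) - set es" using that d(11) unfolding wedges_def by auto
      then show False using True by auto
    qed
    define BB where "BB = {l. l < m \<and> \<not> es ! l \<subseteq> W}"
    have BB: "bad vs es = BB" unfolding bad_def BB_def using ball by auto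
    have fBB: "finite BB" unfolding BB_def by auto
    show False
    proof (cases "card BB = 1")
      case True
      then obtain j where j: "BB = {j}" by (rule card_1_singletonE)
      then have jm: "j < m" "\<not> es ! j \<subseteq> W" unfolding BB_def by auto
      have good: "es ! i \<subseteq> W" if "i < m" "i \<noteq> j" for i using that j unfolding BB_def by auto
      \<comment> \<open>An edge containing the first \<open>m = r\<close> vertices would consist of
        them and lie inside \<open>W\<close>. At the head \<open>vs ! i\<close> nothing is bad, so
        all \<open>m\<close> possible subsets are edges, in particular
        \<open>W - {vs ! 0}\<close>.\<close>
      obtain i where i: "i < m" "vs ! i \<notin> es ! j" using eW2[of "es ! j"] adm_edge(1)[OF a jm(1)] jm by auto
      note ro = rotate_own[OF a i(1) ball[OF i(1)]]
      let ?vs = "rev (take (Suc i) vs) @ drop (Suc i) vs" and ?es = "rev (take i es) @ es ! i # drop (Suc i) es"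
      have "bad ?vs ?es = {}" unfolding ro(4) using good i by metis
      then have "m \<le> card (wedges (vs ! i))"
        using deg_split[OF ro(1)] ro(2) cm by (simp split: if_splits)
      then have wa: "wedges (vs ! i) = alls (vs ! i)"
        using card_alls[of "vs ! i"] vW[of i] i cm by (intro card_seteq[OF finite_alls wedges_sub]) auto
      define y where "y = W - {vs ! 0}"
      have "vs ! i \<noteq> vs ! 0" using i ball[OF jm(1)] d(11) by auto
      then have "y \<in> alls (vs ! i)" unfolding alls_def y_def using vW[of i] vW[of 0] cardW finW i r by auto
      then have yw: "y \<in> wedges (vs ! i)" using wa by simp
      note dy = wedgesD[OF yw]
      have yn: "y \<notin> set es" using ball d(10,11) unfolding y_def by (metis Diff_iff in_set_conv_nth singletonI)
      have yv: "vs ! l \<in> y" if "1 \<le> l" "l \<le> m" for l unfolding y_def using vW[of l] l[of l 0] that by auto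
      show False
      proof (cases "j = 0")
        case False
        have n: "admi vs (es[j := y])"
          using yv jm False dy yn by (intro adm_update[OF a]) auto
        have "es ! j \<subseteq> W"
          using trap[OF n] not_in_update[OF a jm(1), of y] adm_edge(1,2,10)[OF a jm(1)] ball[OF jm(1)] yn by metis
        then show False using jm by simp
      next
        case True
        \<comment> \<open>\<open>y\<close> misses \<open>vs ! 0\<close> and cannot replace
          \<open>es ! 0\<close> directly. After exchanging the first two vertices, \<open>y\<close>,
          \<open>es ! 2\<close> and \<open>es ! 1\<close> go to positions 2, 1 and 0 in turn: each
          frees the edge that moves next, and the last move frees \<open>es ! 0\<close>.\<close>
        have m2: "0 < m" "1 < m" "2 < m" using r by auto
        define v where "v = rev (take (Suc 1) vs) @ drop (Suc 1) vs"
        define e where "e = rev (take 1 es) @ es ! 1 # drop (Suc 1) es"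
        note ro = rotate_own[OF a m2(2) ball[OF m2(2)], folded v_def e_def]
        have ve: "length v = Suc m" "length e = m" using admD(9,10)[OF ro(1)] by auto
        have v0: "v ! 0 = vs ! 1" "v ! 1 = vs ! 0" "v ! 2 = vs ! 2" "v ! 3 = vs ! 3"
          using d(9) m2 by (auto simp: v_def nth_append take_Suc_conv_app_nth numeral_eq_Suc rev_nth)
        have e0: "e ! 0 = es ! 0" "e ! 1 = es ! 1" "e ! 2 = es ! 2"
          using d(10) m2 by (auto simp: e_def nth_append take_Suc_conv_app_nth numeral_eq_Suc)
        note E0 = adm_edge[OF a m2(1)] and E1 = adm_edge[OF a m2(2)] and E2 = adm_edge[OF a m2(3)]
        have dist: "es ! 0 \<noteq> es ! 1" "es ! 0 \<noteq> es ! 2" "es ! 1 \<noteq> es ! 2"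
          using d(5,10) m2 by (auto simp: nth_eq_iff_index_eq)
        have F1: "es ! 1 \<in> F \<union> Pow W" "es ! 2 \<in> F \<union> Pow W" using E1(10) E2(10) d(8) by blast+
        have 1: "admi v (e[2 := y])"
          using yv[of 2] yv[of 3] v0 m2 dy yn ro(3) by (intro adm_update[OF ro(1)]) (auto simp: numeral_eq_Suc)
        have s1: "set (e[2 := y]) = insert y (set es - {es ! 2})"
          using update_set_edges[of e 2 y] admD(5)[OF ro(1)] ve m2 e0 ro(3) by simp
        have i1: "e[2 := y] ! 1 = es ! 1" "e[2 := y] ! 0 = es ! 0" using e0 ve m2 by (auto simp: nth_list_update)
        have 2: "admi v (e[2 := y, 1 := es ! 2])"
        proof (rule adm_update[OF 1 m2(2)])
          show "v ! 1 \<in> es ! 2" using v0 ball[OF m2(3)] d(11) by simp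
          show "v ! Suc 1 \<in> es ! 2" using v0 E2(3) by (simp add: numeral_eq_Suc)
          show "es ! 2 \<notin> set (e[2 := y]) - {e[2 := y] ! 1}" unfolding s1 using yn E2(10) by auto
        qed (use E2 F1 in auto)
        have s2: "set (e[2 := y, 1 := es ! 2]) = insert (es ! 2) (insert y (set es - {es ! 2}) - {es ! 1})"
          using update_set_edges[of "e[2 := y]" 1 "es ! 2"] admD(5)[OF 1] ve m2 i1 s1 by simp
        have i2: "e[2 := y, 1 := es ! 2] ! 0 = es ! 0" using i1 ve m2 by (auto simp: nth_list_update)
        have 3: "admi v (e[2 := y, 1 := es ! 2, 0 := es ! 1])"
        proof (rule adm_update[OF 2 m2(1)])
          show "v ! 0 \<in> es ! 1" using v0 E1 by simp
          show "v ! Suc 0 \<in> es ! 1" using v0 ball[OF m2(2)] d(11) by simp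
          show "es ! 1 \<notin> set (e[2 := y, 1 := es ! 2]) - {e[2 := y, 1 := es ! 2] ! 0}"
            unfolding s2 using dist yn E1(10) by auto
        qed (use E1 F1 in auto)
        have s3: "es ! 0 \<notin> set (e[2 := y, 1 := es ! 2, 0 := es ! 1])"
          using not_in_update[OF 2 m2(1), of "es ! 1"] i2 dist by metis
        have "hd v \<in> es ! 0" using ro(2) E0 by simp
        then have "es ! 0 \<subseteq> W" using trap[OF 3 E0(1) s3 E0(2)] by simp
        then show False using jm True by simp
      qed
    next
      case False
      then have b2: "2 \<le> card BB" using nb BB fBB by (metis One_nat_def Suc_leI card_gt_0_iff le_neq_implies_less numeral_2_eq_2)
      have use_le: "card (wedges x \<inter> set es) \<le> m - card BB" for x
      proof -
        have "wedges x \<inter> set es \<subseteq> (!) es ` ({..<m} - BB)"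
          unfolding BB_def using d(10) wedgesD(3) by (fastforce simp: in_set_conv_nth)
        then have "card (wedges x \<inter> set es) \<le> card ({..<m} - BB)" by (intro surj_card_le) auto
        also have "\<dots> = m - card BB" unfolding BB_def by (subst card_Diff_subset) auto
        finally show ?thesis .
      qed
      have key: "(\<forall>l < m. vs ! i \<in> es ! l) \<or> (vs ! i \<in> es ! 0 \<and> \<not> es ! 0 \<subseteq> W)" if im: "i < m" for i
      proof -
        note ro = rotate_own[OF a im ball[OF im]]
        let ?vs = "rev (take (Suc i) vs) @ drop (Suc i) vs" and ?es = "rev (take i es) @ es ! i # drop (Suc i) es"
        have tl: "m + 1 \<le> card (wedges (vs ! i) - set es) + card (wedges (vs ! i) \<inter> set es) + card (bad ?vs ?es) + 1"
          using total_le[OF ro(1)] unfolding ro(2,3) cm by (simp split: if_splits)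
        show ?thesis
        proof (cases "wedges (vs ! i) - set es = {}")
          case True
          have "card (wedges (vs ! i) - set es) = 0" by (simp only: True card.empty)
          then have "m \<le> card {l. l < m \<and> vs ! i \<in> ?es ! l}"
            using tl used_bad_le[OF ro(1)] unfolding ro(2,3) by linarith
          then have "{l. l < m \<and> vs ! i \<in> ?es ! l} = {..<m}"
            by (intro card_seteq) auto
          then have al: "vs ! i \<in> ?es ! l" if "l < m" for l using that by blast
          have "vs ! i \<in> es ! l" if "l < m" for l
          proof -
            have "es ! l \<in> set ?es" unfolding ro(3) using d(10) that by simp
            then obtain l' where "l' < m" "?es ! l' = es ! l" using admD(10)[OF ro(1)] by (metis in_set_conv_nth)
            then show ?thesis using al[of l'] by simp
          qed
          then show ?thesis by blast
        next
          case False
          then obtain w where w: "w \<in> wedges (vs ! i)" "w \<notin> set es" by auto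
          have wW: "w = W - {vs ! 0}" if "w \<in> wedges (vs ! i)" "w \<notin> set es" for w
            using co[of w "vs ! 0"] wedgesD[OF that(1)] nv0[OF that] vW[of 0] by auto
          have "wedges (vs ! i) - set es \<subseteq> {W - {vs ! 0}}" using wW by auto
          then have "card (wedges (vs ! i) - set es) \<le> 1" using card_mono[of "{W - {vs ! 0}}"] by fastforce
          then have "1 \<le> card (bad ?vs ?es)" using tl use_le[of "vs ! i"] b2 r by linarith
          then obtain q where q: "q \<in> bad ?vs ?es" by (metis card.empty ex_in_conv not_one_le_zero)
          have qm: "q < m" "vs ! i \<in> ?es ! q" "\<not> ?es ! q \<subseteq> W" using q ro(2) unfolding bad_def by auto
          have "?vs ! Suc q \<notin> w" using avoid[OF ro(1) q] w unfolding ro(2,3) by simp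
          then have "?vs ! Suc q = vs ! 0" using wW[OF w] adm_edge(6)[OF ro(1) qm(1)] by auto
          moreover have "?vs ! i = vs ! 0" using im d(9) by (simp add: nth_append rev_nth)
          ultimately have "Suc q = i" using admD(2,9)[OF ro(1)] qm im by (metis Suc_less_eq less_SucI nth_eq_iff_index_eq)
          moreover then have "?es ! q = es ! 0" using im d(10) by (auto simp: nth_append rev_nth)
          ultimately show ?thesis using qm by simp
        qed
      qed
      show False
      proof (cases "\<forall>i < m. \<forall>l < m. vs ! i \<in> es ! l")
        case True
        then have "es ! 0 = es ! 1" using eW[of "es ! 0"] eW[of "es ! 1"] adm_edge(1)[OF a, of 0] adm_edge(1)[OF a, of 1] r by simp
        then show False using d(5,10) r by (simp add: nth_eq_iff_index_eq)
      next
        case False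
        then have nW: "\<not> es ! 0 \<subseteq> W" using key by blast
        have "\<forall>i < m. vs ! i \<in> es ! 0" using key r by (metis less_le_trans zero_less_numeral)
        then show False using eW2[of "es ! 0"] adm_edge(1)[OF a, of 0] nW r by auto
      qed
    qed
  next
    case False
    then obtain w where w: "w \<in> wedges (hd vs)" "w \<notin> set es" by auto
    note dw = wedgesD[OF w(1)]
    have wW: "w' = W - {vs ! Suc j}" if "w' \<in> wedges (hd vs)" "w' \<notin> set es" "j \<in> bad vs es" for w' j
      using co[of w' "vs ! Suc j"] wedgesD[OF that(1)] avoid[OF a that(3,1,2)] adm_edge(6)[OF a, of j] that(3)
      unfolding bad_def by auto
    obtain j where j: "j \<in> bad vs es" using nb by auto
    then have jm: "j < m" "hd vs \<in> es ! j" "\<not> es ! j \<subseteq> W" unfolding bad_def by auto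
    have wj: "w = W - {vs ! Suc j}" by (rule wW[OF w j])
    have wv: "vs ! i \<in> w" if "i \<le> m" "i \<noteq> Suc j" for i
      unfolding wj using vW[OF that(1)] l[of i "Suc j"] that jm by auto
    \<comment> \<open>Substituting \<open>w\<close> for \<open>es ! i\<close> keeps the head and
      releases \<open>es ! i\<close>. This edge must lie inside \<open>W\<close> and miss
      \<open>vs ! Suc j\<close>, which leaves only \<open>w\<close> itself.\<close>
    have repl: False if i: "i < m" "i \<noteq> j" "vs ! i \<in> w" "vs ! Suc i \<in> w" "hd vs \<in> es ! i" for i
    proof -
      have n: "admi vs (es[i := w])"
        using i dw w by (intro adm_update[OF a]) auto
      have ne: "w \<noteq> es ! i" using w adm_edge(10)[OF a i(1)] by auto
      note ni = not_in_update[OF a i(1) ne]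
      have eiW: "es ! i \<subseteq> W" using trap[OF n adm_edge(1)[OF a i(1)] ni adm_edge(2)[OF a i(1)]] i by simp
      then have "es ! i \<in> wedges (hd vs)" using adm_edge(1,2)[OF a i(1)] i unfolding wedges_def by auto
      moreover have "j \<in> bad vs (es[i := w])" unfolding bad_def using jm i by auto
      ultimately have "vs ! Suc j \<notin> es ! i" using avoid[OF n] ni by blast
      then have "es ! i = W - {vs ! Suc j}" using co[of "es ! i" "vs ! Suc j"] eiW adm_edge(8)[OF a i(1)] vW[of "Suc j"] jm by auto
      then show False using ne wj by simp
    qed
    have j0: "j = 0"
    proof (rule ccontr)
      assume "j \<noteq> 0"
      then show False using repl[of 0] wv[of 0] wv[of 1] adm_edge(3)[OF a, of 0] d(11) r by simp
    qed
    have inc: "{i. i < m \<and> hd vs \<in> es ! i} \<subseteq> {0, 1}"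
    proof -
      have "i \<le> 1" if "i < m" "hd vs \<in> es ! i" for i
      proof (rule ccontr)
        assume "\<not> i \<le> 1"
        then show False using repl[of i] wv[of i] wv[of "Suc i"] that j0 by simp
      qed
      then show ?thesis by (auto simp: le_Suc_eq)
    qed
    have "card {i. i < m \<and> hd vs \<in> es ! i} \<le> card {0, 1::nat}"
      by (rule card_mono[OF _ inc]) simp
    then have c2: "card {i. i < m \<and> hd vs \<in> es ! i} \<le> 2" by simp
    have "wedges (hd vs) - set es \<subseteq> {w}" using wW[OF _ _ j] wj by auto
    then have "card (wedges (hd vs) - set es) \<le> 1" using card_mono[of "{w}"] by fastforce
    then show False using total_le[OF a] used_bad_le[OF a] c2 cm r by (simp split: if_splits)
  qed
qed

lemma no_bad: "admi vs es \<Longrightarrow> bad vs es = {}"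
proof -
  assume a: "admi vs es"
  consider "r = 3" | "4 \<le> r" "r < m" | "r = m" "4 \<le> m" using r3 rm by linarith
  then show ?thesis using bad_mid[OF a] bad_three[OF a] bad_large[OF a] by cases auto
qed

text \<open>Without bad edges the degree is reached only if every \<open>r\<close>-subset of
  \<open>W\<close> through the head is an edge other than \<open>x0\<close> and \<open>x0\<close>
  contains the head too. Every vertex of \<open>W\<close> except \<open>z\<close> can be made the
  head, so \<open>x0\<close> has \<open>m \<ge> r\<close> vertices in \<open>W\<close>. Then
  \<open>x0\<close> lies inside \<open>W\<close> and would itself be one of those subsets.\<close>

lemma no_adm: "\<not> admi vs es"
proof
  assume a: "admi vs es"
  have full: "wedges (hd us) = alls (hd us)" "x0 \<in> E" "hd us \<in> x0" if u: "admi us fs" for us fs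
  proof -
    have b: "card (bad us fs) = 0" using no_bad[OF u] by simp
    note ds = deg_split[OF u, unfolded b] and cl = card_wedges_le[OF admD(12)[OF u]]
    show "x0 \<in> E" "hd us \<in> x0" using ds cl by (auto split: if_splits)
    have "card (alls (hd us)) \<le> card (wedges (hd us))"
      using ds card_alls[OF admD(12)[OF u]] by (auto split: if_splits)
    then show "wedges (hd us) = alls (hd us)" by (intro card_seteq[OF finite_alls wedges_sub]) auto
  qed
  note d = admD[OF a] and f = full[OF a]
  have l: "vs ! i = vs ! j \<longleftrightarrow> i = j" if "i \<le> m" "j \<le> m" for i j
    using d that by (simp add: nth_eq_iff_index_eq)
  have vW: "vs ! i \<in> W" if "i \<le> m" for i using d(3)[symmetric] d(9) that by auto
  have m: "0 < m" using r3 rm by simp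
  have fx: "finite x0" "card x0 = r" using unif[OF f(2)] r3 by (auto intro: card_ge_0_finite)
  have nW: "\<not> x0 \<subseteq> W"
  proof
    assume "x0 \<subseteq> W"
    then have "x0 \<in> alls (hd vs)" unfolding alls_def using f fx by auto
    then have "x0 \<in> wedges (hd vs)" using f by simp
    then show False unfolding wedges_def by simp
  qed
  have "\<exists>us fs. admi us fs \<and> hd us = vs ! i" if i: "i < m" for i
  proof (cases "hd vs \<in> es ! i")
    case True
    then show ?thesis using rotate_own[OF a i] by blast
  next
    case False
    then have i0: "i \<noteq> 0" using adm_edge(3)[OF a m] d(11) by metis
    let ?D = "{w. w \<subseteq> W - {vs ! 0} \<and> vs ! Suc i \<in> w \<and> card w = r - 1}"
    let ?S = "{w \<in> wedges (hd vs). vs ! Suc i \<in> w}"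
    have rot: ?thesis if "admi vs fs" "x \<in> wedges (hd vs)" "vs ! Suc i \<in> x" "x \<notin> set fs - {fs ! i}" for x fs
    proof -
      have "admi (rev (take (Suc i) vs) @ drop (Suc i) vs) (rev (take i fs) @ x # drop (Suc i) fs)"
        using wedgesD[OF that(2)] that i by (intro adm_rotate[OF that(1)]) auto
      then show ?thesis using rotate_hd[of i vs] i d by auto
    qed
    show ?thesis
    proof (cases "\<exists>x \<in> ?S. x \<notin> set es - {es ! i}")
      case True
      then show ?thesis using rot[OF a] by auto
    next
      case False
      \<comment> \<open>All edges inside \<open>W\<close> through the head and
        \<open>vs ! Suc i\<close> stand on the path at positions other than \<open>i\<close>. There
        are at least \<open>m - 1\<close> of them, so they are all the other path edges. A subset
        \<open>y\<close> through the first two vertices that misses \<open>vs ! Suc i\<close> is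
        then free to replace \<open>es ! 0\<close>, and \<open>es ! 0\<close> serves for the
        rotation.\<close>
      have "card ((\<lambda>w. insert (vs ! 0) w) ` ?D) = card ?D"
        by (intro card_image inj_onI) auto
      moreover have "card ?D = m - 1 choose (r - 2)"
        using card_subsets_containing[of "W - {vs ! 0}" "vs ! Suc i" "r - 1"] finW vW[of 0] vW[of "Suc i"] l[of 0 "Suc i"]
          i cardW r3 by (simp add: numeral_2_eq_2)
      moreover have "m - 1 \<le> m - 1 choose (r - 2)"
        using r3 rm by (intro choose_ge_self) auto
      moreover have "(\<lambda>w. insert (vs ! 0) w) ` ?D \<subseteq> ?S"
      proof
        fix y assume "y \<in> (\<lambda>w. insert (vs ! 0) w) ` ?D"
        then obtain w where w: "y = insert (vs ! 0) w" "w \<subseteq> W - {vs ! 0}" "vs ! Suc i \<in> w" "card w = r - 1" by auto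
        have "finite w" "vs ! 0 \<notin> w" using w finW by (auto intro: finite_subset)
        then have "y \<in> alls (hd vs)" unfolding alls_def using w d(11) vW[of 0] r3 by auto
        then show "y \<in> ?S" using f w by auto
      qed
      moreover have fS: "finite ?S" using finite_wedges by simp
      ultimately have c1: "m - 1 \<le> card ?S" using card_mono[OF fS] by (metis (no_types, lifting) order_trans)
      have sub: "?S \<subseteq> (!) es ` ({..<m} - {i})"
      proof
        fix x assume "x \<in> ?S"
        then have "x \<in> set es - {es ! i}" using False by auto
        then obtain j where "j < m" "es ! j = x" "j \<noteq> i" using d(10) by (auto simp: in_set_conv_nth)
        then show "x \<in> (!) es ` ({..<m} - {i})" by auto
      qed
      have "card ((!) es ` ({..<m} - {i})) \<le> m - 1"
        using card_image_le[of "{..<m} - {i}" "(!) es"] i by simp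
      then have "?S = (!) es ` ({..<m} - {i})" using sub c1 by (intro card_seteq) auto
      then have S: "es ! j \<in> ?S" if "j < m" "j \<noteq> i" for j using that by auto
      then have e0: "es ! 0 \<in> wedges (hd vs)" "vs ! Suc i \<in> es ! 0" using m i0 by auto
      have "vs ! 0 \<noteq> vs ! 1" "vs ! 0 \<in> W - {vs ! Suc i}" "vs ! 1 \<in> W - {vs ! Suc i}"
        using l[of 0 1] l[of 0 "Suc i"] l[of 1 "Suc i"] vW[of 0] vW[of 1] i i0 m by auto
      then have "{vs ! 0, vs ! 1} \<subseteq> W - {vs ! Suc i}" "card {vs ! 0, vs ! 1} = 2" by auto
      moreover have "card (W - {vs ! Suc i}) = m" using cardW finW vW[of "Suc i"] i by simp
      ultimately obtain y where y: "{vs ! 0, vs ! 1} \<subseteq> y" "y \<subseteq> W - {vs ! Suc i}" "card y = r"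
        using exists_subset_between[of "{vs ! 0, vs ! 1}" r "W - {vs ! Suc i}"] r3 rm finW by auto
      then have "y \<in> alls (hd vs)" unfolding alls_def using d(11) by auto
      then have yw: "y \<in> wedges (hd vs)" using f by simp
      have yn: "y \<notin> set es"
      proof
        assume "y \<in> set es"
        then obtain j where "j < m" "es ! j = y" using d(10) by (auto simp: in_set_conv_nth)
        then have "vs ! Suc i \<in> y" using S[of j] adm_edge(4)[OF a i] by (cases "j = i") auto
        then show False using y by auto
      qed
      have n: "admi vs (es[0 := y])"
        using y yn wedgesD[OF yw] m by (intro adm_update[OF a]) auto
      have "es ! 0 \<notin> set (es[0 := y])" using not_in_update[OF a m, of y] yn adm_edge(10)[OF a m] by metis
      then show ?thesis using rot[OF n e0] by auto
    qed
  qed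
  then have "vs ! i \<in> x0" if "i < m" for i using full(3) that by metis
  then have "(\<lambda>i. vs ! i) ` {..<m} \<subseteq> x0 \<inter> W" using vW by auto
  then have "card ((\<lambda>i. vs ! i) ` {..<m}) \<le> card (x0 \<inter> W)" using fx by (intro card_mono) auto
  moreover have "card ((\<lambda>i. vs ! i) ` {..<m}) = m" using l by (subst card_image) (auto simp: inj_on_def)
  moreover have "card (x0 \<inter> W) < r" using nW fx by (metis inf.cobounded1 inf.absorb_iff1 psubsetI psubset_card_mono)
  ultimately show False using rm by simp
qed

end

text \<open>Used twice: on the start of a longest path, where \<open>g\<close> may be a later path
  edge, and with \<open>x0 = {}\<close> on an outside path extended by one cycle vertex.\<close>

theorem escape:
  fixes E :: "'a set set"
  assumes "finite E" "\<And>e. e \<in> E \<Longrightarrow> card e = r" "3 \<le> r" "r \<le> m"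
    and deg: "\<And>x. x \<in> set vs \<Longrightarrow> (m choose (r - 1)) + 1 \<le> card {e \<in> E. x \<in> e}"
    and p: "bp vs es" "distinct vs" "length vs = Suc m" "distinct es" "set es \<subseteq> E" "x0 \<notin> set es"
  shows "\<exists>us fs g. bp us fs \<and> distinct us \<and> set us = set vs \<and> last us = last vs \<and> distinct fs \<and>
     set fs \<subseteq> E \<and> x0 \<notin> set fs \<and> set fs \<subseteq> set es \<union> Pow (set vs) \<and>
     g \<in> E \<and> g \<notin> set fs \<and> g \<noteq> x0 \<and> hd us \<in> g \<and> \<not> g \<subseteq> set vs"
proof (rule ccontr)
  assume n: "\<not> ?thesis"
  interpret trapped E "set vs" "last vs" x0 "set es" r m
  proof
    show "card (set vs) = Suc m" using p distinct_card by metis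
    show "g \<subseteq> set vs" if "adm E (set vs) (last vs) x0 (set es) us fs" "g \<in> E" "g \<notin> set fs" "g \<noteq> x0" "hd us \<in> g" for us fs g
      using n that unfolding adm_def by blast
  qed (use assms in auto)
  have "admi vs es" unfolding adm_def using p by auto
  then show False using no_adm by simp
qed

section \<open>Cycles closed from longest paths\<close>

locale hyper =
  fixes V :: "'a set" and E :: "'a set set" and r :: nat
  assumes finV: "finite V" and subV: "e \<in> E \<Longrightarrow> e \<subseteq> V" and unif: "e \<in> E \<Longrightarrow> card e = r" and r3: "3 \<le> r"
begin

lemma finE: "finite E"
  using finV subV by (meson PowI finite_Pow_iff finite_subset subsetI)

lemma finite_edge: "e \<in> E \<Longrightarrow> finite e"
  using finV subV by (meson finite_subset)

definition bpath :: "'a list \<Rightarrow> 'a set list \<Rightarrow> bool" where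
  "bpath vs es \<longleftrightarrow> bp vs es \<and> distinct vs \<and> set vs \<subseteq> V \<and> distinct es \<and> set es \<subseteq> E"

definition longest :: "'a list \<Rightarrow> 'a set list \<Rightarrow> bool" where
  "longest vs es \<longleftrightarrow> bpath vs es \<and> (\<forall>us fs. bpath us fs \<longrightarrow> length us \<le> length vs)"

definition short_cycles :: "nat \<Rightarrow> bool" where
  "short_cycles c \<longleftrightarrow> (\<forall>vs es. berge_cycle V E vs es \<longrightarrow> length vs \<le> c)"

lemma bpathD:
  assumes "bpath vs es"
  shows "bp vs es" "distinct vs" "set vs \<subseteq> V" "distinct es" "set es \<subseteq> E" "length vs = Suc (length es)"
    "hd vs = vs ! 0" "vs \<noteq> []"
  using assms bp_length[of vs es] bp_not_Nil[of vs es] unfolding bpath_def by (auto simp: hd_conv_nth)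

lemma longestD: "longest vs es \<Longrightarrow> bpath vs es"
  "longest vs es \<Longrightarrow> bpath us fs \<Longrightarrow> length us \<le> length vs"
  unfolding longest_def by auto

lemma longest_sameI: "longest vs es \<Longrightarrow> bpath us fs \<Longrightarrow> length us = length vs \<Longrightarrow> longest us fs"
  unfolding longest_def by auto

lemma ex_longest:
  assumes "V \<noteq> {}"
  shows "\<exists>vs es. longest vs es"
proof -
  obtain x where "x \<in> V" using assms by auto
  then have "bpath [x] []" unfolding bpath_def by simp
  then have "\<exists>es. bpath [x] es" by auto
  moreover have "\<forall>vs. (\<exists>es. bpath vs es) \<longrightarrow> length vs < Suc (card V)"
  proof (clarsimp simp: less_Suc_eq_le)
    fix vs es assume "bpath vs es"
    then show "length vs \<le> card V" using bpathD(2,3) finV by (metis card_mono distinct_card)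
  qed
  ultimately have "\<exists>vs. (\<exists>es. bpath vs es) \<and> (\<forall>us. (\<exists>es. bpath us es) \<longrightarrow> length us \<le> length vs)"
    by (rule ex_has_greatest_nat)
  then show ?thesis unfolding longest_def by blast
qed

text \<open>\<open>g\<close> closes the initial segment to a cycle of length \<open>j + 1\<close>.
  It only has to differ from the first \<open>j\<close> edges, so a later edge of the path can also
  play this role.\<close>

lemma close_nth:
  assumes p: "bpath us fs" and g: "g \<in> E" "hd us \<in> g" "us ! j \<in> g" "j < length us" "g \<notin> set (take j fs)"
    and c: "short_cycles c"
  shows "j < c"
proof -
  note d = bpathD[OF p]
  have "berge_cycle V E (take (Suc j) us) (take j fs @ [g])"
  proof (rule berge_cycle_of_bp)
    show "bp (take (Suc j) us) (take j fs)" using d g by (intro bp_take) auto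
    show "set (take (Suc j) us) \<subseteq> V" "set (take j fs) \<subseteq> E" using d set_take_subset by fastforce+
    show "hd (take (Suc j) us) \<in> g" using g d by (cases us) auto
    show "last (take (Suc j) us) \<in> g" using g by (simp add: take_Suc_conv_app_nth)
  qed (use d g in auto)
  then show ?thesis using c g unfolding short_cycles_def by fastforce
qed

lemma close_unused:
  assumes p: "longest us fs" and g: "g \<in> E" "g \<notin> set fs" "hd us \<in> g" and c: "short_cycles c"
  shows "g \<subseteq> set (take c us)"
proof
  fix y assume y: "y \<in> g"
  note d = bpathD[OF longestD(1)[OF p]]
  have "y \<in> set us"
  proof (rule ccontr)
    assume n: "y \<notin> set us"
    have "bp (y # us) (g # fs)" using d(1,8) y g by (cases us) auto
    then have "bpath (y # us) (g # fs)" unfolding bpath_def using d n g y subV by auto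
    then show False using longestD(2)[OF p] by fastforce
  qed
  then obtain j where j: "j < length us" "us ! j = y" by (auto simp: in_set_conv_nth)
  have "j < c" using close_nth[OF longestD(1)[OF p] g(1,3) _ j(1) _ c] y j g(2) by (meson in_set_takeD)
  then show "y \<in> set (take c us)" using j by (auto simp: in_set_conv_nth)
qed

lemma close_used:
  assumes p: "bpath us fs" and i: "i < length fs" "hd us \<in> fs ! i" and c: "short_cycles c"
  shows "i < c"
proof -
  note d = bpathD[OF p]
  have "fs ! i \<notin> set (take i fs)" using d(4) i by (simp add: distinct_conv_nth in_set_conv_nth)
  moreover have "fs ! i \<in> E" using d(5) i nth_mem by blast
  ultimately show ?thesis using close_nth[OF p, of "fs ! i" i c] d(6) i c bp_nth[OF d(1) i(1)] by auto
qed

lemma edges_at_hd: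
  assumes "bpath us fs"
  shows "{e \<in> E. hd us \<in> e} \<subseteq> {e \<in> E. hd us \<in> e \<and> e \<notin> set fs} \<union> (!) fs ` {i. i < length fs \<and> hd us \<in> fs ! i}"
  by (auto simp: in_set_conv_nth)

theorem long_cycle:
  assumes V: "V \<noteq> {}" and k: "r + 2 \<le> k"
    and deg: "\<And>x. x \<in> V \<Longrightarrow> (k - 2 choose (r - 1)) + 1 \<le> card {e \<in> E. x \<in> e}"
  shows "\<not> short_cycles (k - 1)"
proof
  assume c: "short_cycles (k - 1)"
  obtain vs es where P: "longest vs es" using ex_longest[OF V] by blast
  note p = longestD(1)[OF P] and d = bpathD[OF longestD(1)[OF P]]
  have hV: "hd vs \<in> V" using d by (cases vs) auto
  have len: "k - 1 \<le> length vs"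
  proof (rule ccontr)
    assume s: "\<not> k - 1 \<le> length vs"
    let ?U = "{e \<in> E. hd vs \<in> e \<and> e \<notin> set es}"
    have "?U \<subseteq> {a. a \<subseteq> set vs \<and> hd vs \<in> a \<and> card a = r}"
    proof
      fix e assume "e \<in> ?U"
      then have "e \<subseteq> set (take (k - 1) vs)" using close_unused[OF P _ _ _ c] by auto
      then show "e \<in> {a. a \<subseteq> set vs \<and> hd vs \<in> a \<and> card a = r}"
        using \<open>e \<in> ?U\<close> unif set_take_subset by fastforce
    qed
    then have "card ?U \<le> card {a. a \<subseteq> set vs \<and> hd vs \<in> a \<and> card a = r}" by (intro card_mono) auto
    also have "\<dots> = length vs - 1 choose (r - 1)"
      using card_subsets_containing[of "set vs" "hd vs" r] d r3 by (simp add: distinct_card)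
    also have "\<dots> \<le> k - 3 choose (r - 1)" using s by (intro binomial_right_mono) auto
    finally have 1: "card ?U \<le> k - 3 choose (r - 1)" .
    have "card {e \<in> E. hd vs \<in> e} \<le> card (?U \<union> (!) es ` {i. i < length es \<and> hd vs \<in> es ! i})"
      using edges_at_hd[OF p] finE by (intro card_mono) auto
    also have "\<dots> \<le> card ?U + card ((!) es ` {i. i < length es \<and> hd vs \<in> es ! i})" by (rule card_Un_le)
    also have "card ((!) es ` {i. i < length es \<and> hd vs \<in> es ! i}) \<le> card {..<length es}"
      by (rule order_trans[OF card_image_le]) (auto intro!: card_mono simp del: card_lessThan)
    finally have 2: "card {e \<in> E. hd vs \<in> e} \<le> (k - 3 choose (r - 1)) + (k - 3)"
      using 1 s d(6) by simp
    have "k - 2 choose (r - 1) = (k - 3 choose (r - 2)) + (k - 3 choose (r - 1))"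
      using choose_pascal[of "k - 2" "r - 1"] r3 k by (simp add: numeral_2_eq_2 numeral_3_eq_3)
    moreover have "k - 3 \<le> k - 3 choose (r - 2)" using r3 k by (intro choose_ge_self) auto
    ultimately show False using 2 deg[OF hV] by linarith
  qed
  define W where "W = set (take (k - 1) vs)"
  \<comment> \<open>The edge leading from \<open>W\<close> to the rest of the path; the default
    \<open>{}\<close> for a path that ends with \<open>W\<close> is never an edge.\<close>
  define x0 where "x0 = (if k - 2 < length es then es ! (k - 2) else {})"
  have le: "k - 2 \<le> length es" using len d(6) by simp
  \<comment> \<open>Hence neither an edge inside \<open>W\<close> nor an edge of the first segment
    occurs among the later edges, and the rearranged segment can be glued back.\<close>
  have late: "\<not> es ! i \<subseteq> W" if "k - 2 \<le> i" "i < length es" for i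
  proof -
    have "vs ! Suc i \<notin> W" unfolding W_def using d(2,6) that k
      by (auto simp: in_set_conv_nth nth_eq_iff_index_eq)
    then show ?thesis using bp_nth[OF d(1) that(2)] by auto
  qed
  have "\<exists>us fs g. bp us fs \<and> distinct us \<and> set us = set (take (k - 1) vs) \<and> last us = last (take (k - 1) vs) \<and> distinct fs \<and>
     set fs \<subseteq> E \<and> x0 \<notin> set fs \<and> set fs \<subseteq> set (take (k - 2) es) \<union> Pow (set (take (k - 1) vs)) \<and>
     g \<in> E \<and> g \<notin> set fs \<and> g \<noteq> x0 \<and> hd us \<in> g \<and> \<not> g \<subseteq> set (take (k - 1) vs)"
  proof (rule escape[where m = "k - 2" and r = r])
    show "(k - 2 choose (r - 1)) + 1 \<le> card {e \<in> E. x \<in> e}" if "x \<in> set (take (k - 1) vs)" for x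
      using deg that d(3) by (meson in_set_takeD subsetD)
    have "Suc (k - 2) = k - 1" using k by simp
    then show "bp (take (k - 1) vs) (take (k - 2) es)" using bp_take[OF d(1) le] by simp
    show "length (take (k - 1) vs) = Suc (k - 2)" using len k by simp
    show "set (take (k - 2) es) \<subseteq> E" using d(5) set_take_subset by fastforce
    show "x0 \<notin> set (take (k - 2) es)"
    proof (cases "k - 2 < length es")
      case True
      then show ?thesis unfolding x0_def using d(4) by (auto simp: in_set_conv_nth nth_eq_iff_index_eq)
    next
      case False
      have "{} \<notin> E" using unif r3 by force
      then show ?thesis unfolding x0_def using False d(5) by (auto dest: in_set_takeD)
    qed
  qed (use unif r3 k d finE in auto)
  then obtain us1 fs1 g where e: "bp us1 fs1" "distinct us1" "set us1 = W" "last us1 = last (take (k - 1) vs)"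
    "distinct fs1" "set fs1 \<subseteq> E" "x0 \<notin> set fs1" "set fs1 \<subseteq> set (take (k - 2) es) \<union> Pow W"
    "g \<in> E" "g \<notin> set fs1" "g \<noteq> x0" "hd us1 \<in> g" "\<not> g \<subseteq> W"
    unfolding W_def by blast
  have l1: "length us1 = k - 1" using e(2,3) d(2) len unfolding W_def
    by (metis distinct_card distinct_take length_take min.absorb2)
  have l1': "length fs1 = k - 2" using l1 bp_length[OF e(1)] by simp
  define us where "us = us1 @ drop (k - 1) vs"
  define fs where "fs = fs1 @ drop (k - 2) es"
  have bpu: "bp us fs"
  proof (cases "k - 2 < length es")
    case True
    have s: "Suc (k - 2) = k - 1" using k by simp
    have "drop (k - 2) es = es ! (k - 2) # drop (k - 1) es" using True s by (metis Cons_nth_drop_Suc)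
    moreover have "bp (us1 @ drop (k - 1) vs) (fs1 @ es ! (k - 2) # drop (k - 1) es)"
    proof (rule bp_append[OF e(1)])
      show "bp (drop (k - 1) vs) (drop (k - 1) es)" using True s by (intro bp_drop[OF d(1)]) auto
      have "take (k - 1) vs = take (k - 2) vs @ [vs ! (k - 2)]"
        using take_Suc_conv_app_nth[of "k - 2" vs] True d(6) s by simp
      then have "last (take (k - 1) vs) = vs ! (k - 2)" by simp
      then show "last us1 \<in> es ! (k - 2)" using e(4) bp_nth[OF d(1) True] by simp
      show "hd (drop (k - 1) vs) \<in> es ! (k - 2)"
        using bp_nth[OF d(1) True] True d(6) s by (simp add: hd_drop_conv_nth)
    qed
    ultimately show ?thesis unfolding us_def fs_def by simp
  next
    case False
    then show ?thesis unfolding us_def fs_def using e(1) le d(6) k by simp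
  qed
  have du: "distinct us" unfolding us_def using e(2,3) d(2) unfolding W_def
    by (simp add: set_take_disj_set_drop_if_distinct)
  have df: "distinct fs"
  proof -
    have "e' \<notin> set (drop (k - 2) es)" if "e' \<in> set fs1" for e'
    proof
      assume "e' \<in> set (drop (k - 2) es)"
      then obtain i where i: "k - 2 \<le> i" "i < length es" "es ! i = e'"
        by (auto simp: in_set_conv_nth) (metis le_add1 less_diff_conv2 add.commute le nat_le_linear less_diff_conv)
      then have "e' \<in> set (take (k - 2) es)" using late[OF i(1,2)] e(8) that by auto
      then show False using i d(4) by (auto simp: in_set_conv_nth nth_eq_iff_index_eq)
    qed
    then show ?thesis unfolding fs_def using e(5) d(4) by auto
  qed
  have bu: "bpath us fs" unfolding bpath_def
    using bpu du df e(3,6) d(3,5) unfolding us_def fs_def W_def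
    by (auto dest: in_set_takeD in_set_dropD)
  have L: "longest us fs"
    by (rule longest_sameI[OF P bu]) (use l1 len in \<open>simp add: us_def\<close>)
  have hu: "hd us = hd us1" unfolding us_def using l1 k by (cases us1) auto
  show False
  proof (cases "g \<in> set fs")
    case False
    then have "g \<subseteq> set (take (k - 1) us)" using close_unused[OF L e(9) _ _ c] e(12) hu by simp
    then show False using e(3,13) l1 unfolding us_def by simp
  next
    case True
    \<comment> \<open>\<open>g\<close> is a later path edge other than \<open>x0\<close>, so its
      position is at least \<open>k - 1\<close>, too far for \<open>close_used\<close>.\<close>
    then have "g \<in> set (drop (k - 2) es)" using e(10) unfolding fs_def by simp
    then obtain q where q: "q < length es - (k - 2)" "es ! (k - 2 + q) = g" by (auto simp: in_set_conv_nth)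
    have "q \<noteq> 0" using q e(11) unfolding x0_def by (auto split: if_splits)
    have "fs ! (k - 2 + q) = g" "k - 2 + q < length fs" unfolding fs_def using l1' q by (auto simp: nth_append)
    then have "k - 2 + q < k - 1" using close_used[OF bu _ _ c, of "k - 2 + q"] e(12) hu by simp
    then show False using \<open>q \<noteq> 0\<close> by simp
  qed
qed

section \<open>Small \<open>k\<close>: the edges at the head are the first \<open>k - 1\<close> path
  edges\<close>

lemma short_path_edges:
  assumes L: "longest us fs" and c: "short_cycles (k - 1)" and k: "3 \<le> k" "k \<le> r + 1"
    and deg: "\<forall>x \<in> V. k - 1 \<le> card {e \<in> E. x \<in> e}"
    and un: "\<forall>g \<in> E. hd us \<in> g \<longrightarrow> g \<in> set fs"
  shows "k - 1 \<le> length fs" "l < k - 1 \<Longrightarrow> hd us \<in> fs ! l"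
proof -
  note d = bpathD[OF longestD(1)[OF L]]
  have hV: "hd us \<in> V" using d by (cases us) auto
  let ?I = "{i. i < length fs \<and> hd us \<in> fs ! i}"
  have "{e \<in> E. hd us \<in> e} \<subseteq> (!) fs ` ?I"
    using edges_at_hd[OF longestD(1)[OF L]] un by auto
  then have "card {e \<in> E. hd us \<in> e} \<le> card ?I" by (intro surj_card_le) auto
  then have 1: "k - 1 \<le> card ?I" using deg hV by fastforce
  \<comment> \<open>A path edge through the head closes a cycle ending at its position, so all of
    them are early; the degree says that there are at least \<open>k - 1\<close>.\<close>
  have "?I \<subseteq> {..<k - 1}" using close_used[OF longestD(1)[OF L] _ _ c] by auto
  then have I: "?I = {..<k - 1}" using 1 by (intro card_seteq) auto
  then have "k - 2 \<in> ?I" using k by auto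
  then show "k - 1 \<le> length fs" by auto
  show "l < k - 1 \<Longrightarrow> hd us \<in> fs ! l" using I by auto
qed

text \<open>Counting subsets gives nothing for \<open>k \<le> r + 1\<close>. Instead, two of the
  first \<open>k - 1\<close> path edges are shown to coincide: rotations prove that each of them
  contains the first \<open>k - 1\<close> vertices, which settles \<open>r = k - 1\<close>, and for
  larger \<open>r\<close> the remaining vertices of \<open>es ! 0\<close> are carried over to
  \<open>es ! (k - 2)\<close>.\<close>

theorem long_cycle_small:
  assumes V: "V \<noteq> {}" and k: "3 \<le> k" "k \<le> r + 1"
    and deg: "\<And>x. x \<in> V \<Longrightarrow> k - 1 \<le> card {e \<in> E. x \<in> e}"
  shows "\<not> short_cycles (k - 1)"
proof
  assume c: "short_cycles (k - 1)"
  have kk: "0 < k - 1" "1 < k - 1" "k - 2 < k - 1" "0 < k - 2" "0 \<noteq> k - 2" using k by linarith+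
  have deg1: "\<forall>x \<in> V. k - 1 \<le> card {e \<in> E. x \<in> e}" using deg by blast
  \<comment> \<open>Such an edge has \<open>r \<ge> k - 1\<close> vertices, all among the first
    \<open>k - 1\<close> path vertices.\<close>
  have inW: "g = set (take (k - 1) us) \<and> r = k - 1" if "longest us fs" "g \<in> E" "g \<notin> set fs" "hd us \<in> g" for us fs g
  proof -
    have g: "g \<subseteq> set (take (k - 1) us)" by (rule close_unused[OF that c])
    have "card (set (take (k - 1) us)) \<le> k - 1" by (rule order_trans[OF card_length]) simp
    moreover have "card g \<le> card (set (take (k - 1) us))" using g by (intro card_mono) auto
    ultimately show ?thesis using g unif[OF that(2)] k by (metis List.finite_set One_nat_def add.commute card_seteq diff_le_mono le_antisym le_trans plus_1_eq_Suc diff_Suc_1)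
  qed
  obtain vs es where P: "longest vs es" using ex_longest[OF V] by blast
  note p = longestD(1)[OF P] and d = bpathD[OF longestD(1)[OF P]]
  define W where "W = set (take (k - 1) vs)"
  show False
  proof (cases "\<exists>g \<in> E. hd vs \<in> g \<and> g \<notin> set es")
    case True
    then obtain g where g: "g \<in> E" "hd vs \<in> g" "g \<notin> set es" by auto
    have gW: "g = W" "r = k - 1" using inW[OF P g(1,3,2)] unfolding W_def by auto
    have "card W = k - 1" using unif[OF g(1)] gW by simp
    then have lv: "k - 1 \<le> length vs" unfolding W_def using card_length[of "take (k - 1) vs"] by simp
    then have l0: "0 < length es" using d(6) k by linarith
    have "vs ! 1 \<in> W" unfolding W_def using lv k by (auto simp: in_set_conv_nth intro!: exI[of _ 1])
    then have b: "bp vs (es[0 := g])" using g gW d(7) by (intro bp_update[OF d(1)]) auto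
    have "bpath vs (es[0 := g])" unfolding bpath_def
      using b d g update_distinct_edges[OF d(4), of g 0] set_update_subset_insert[of es 0 g] by auto
    then have L: "longest vs (es[0 := g])" by (rule longest_sameI[OF P]) simp
    have "es ! 0 \<in> set es" using l0 by simp
    then have e0: "es ! 0 \<in> E" "es ! 0 \<noteq> g" "hd vs \<in> es ! 0" using d(5,7) g bp_nth[OF d(1) l0] by auto
    have "es ! 0 \<notin> set (es[0 := g])" using update_set_edges[OF d(4) l0] e0 by auto
    then have "es ! 0 = W" using inW[OF L e0(1) _ e0(3)] unfolding W_def by simp
    then show False using e0 gW by simp
  next
    case False
    then have un: "g \<in> set es" if "g \<in> E" "hd vs \<in> g" for g using that by auto
    have un1: "\<forall>g \<in> E. hd vs \<in> g \<longrightarrow> g \<in> set es" using un by blast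
    note sp = short_path_edges[OF P c k deg1 un1]
    have el: "es ! i \<in> E" if "i < k - 1" for i using d(5) sp(1) that by (meson le_trans less_le_trans nth_mem subsetD)
    have ne: "es ! i \<noteq> es ! j" if "i < k - 1" "j < k - 1" "i \<noteq> j" for i j
      using d(4) sp(1) that by (simp add: nth_eq_iff_index_eq)
    \<comment> \<open>The rotation with \<open>es ! i\<close> permutes the first
      \<open>k - 1\<close> vertices and the first \<open>k - 1\<close> edges among themselves, so
      the new head \<open>vs ! i\<close> lies on the same \<open>k - 1\<close> edges as the old
      one.\<close>
    have WE: "vs ! i \<in> es ! l" if i: "i < k - 1" and l: "l < k - 1" for i l
    proof -
      define us where "us = rev (take (Suc i) vs) @ drop (Suc i) vs"
      define fs where "fs = rev (take i es) @ es ! i # drop (Suc i) es"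
      have il: "i < length es" using i sp(1) by simp
      have b: "bp us fs" unfolding us_def fs_def
        using bp_nth[OF d(1) il] sp(2)[OF i] by (intro bp_rotate[OF d(1) il]) auto
      have sf: "set fs = set es" unfolding fs_def using rotate_set_edges[OF d(4) il, of "es ! i"] il by auto
      have su: "set us = set vs" unfolding us_def by (rule rotate_set)
      have "bpath us fs" unfolding bpath_def using b sf su d
        by (simp add: us_def fs_def rotate_distinct rotate_distinct_edges il del: distinct_append)
      then have L: "longest us fs" by (rule longest_sameI[OF P]) (simp add: us_def)
      have hu: "hd us = vs ! i" unfolding us_def using rotate_hd[of i vs] il d(6) by simp
      have tu: "set (take (k - 1) us) = W"
      proof -
        have "take (k - 1) us = rev (take (Suc i) vs) @ drop (Suc i) (take (k - 1) vs)"
          unfolding us_def using i il d(6) by (simp add: drop_take)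
        moreover have "take (k - 1) vs = take (Suc i) vs @ drop (Suc i) (take (k - 1) vs)"
          using i by (metis append_take_drop_id min.absorb1 take_take Suc_leI)
        ultimately show ?thesis unfolding W_def by (metis set_append set_rev)
      qed
      have "g \<in> set fs" if "g \<in> E" "hd us \<in> g" for g
      proof (rule ccontr)
        assume n: "g \<notin> set fs"
        then have "g = W" using inW[OF L that(1) n that(2)] tu by simp
        moreover have "hd vs \<in> W" unfolding W_def using d k by (cases vs; cases "k - 1") auto
        ultimately show False using n un that sf by simp
      qed
      then have "\<forall>g \<in> E. hd us \<in> g \<longrightarrow> g \<in> set fs" by blast
      note sp' = short_path_edges[OF L c k deg1 this]
      have tf: "set (take (k - 1) fs) = set (take (k - 1) es)"
      proof -
        have "take (k - 1) fs = rev (take i es) @ es ! i # drop (Suc i) (take (k - 1) es)"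
          unfolding fs_def using i il by (simp add: drop_take Suc_diff_le[symmetric] Suc_diff_Suc take_Cons')
        moreover have "take (k - 1) es = take i es @ es ! i # drop (Suc i) (take (k - 1) es)"
          using id_take_nth_drop[of i "take (k - 1) es"] i il by (simp add: min_def)
        ultimately show ?thesis by (metis set_append set_rev)
      qed
      have "es ! l \<in> set (take (k - 1) fs)" unfolding tf using l sp(1) by (auto simp: in_set_conv_nth)
      then obtain l' where "l' < k - 1" "fs ! l' = es ! l" by (auto simp: in_set_conv_nth)
      then show ?thesis using sp'(2)[of l'] hu by simp
    qed
    have lv: "k \<le> length vs" using sp(1) d(6) k by simp
    have cW: "card W = k - 1" unfolding W_def using d(2) lv by (simp add: distinct_card)
    have WE': "W \<subseteq> es ! l" if "l < k - 1" for l unfolding W_def using WE[OF _ that] lv by (auto simp: in_set_conv_nth)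
    show False
    proof (cases "r = k - 1")
      case True
      have "es ! l = W" if "l < k - 1" for l
        using card_subset_eq[OF finite_edge[OF el[OF that]] WE'[OF that]] cW unif[OF el[OF that]] True by simp
      then have "es ! 0 = es ! 1" using kk(1,2) by metis
      then show False using ne[OF kk(1,2)] by simp
    next
      case False
      have un': "g \<in> set fs" if "longest us fs" "g \<in> E" "hd us \<in> g" for us fs g
        using inW[OF that(1,2) _ that(3)] False by blast
      \<comment> \<open>Put \<open>y\<close> in front: \<open>es ! j\<close> joins it to
        \<open>vs ! 0\<close>, the other edges before position \<open>k - 2\<close> join the
        vertices up to \<open>vs ! (k - 3)\<close>, which works in any order by \<open>WE\<close>,
        and \<open>es ! (k - 2)\<close> skips \<open>vs ! (k - 2)\<close>. The path is again longest
        and has the same first \<open>k - 1\<close> edges, so all of them contain the new head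
        \<open>y\<close>.\<close>
      have ext: "y \<in> es ! l" if j: "j < k - 2" and y: "y \<in> es ! j" "y \<notin> W" "y \<noteq> vs ! (k - 1)" and l: "l < k - 1" for j y l
      proof -
        have l2: "k - 2 < length es" using sp(1) kk(3) by linarith
        define mid where "mid = take j es @ drop (Suc j) (take (k - 2) es)"
        have lm: "length mid = k - 3" unfolding mid_def using j sp(1) by simp
        have tk: "take (k - 2) es = take j es @ es ! j # drop (Suc j) (take (k - 2) es)"
          using id_take_nth_drop[of j "take (k - 2) es"] j l2 by (simp add: min_def)
        have sm: "set (take (k - 2) es) = insert (es ! j) (set mid)" by (subst tk) (auto simp: mid_def)
        have dm: "distinct (es ! j # mid)"
        proof -
          have "distinct (take (k - 2) es)" using d(4) by simp
          then have "distinct (take j es @ es ! j # drop (Suc j) (take (k - 2) es))" using tk by simp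
          then show ?thesis unfolding mid_def by auto
        qed
        have md: "\<exists>q < k - 2. e = es ! q" if "e \<in> set mid" for e
        proof -
          have "e \<in> set (take (k - 2) es)" using that sm by auto
          then show ?thesis by (auto simp: in_set_conv_nth)
        qed
        have k2: "Suc (k - 3) = k - 2" "Suc (k - 2) = k - 1" using k j by auto
        have bm: "bp (take (k - 2) vs) mid" unfolding bp_iff_nth
        proof (intro conjI allI impI)
          show "length (take (k - 2) vs) = Suc (length mid)" using lm lv k2 by simp
          fix i assume "i < length mid"
          then have i: "i < k - 3" "mid ! i \<in> set mid" using lm by auto
          then obtain q where "q < k - 2" "mid ! i = es ! q" using md by blast
          then show "take (k - 2) vs ! i \<in> mid ! i" "take (k - 2) vs ! Suc i \<in> mid ! i"
            using WE[of i q] WE[of "Suc i" q] i by auto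
        qed
        have dr: "drop (k - 2) es = es ! (k - 2) # drop (k - 1) es" using l2 k2 by (metis Cons_nth_drop_Suc)
        have lastv: "last (take (k - 2) vs) \<in> es ! (k - 2)"
        proof -
          have "k - 3 < length vs" "k - 3 < k - 1" using lv k by linarith+
          then have "take (k - 2) vs = take (k - 3) vs @ [vs ! (k - 3)]" "vs ! (k - 3) \<in> es ! (k - 2)"
            using k2 take_Suc_conv_app_nth[of "k - 3" vs] WE[OF _ kk(3)] by auto
          then show ?thesis by simp
        qed
        have hdv: "vs ! (k - 1) \<in> es ! (k - 2)" using bp_nth[OF d(1) l2] k2 by simp
        have dme: "distinct (es ! j # mid @ drop (k - 2) es)"
        proof -
          have "set (es ! j # mid) \<inter> set (drop (k - 2) es) = {}"
            using sm set_take_disj_set_drop_if_distinct[OF d(4), of "k - 2" "k - 2"] by auto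
          then show ?thesis using dm d(4) by auto
        qed
        have sE: "set (es ! j # mid @ drop (k - 2) es) \<subseteq> E"
          using sm d(5) set_take_subset[of "k - 2" es] set_drop_subset[of "k - 2" es] by auto
        have dvs: "distinct (take (k - 2) vs @ drop (k - 1) vs)"
          using d(2) set_take_disj_set_drop_if_distinct[OF d(2), of "k - 2" "k - 1"] by simp
        have svs: "set (take (k - 2) vs @ drop (k - 1) vs) \<subseteq> V"
          using d(3) set_take_subset[of "k - 2" vs] set_drop_subset[of "k - 1" vs] by auto
        have hh: "hd (take (k - 2) vs) = vs ! 0" using lv j d(7) by simp
        have tne: "take (k - 2) vs \<noteq> []" using bp_not_Nil[OF bm] .
        have v0: "vs ! 0 \<in> es ! j" using WE[of 0 j] j by simp
        \<comment> \<open>If \<open>y\<close> is the path vertex at position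
          \<open>q \<ge> k\<close>, then \<open>es ! j\<close> closes the path without
          \<open>vs ! (k - 2)\<close> to a cycle of length \<open>q\<close>.\<close>
        have yv: "y \<notin> set vs"
        proof
          assume "y \<in> set vs"
          then obtain q where q: "q < length vs" "vs ! q = y" by (auto simp: in_set_conv_nth)
          have "\<not> q < k - 1" using q y unfolding W_def by (auto simp: in_set_conv_nth)
          moreover have "q \<noteq> k - 1" using q y by auto
          ultimately have qk: "k \<le> q" by simp
          let ?t = "take (q - (k - 2)) (drop (k - 1) vs)" and ?f = "take (q - (k - 1)) (drop (k - 1) es)"
          have q2: "q - (k - 2) = Suc (q - (k - 1))" using qk k j by simp
          have bt: "bp ?t ?f" unfolding q2
            using sp(1) q d(6) by (intro bp_take bp_drop[OF d(1)]) auto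
          have lt: "length ?t = q - (k - 2)" using q qk by simp
          have lst: "last ?t = y"
            using lt q qk q2 by (subst last_conv_nth) (auto)
          have b: "bp (take (k - 2) vs @ ?t) (mid @ es ! (k - 2) # ?f)"
          proof (rule bp_append[OF bm bt lastv])
            show "hd ?t \<in> es ! (k - 2)" using hdv q2 lv by (simp add: hd_drop_conv_nth)
          qed
          have "berge_cycle V E (take (k - 2) vs @ ?t) ((mid @ es ! (k - 2) # ?f) @ [es ! j])"
          proof (rule berge_cycle_of_bp[OF b])
            show "distinct (take (k - 2) vs @ ?t)" using dvs by (auto dest: in_set_takeD)
            show "set (take (k - 2) vs @ ?t) \<subseteq> V" using svs by (auto dest: in_set_takeD)
            show "distinct (mid @ es ! (k - 2) # ?f)" "es ! j \<notin> set (mid @ es ! (k - 2) # ?f)"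
              using dme unfolding dr by (auto dest: in_set_takeD)
            show "set (mid @ es ! (k - 2) # ?f) \<subseteq> E" using sE unfolding dr by (auto dest: in_set_takeD)
            show "es ! j \<in> E" using el j by simp
            show "hd (take (k - 2) vs @ ?t) \<in> es ! j" using hh v0 tne by (simp add: hd_append)
            show "last (take (k - 2) vs @ ?t) \<in> es ! j" using lst lt y(1) q2 by (subst last_append) auto
          qed
          then have "length (take (k - 2) vs @ ?t) \<le> k - 1" using c unfolding short_cycles_def by blast
          then show False using lt lv qk k j by simp
        qed
        have b: "bp (y # take (k - 2) vs @ drop (k - 1) vs) (es ! j # mid @ drop (k - 2) es)"
        proof -
          have "bp (take (k - 2) vs @ drop (k - 1) vs) (mid @ es ! (k - 2) # drop (k - 1) es)"
          proof (rule bp_append[OF bm _ lastv])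
            show "bp (drop (k - 1) vs) (drop (k - 1) es)" using sp(1) by (intro bp_drop[OF d(1)])
            show "hd (drop (k - 1) vs) \<in> es ! (k - 2)" using hdv lv k by (simp add: hd_drop_conv_nth)
          qed
          then have "bp ([y] @ take (k - 2) vs @ drop (k - 1) vs) ([] @ es ! j # mid @ drop (k - 2) es)"
            unfolding dr using y v0 hh tne by (intro bp_append[where p = "[y]"]) (auto simp: hd_append)
          then show ?thesis by simp
        qed
        have "bpath (y # take (k - 2) vs @ drop (k - 1) vs) (es ! j # mid @ drop (k - 2) es)"
        proof -
          have "j < k - 1" using j by linarith
          then have "y \<in> V" using y(1) subV[OF el[of j]] by auto
          then show ?thesis unfolding bpath_def using b dvs svs yv dme sE by (auto dest: in_set_takeD in_set_dropD)
        qed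
        then have L: "longest (y # take (k - 2) vs @ drop (k - 1) vs) (es ! j # mid @ drop (k - 2) es)"
          by (rule longest_sameI[OF P]) (use lv k j in simp)
        have un2: "\<forall>g \<in> E. hd (y # take (k - 2) vs @ drop (k - 1) vs) \<in> g \<longrightarrow> g \<in> set (es ! j # mid @ drop (k - 2) es)"
          using un'[OF L] by blast
        note sp2 = short_path_edges(2)[OF L c k deg1 un2]
        have tk1: "take (k - 1) (es ! j # mid @ drop (k - 2) es) = es ! j # mid @ [es ! (k - 2)]"
          unfolding dr using lm k2 k by (simp add: take_Cons' numeral_eq_Suc)
        have "set (take (k - 1) es) = set (take (k - 1) (es ! j # mid @ drop (k - 2) es))"
        proof -
          have "take (k - 1) es = take (k - 2) es @ [es ! (k - 2)]"
            using l2 k2 by (metis take_Suc_conv_app_nth)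
          then show ?thesis unfolding tk1 using sm by auto
        qed
        moreover have "es ! l \<in> set (take (k - 1) es)" using l sp(1) by (auto simp: in_set_conv_nth)
        ultimately obtain l' where "l' < k - 1" "(es ! j # mid @ drop (k - 2) es) ! l' = es ! l"
          by (auto simp only: in_set_conv_nth length_take min_less_iff_conj nth_take)
        then show ?thesis using sp2[of l'] by simp
      qed
      have "es ! 0 \<subseteq> es ! (k - 2)"
      proof
        fix y assume y: "y \<in> es ! 0"
        have "vs ! (k - 1) \<in> es ! (k - 2)" 
        proof -
          have "Suc (k - 2) = k - 1" "k - 2 < length es" using sp(1) k by linarith+
          then show ?thesis using bp_nth[OF d(1), of "k - 2"] by simp
        qed
        then show "y \<in> es ! (k - 2)" using ext[OF kk(4) y _ _ kk(3)] WE'[OF kk(3)] by auto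
      qed
      then have "es ! 0 = es ! (k - 2)"
        using unif[OF el[OF kk(1)]] unif[OF el[OF kk(3)]] finite_edge[OF el[OF kk(3)]] by (intro card_subset_eq) auto
      then show False using ne[OF kk(1,3,5)] by simp
    qed
  qed
qed

end

section \<open>Longest cycles as periodic functions\<close>

text \<open>The situation to be refuted in (c): the longest cycle has length \<open>c\<close> and
  misses a vertex. The two values of \<open>card V\<close> come from rounding in \<open>t\<close>,
  and they give \<open>c \<le> 2 * t + 1\<close>.\<close>

locale ham = hyper +
  fixes t c :: nat
  assumes rt: "r \<le> t" and nV: "2 * t + 1 \<le> card V" "card V \<le> 2 * t + 2"
    and deg: "x \<in> V \<Longrightarrow> (t choose (r - 1)) + 1 \<le> card {e \<in> E. x \<in> e}"
    and sc: "short_cycles c" and ct: "t + 2 \<le> c" and cV: "c < card V"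
begin

text \<open>
  Cycles are indexed by all integers with period \<open>c\<close>, so that rotating and reversing a cycle become
  substitutions in the index.
\<close>

definition cyc :: "(int \<Rightarrow> 'a) \<Rightarrow> (int \<Rightarrow> 'a set) \<Rightarrow> bool" where
  "cyc v e \<longleftrightarrow> (\<forall>i j. v i = v j \<longleftrightarrow> i mod int c = j mod int c) \<and> (\<forall>i j. e i = e j \<longleftrightarrow> i mod int c = j mod int c) \<and>
     (\<forall>i. v i \<in> V \<and> e i \<in> E \<and> v i \<in> e i \<and> v (i + 1) \<in> e i)"

abbreviation "I \<equiv> {0..<int c}"

lemma c5: "5 \<le> c" "3 \<le> t" "0 < c" "0 < int c"
  using ct rt r3 by auto

lemma cycD:
  assumes "cyc v e"
  shows "v i = v j \<longleftrightarrow> i mod int c = j mod int c" "e i = e j \<longleftrightarrow> i mod int c = j mod int c"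
    "v i \<in> V" "e i \<in> E" "v i \<in> e i" "v (i + 1) \<in> e i" "v i \<in> e (i - 1)"
proof -
  show "v i = v j \<longleftrightarrow> i mod int c = j mod int c" "e i = e j \<longleftrightarrow> i mod int c = j mod int c"
    "v i \<in> V" "e i \<in> E" "v i \<in> e i" "v (i + 1) \<in> e i" using assms unfolding cyc_def by blast+
  have "v (i - 1 + 1) \<in> e (i - 1)" using assms unfolding cyc_def by blast
  then show "v i \<in> e (i - 1)" by simp
qed

lemma cyc_period:
  assumes "cyc v e"
  shows "v (i + int c) = v i" "e (i + int c) = e i" "v (i mod int c) = v i" "e (i mod int c) = e i"
  using cycD(1,2)[OF assms] by auto

lemma mod_neq: "i mod int c \<noteq> j mod int c" if "i < j" "j < i + int c"
proof
  assume "i mod int c = j mod int c"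
  then have "int c dvd j - i" by (metis mod_eq_dvd_iff)
  then have "int c \<le> j - i" using that by (intro zdvd_imp_le) auto
  then show False using that by simp
qed

lemma mod_inj: "i \<in> I \<Longrightarrow> j \<in> I \<Longrightarrow> i mod int c = j mod int c \<Longrightarrow> i = j"
  by auto

lemma cyc_inj:
  assumes "cyc v e"
  shows "inj_on v I" "inj_on e I"
  using cycD(1,2)[OF assms] by (auto simp: inj_on_def)

lemma mod_in_I: "i mod int c \<in> I"
  using c5(4) by auto

lemma range_cyc:
  assumes "cyc v e"
  shows "range v = v ` I" "range e = e ` I" "card (range v) = c" "card (range e) = c"
    "finite (range v)" "finite (range e)" "range v \<subseteq> V" "range e \<subseteq> E"
proof -
  show 1: "range v = v ` I"
  proof
    show "range v \<subseteq> v ` I" using cyc_period(3)[OF assms] mod_in_I by (metis imageI image_subsetI)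
  qed auto
  show 2: "range e = e ` I"
  proof
    show "range e \<subseteq> e ` I" using cyc_period(4)[OF assms] mod_in_I by (metis imageI image_subsetI)
  qed auto
  show "card (range v) = c" "card (range e) = c" unfolding 1 2 using cyc_inj[OF assms] by (auto simp: card_image)
  show "finite (range v)" "finite (range e)" unfolding 1 2 by auto
  show "range v \<subseteq> V" "range e \<subseteq> E" using cycD[OF assms] by auto
qed

lemma arc_inj:
  assumes "cyc v e" "j < i + int c"
  shows "inj_on v {i..j}" "inj_on e {i..j}"
proof -
  have *: "x = y" if "x mod int c = y mod int c" "x \<in> {i..j}" "y \<in> {i..j}" for x y
    using that assms(2) mod_neq[of x y] mod_neq[of y x] by (cases x y rule: linorder_cases) auto
  show "inj_on v {i..j}" by (rule inj_onI) (use * cycD(1)[OF assms(1)] in auto)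
  show "inj_on e {i..j}" by (rule inj_onI) (use * cycD(2)[OF assms(1)] in auto)
qed

section \<open>Longer cycles from an outside path or from two crossing attachments\<close>

lemma bp_arc:
  assumes "cyc v e" "i \<le> j"
  shows "bp (map v [i..j]) (map e [i..j - 1])"
  using assms(2)
proof (induction j rule: int_ge_induct)
  case (step j)
  have "bp (map v [i..j] @ [v (j + 1)]) (map e [i..j - 1] @ e j # [])"
    using step cycD[OF assms(1)] by (intro bp_append) (auto simp: upto_rec2 last_map)
  moreover have "[i..j + 1] = [i..j] @ [j + 1]" "[i..j] = [i..j - 1] @ [j]"
    using step by (auto simp: upto_rec2[of i "j + 1"] upto_rec2[of i j])
  ultimately show ?case by simp
qed (auto)

text \<open>Replacing the arc from \<open>i\<close> to \<open>j\<close> by \<open>us\<close> gives a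
  cycle with \<open>c - (j - i) + 1 + length us\<close> vertices. Only edges on the remaining arc
  are excluded for \<open>a\<close> and \<open>b\<close>, so they may be cycle edges of the replaced
  arc.\<close>

lemma bridge:
  assumes C: "cyc v e" and ij: "i < j" "j \<le> i + int c"
    and Q: "bp us fs" "distinct us" "set us \<subseteq> V" "set us \<inter> range v = {}"
    and ab: "distinct (a # b # fs)" "set (a # b # fs) \<subseteq> E"
    and no: "\<And>k. j \<le> k \<Longrightarrow> k < i + int c \<Longrightarrow> e k \<notin> set (a # b # fs)"
    and l: "v i \<in> a" "hd us \<in> a" "last us \<in> b" "v j \<in> b"
  shows "int (length us) + 1 \<le> j - i"
proof -
  let ?A = "map v [j..i + int c]" and ?B = "map e [j..i + int c - 1]"
  have "bp (?A @ us) (?B @ a # fs)"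
  proof (rule bp_append[OF bp_arc[OF C ij(2)] Q(1)])
    show "last ?A \<in> a" using ij l cyc_period(1)[OF C] by (simp add: last_map upto_rec2)
  qed (rule l(2))
  then have "berge_cycle V E (?A @ us) ((?B @ a # fs) @ [b])"
  proof (rule berge_cycle_of_bp)
    have "i + int c < j + int c" using ij by simp
    then have "distinct ?A" using arc_inj(1)[OF C] by (simp add: distinct_map)
    moreover have "set ?A \<inter> set us = {}" using Q(4) by auto
    ultimately show "distinct (?A @ us)" using Q(2) by simp
    show "set (?A @ us) \<subseteq> V" using Q(3) cycD(3)[OF C] by auto
    have "i + int c - 1 < j + int c" using ij by simp
    then have "distinct ?B" using arc_inj(2)[OF C] by (simp add: distinct_map)
    moreover have "set ?B \<inter> set (a # b # fs) = {}" using no by fastforce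
    ultimately show "distinct (?B @ a # fs)" "b \<notin> set (?B @ a # fs)" using ab(1) by auto
    show "set (?B @ a # fs) \<subseteq> E" "b \<in> E" using ab(2) cycD(4)[OF C] by auto
    show "hd (?A @ us) \<in> b" using ij l by (simp add: upto_rec1)
    show "last (?A @ us) \<in> b" using l bp_not_Nil[OF Q(1)] by simp
  qed
  then have "length (?A @ us) \<le> c" using sc unfolding short_cycles_def by blast
  then show ?thesis using ij by (simp; linarith)
qed

text \<open>The cycle runs from \<open>v (i + 1)\<close> to \<open>v j\<close>, through
  \<open>u\<close> to \<open>v i\<close>, backwards to \<open>v (j + 1)\<close>, and closes with
  \<open>g\<close>; it has \<open>c + 1\<close> vertices. The cycle edges at \<open>i\<close> and
  \<open>j\<close> are dropped, so \<open>a\<close> and \<open>b\<close> may be these.\<close>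

lemma cross:
  assumes C: "cyc v e" and ij: "i < j" "j < i + int c" and u: "u \<in> V" "u \<notin> range v"
    and abg: "distinct [a, b, g]" "set [a, b, g] \<subseteq> E"
    and no: "\<And>k. i < k \<Longrightarrow> k < i + int c \<Longrightarrow> k \<noteq> j \<Longrightarrow> e k \<notin> {a, b, g}"
    and l: "v i \<in> a" "u \<in> a" "v j \<in> b" "u \<in> b" "v (i + 1) \<in> g" "v (j + 1) \<in> g"
  shows False
proof -
  let ?A = "map v [i + 1..j]" and ?B = "map v [j + 1..i + int c]"
  let ?A' = "map e [i + 1..j - 1]" and ?B' = "map e [j + 1..i + int c - 1]"
  have "bp (?A @ [u] @ rev ?B) (?A' @ b # [] @ a # rev ?B')"
  proof (rule bp_append)
    show "bp ?A ?A'" using ij by (intro bp_arc[OF C]) auto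
    show "bp ([u] @ rev ?B) ([] @ a # rev ?B')"
    proof (rule bp_append)
      show "bp (rev ?B) (rev ?B')" using ij by (intro bp_rev bp_arc[OF C]) auto
      have "last ?B = v i" using ij cyc_period(1)[OF C] by (simp add: last_map upto_rec2)
      then show "hd (rev ?B) \<in> a" using l(1) by (simp add: hd_rev)
    qed (use l in auto)
    show "last ?A \<in> b" using ij l by (simp add: last_map upto_rec2)
  qed (use l in auto)
  then have "berge_cycle V E (?A @ [u] @ rev ?B) ((?A' @ b # [] @ a # rev ?B') @ [g])"
  proof (rule berge_cycle_of_bp)
    have iv: "inj_on v {i + 1..i + int c}" "inj_on e {i + 1..i + int c}" using arc_inj[OF C, of "i + int c" "i + 1"] by auto
    have dA: "distinct ?A" "distinct ?B" "distinct ?A'" "distinct ?B'"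
      using ij inj_on_subset[OF iv(1), of "{i + 1..j}"] inj_on_subset[OF iv(1), of "{j + 1..i + int c}"]
        inj_on_subset[OF iv(2), of "{i + 1..j - 1}"] inj_on_subset[OF iv(2), of "{j + 1..i + int c - 1}"]
      by (simp_all add: distinct_map)
    have d2: "set ?A \<inter> set ?B = {}" "set ?A' \<inter> set ?B' = {}"
    proof -
      show "set ?A \<inter> set ?B = {}" unfolding set_map set_upto
        using ij by (subst inj_on_image_Int[OF iv(1), symmetric]) auto
      show "set ?A' \<inter> set ?B' = {}" unfolding set_map set_upto
        using ij by (subst inj_on_image_Int[OF iv(2), symmetric]) auto
    qed
    have n: "set ?A' \<inter> {a, b, g} = {}" "set ?B' \<inter> {a, b, g} = {}" 
    proof -
      have "e k \<notin> {a, b, g}" if "k \<in> {i + 1..j - 1}" for k using no[of k] that ij by auto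
      then show "set ?A' \<inter> {a, b, g} = {}" unfolding set_map set_upto by blast
      have "e k \<notin> {a, b, g}" if "k \<in> {j + 1..i + int c - 1}" for k using no[of k] that ij by auto
      then show "set ?B' \<inter> {a, b, g} = {}" unfolding set_map set_upto by blast
    qed
    show "distinct (?A @ [u] @ rev ?B)" using dA d2 u by auto
    show "set (?A @ [u] @ rev ?B) \<subseteq> V" using u cycD(3)[OF C] by auto
    show "distinct (?A' @ b # [] @ a # rev ?B')" "g \<notin> set (?A' @ b # [] @ a # rev ?B')"
      using dA d2 n abg(1) by auto
    show "set (?A' @ b # [] @ a # rev ?B') \<subseteq> E" "g \<in> E" using abg cycD(4)[OF C] by auto
    show "hd (?A @ [u] @ rev ?B) \<in> g" using ij l by (simp add: upto_rec1)
    have "hd ?B = v (j + 1)" using ij by (simp add: upto_rec1)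
    then show "last (?A @ [u] @ rev ?B) \<in> g" using l ij by (simp add: last_rev)
  qed
  then have "length (?A @ [u] @ rev ?B) \<le> c" using sc unfolding short_cycles_def by blast
  then show False using ij by simp
qed

section \<open>Symmetries of a cycle and local exchanges\<close>

lemma cyc_shift: "cyc v e \<Longrightarrow> cyc (\<lambda>i. v (i + s)) (\<lambda>i. e (i + s))"
proof -
  assume C: "cyc v e"
  have "v (i + 1 + s) \<in> e (i + s)" for i using cycD(6)[OF C, of "i + s"] by (simp add: algebra_simps)
  then show ?thesis using cycD[OF C] unfolding cyc_def by (auto simp: mod_eq_dvd_iff)
qed

text \<open>Edge \<open>k\<close> joins the vertices \<open>k\<close> and \<open>k + 1\<close>, so
  the reflection of the vertices at 0 sends its index to \<open>- k - 1\<close>.\<close>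

lemma cyc_reflect: "cyc v e \<Longrightarrow> cyc (\<lambda>i. v (- i)) (\<lambda>i. e (- i - 1))"
proof -
  assume C: "cyc v e"
  have m: "(- i) mod int c = (- j) mod int c \<longleftrightarrow> i mod int c = j mod int c"
    "(- i - 1) mod int c = (- j - 1) mod int c \<longleftrightarrow> i mod int c = j mod int c" for i j
    by (auto simp: mod_eq_dvd_iff dvd_diff_commute)
  have "v (- i) \<in> e (- i - 1)" "v (- (i + 1)) \<in> e (- i - 1)" for i
    using cycD(7)[OF C, of "- i"] cycD(5)[OF C, of "- i - 1"] by (simp_all add: minus_add_distrib)
  then show ?thesis unfolding cyc_def using cycD[OF C] m by auto
qed

text \<open>The update affects a whole residue class, so that periodicity survives.\<close>

definition upd :: "(int \<Rightarrow> 'b) \<Rightarrow> int \<Rightarrow> 'b \<Rightarrow> int \<Rightarrow> 'b" where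
  "upd f k x = (\<lambda>i. if i mod int c = k mod int c then x else f i)"

lemma upd_inj:
  assumes "\<And>i j. f i = f j \<longleftrightarrow> i mod int c = j mod int c" "x \<notin> range f"
  shows "upd f k x i = upd f k x j \<longleftrightarrow> i mod int c = j mod int c"
proof -
  have "f i \<noteq> x" "f j \<noteq> x" "x \<noteq> f i" "x \<noteq> f j" using assms(2) by auto
  then show ?thesis unfolding upd_def using assms(1) by simp
qed

lemma mod_shift: "(i + 1) mod int c = k mod int c \<longleftrightarrow> i mod int c = (k - 1) mod int c"
  by (auto simp: mod_eq_dvd_iff algebra_simps)

lemma cyc_upd_edge:
  assumes C: "cyc v e" and g: "g \<notin> range e" "g \<in> E" "v k \<in> g" "v (k + 1) \<in> g"
  shows "cyc v (upd e k g)"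
proof -
  have "v i \<in> upd e k g i \<and> v (i + 1) \<in> upd e k g i" for i
  proof (cases "i mod int c = k mod int c")
    case True
    then have "(i + 1) mod int c = (k + 1) mod int c" by (metis mod_add_cong)
    then have "v i = v k" "v (i + 1) = v (k + 1)" using True cycD(1)[OF C] by auto
    then show ?thesis using g True unfolding upd_def by simp
  qed (use cycD[OF C] in \<open>auto simp: upd_def\<close>)
  moreover have "upd e k g i = upd e k g j \<longleftrightarrow> i mod int c = j mod int c" for i j
    by (rule upd_inj[OF cycD(2)[OF C] g(1)])
  ultimately show ?thesis unfolding cyc_def using cycD[OF C] g(2) by (auto simp: upd_def)
qed

text \<open>The edges of the cycle stay the same, so after this exchange the new outside vertex
  \<open>v k\<close> is examined against the same used edges.\<close>

lemma cyc_swap: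
  assumes C: "cyc v e" and u: "u \<notin> range v" "u \<in> V" "u \<in> e (k - 1)" "u \<in> e k"
  shows "cyc (upd v k u) e"
proof -
  have "upd v k u i \<in> e i" "upd v k u (i + 1) \<in> e i" for i
  proof -
    have "e i = e k" if "i mod int c = k mod int c" using cycD(2)[OF C] that by blast
    then show "upd v k u i \<in> e i" using cycD(5)[OF C, of i] u by (auto simp: upd_def)
    have "e i = e (k - 1)" if "i mod int c = (k - 1) mod int c" using cycD(2)[OF C] that by blast
    then show "upd v k u (i + 1) \<in> e i" using cycD(6)[OF C] u mod_shift[of i k] by (auto simp: upd_def)
  qed
  moreover have "upd v k u i = upd v k u j \<longleftrightarrow> i mod int c = j mod int c" for i j
    by (rule upd_inj[OF cycD(1)[OF C] u(1)])
  ultimately show ?thesis unfolding cyc_def using cycD[OF C] u(2) by (auto simp: upd_def)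
qed

text \<open>Unlike \<open>cyc_swap\<close>, this exchange releases \<open>e (k - 1)\<close> and
  \<open>e k\<close>, two edges at the new outside vertex \<open>v k\<close>.\<close>

lemma cyc_swap_unused:
  assumes C: "cyc v e" and u: "u \<notin> range v" "u \<in> V"
    and ab: "a \<notin> range e" "b \<notin> range e" "a \<noteq> b" "a \<in> E" "b \<in> E" "u \<in> a" "u \<in> b" "v (k - 1) \<in> a" "v (k + 1) \<in> b"
  shows "cyc (upd v k u) (upd (upd e (k - 1) a) k b)"
proof -
  let ?e = "upd (upd e (k - 1) a) k b"
  have kk: "(k - 1) mod int c \<noteq> k mod int c" using mod_neq[of "k - 1" k] c5 by simp
  have k2: "(k - 1) mod int c \<noteq> (k + 1) mod int c" "k mod int c \<noteq> (k + 1) mod int c"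
    using mod_neq[of "k - 1" "k + 1"] mod_neq[of "k" "k + 1"] c5 by auto
  have ep: "?e i = (if i mod int c = k mod int c then b else if i mod int c = (k - 1) mod int c then a else e i)" for i
    by (simp add: upd_def)
  have "upd v k u i \<in> ?e i \<and> upd v k u (i + 1) \<in> ?e i" for i
  proof -
    consider "i mod int c = k mod int c" | "i mod int c = (k - 1) mod int c"
      | "i mod int c \<noteq> k mod int c" "i mod int c \<noteq> (k - 1) mod int c" by blast
    then show ?thesis
    proof cases
      case 1
      then have i: "(i + 1) mod int c = (k + 1) mod int c" by (metis mod_add_cong)
      then have "v (i + 1) = v (k + 1)" using cycD(1)[OF C] by blast
      then show ?thesis using 1 i k2 ab unfolding ep by (simp add: upd_def)
    next
      case 2
      then have "(i + 1) mod int c = k mod int c" using mod_shift by simp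
      moreover have "v i = v (k - 1)" using 2 cycD(1)[OF C] by blast
      ultimately show ?thesis using 2 kk ab unfolding ep by (simp add: upd_def)
    next
      case 3
      then show ?thesis unfolding ep using cycD[OF C] mod_shift[of i k] by (simp add: upd_def)
    qed
  qed
  moreover have "upd v k u i = upd v k u j \<longleftrightarrow> i mod int c = j mod int c" for i j
    by (rule upd_inj[OF cycD(1)[OF C] u(1)])
  moreover have "?e i = ?e j \<longleftrightarrow> i mod int c = j mod int c" for i j
  proof -
    have "upd e (k - 1) a l \<noteq> b" for l using ab(2,3) by (auto simp: upd_def)
    then have "b \<notin> range (upd e (k - 1) a)" by auto
    moreover have "upd e (k - 1) a i = upd e (k - 1) a j \<longleftrightarrow> i mod int c = j mod int c" for i j
      by (rule upd_inj[OF cycD(2)[OF C] ab(1)])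
    ultimately show ?thesis using upd_inj[of "upd e (k - 1) a" b k i j] by blast
  qed
  moreover have "upd v k u i \<in> V" "?e i \<in> E" for i
    unfolding ep using cycD(3,4)[OF C] u ab by (auto simp: upd_def)
  ultimately show ?thesis unfolding cyc_def by blast
qed

text \<open>\<open>bridge\<close> with the single vertex \<open>u\<close> would need an arc of
  length at least 2.\<close>

lemma insert_unused:
  assumes C: "cyc v e" and u: "u \<in> V" "u \<notin> range v"
    and ab: "a \<in> E" "b \<in> E" "a \<notin> range e" "b \<notin> range e" "a \<noteq> b" "u \<in> a" "u \<in> b" "v k \<in> a"
  shows "v (k + 1) \<notin> b"
proof
  assume "v (k + 1) \<in> b"
  then have "int (length [u]) + 1 \<le> (k + 1) - k"
    using ab u c5 by (intro bridge[OF C, where a = a and b = b and fs = "[]" and us = "[u]"]) auto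
  then show False by simp
qed

lemma insert_used:
  assumes C: "cyc v e" and u: "u \<in> V" "u \<notin> range v"
    and ab: "a \<in> E" "a \<notin> range e" "u \<in> a" "u \<in> e k"
  shows "v k \<notin> a" "v (k + 1) \<notin> a"
proof -
  have no: "e q \<notin> {a, e k}" if "k + 1 \<le> q" "q < k + int c" for q
    using that ab cycD(2)[OF C] mod_neq[of k q] by fastforce
  show "v k \<notin> a"
  proof
    assume "v k \<in> a"
    then have "int (length [u]) + 1 \<le> (k + 1) - k"
      using ab u c5 cycD[OF C] no by (intro bridge[OF C, where a = a and b = "e k" and fs = "[]" and us = "[u]"]) auto
    then show False by simp
  qed
  show "v (k + 1) \<notin> a"
  proof
    assume "v (k + 1) \<in> a"
    then have "int (length [u]) + 1 \<le> (k + 1) - k"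
      using ab u c5 cycD[OF C] no by (intro bridge[OF C, where a = "e k" and b = a and fs = "[]" and us = "[u]"]) auto
    then show False by simp
  qed
qed

lemma ex_cyc:
  assumes "berge_cycle V E vs es" "length vs = c"
  shows "\<exists>v e. cyc v e"
proof -
  define v where "v = (\<lambda>i. vs ! nat (i mod int c))"
  define e where "e = (\<lambda>i. es ! nat (i mod int c))"
  note b = assms(1)[unfolded berge_cycle_def]
  have n: "nat (i mod int c) < c" for i using mod_in_I[of i] by auto
  have eq: "nat (i mod int c) = nat (j mod int c) \<longleftrightarrow> i mod int c = j mod int c" for i j
    using mod_in_I[of i] mod_in_I[of j] by (metis atLeastLessThan_iff eq_nat_nat_iff)
  have s: "nat ((i + 1) mod int c) = Suc (nat (i mod int c)) mod c" for i
  proof -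
    have "int (Suc (nat (i mod int c)) mod c) = (i mod int c + 1) mod int c"
      using mod_in_I[of i] by (simp add: zmod_int add.commute)
    also have "\<dots> = (i + 1) mod int c" by (simp add: mod_add_left_eq)
    finally show ?thesis by linarith
  qed
  have h1: "v i = v j \<longleftrightarrow> i mod int c = j mod int c" for i j
    unfolding v_def using b assms(2) n eq by (simp add: nth_eq_iff_index_eq)
  have h2: "e i = e j \<longleftrightarrow> i mod int c = j mod int c" for i j
    unfolding e_def using b assms(2) n eq by (simp add: nth_eq_iff_index_eq)
  have h3: "v i \<in> V" "e i \<in> E" for i
    unfolding v_def e_def using b assms(2) n nth_mem by (metis subsetD)+
  have h4: "v i \<in> e i" "v (i + 1) \<in> e i" for i
    unfolding v_def e_def s using b assms(2) n[of i] by auto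
  have "cyc v e" unfolding cyc_def using h1 h2 h3 h4 by simp
  then show ?thesis by blast
qed

subsection \<open>Counting edges at a vertex outside the cycle\<close>

definition idx :: "(int \<Rightarrow> 'a) \<Rightarrow> 'a set \<Rightarrow> int set" where
  "idx v a = {k \<in> I. v k \<in> a}"

definition prv :: "int \<Rightarrow> int" where
  "prv k = (k - 1) mod int c"

text \<open>Edge \<open>k\<close> joins the vertices \<open>k\<close> and \<open>k + 1\<close>, so the cycle edges at vertex \<open>k\<close> are \<open>k\<close> and \<open>prv k\<close>.\<close>

definition touch :: "int set \<Rightarrow> int set" where
  "touch M = M \<union> prv ` M"

lemma prv_I: "prv k \<in> I"
  unfolding prv_def by (rule mod_in_I)

lemma prv_inj: "inj_on prv I"
proof (rule inj_onI)
  fix x y assume "x \<in> I" "y \<in> I" "prv x = prv y"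
  then have "(prv x + 1) mod int c = (prv y + 1) mod int c" by simp
  then have "x mod int c = y mod int c" unfolding prv_def by (simp add: mod_add_left_eq)
  then show "x = y" using mod_inj \<open>x \<in> I\<close> \<open>y \<in> I\<close> by blast
qed

lemma cyc_prv: "cyc v e \<Longrightarrow> v (prv k + 1) = v k"
  unfolding prv_def by (simp add: cycD(1) mod_add_left_eq)

lemma touch_I: "M \<subseteq> I \<Longrightarrow> touch M \<subseteq> I"
  unfolding touch_def using prv_I by auto

lemma finite_touch: "M \<subseteq> I \<Longrightarrow> finite (touch M)"
  using touch_I by (meson finite_atLeastLessThan_int finite_subset)

lemma idx_I: "idx v a \<subseteq> I"
  unfolding idx_def by auto

lemma finite_idx: "finite (idx v a)"
  using idx_I by (meson finite_atLeastLessThan_int finite_subset)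

lemma touch_mono: "M \<subseteq> N \<Longrightarrow> touch M \<subseteq> touch N"
  unfolding touch_def by auto

lemma closed_prv:
  assumes "M \<subseteq> I" "M \<noteq> {}" "prv ` M \<subseteq> M"
  shows "M = I"
proof
  obtain k where k: "k \<in> M" using assms by auto
  have *: "(k - int n) mod int c \<in> M" for n
  proof (induction n)
    case 0
    then show ?case using k assms(1) by auto
  next
    case (Suc n)
    have "prv ((k - int n) mod int c) \<in> M" using Suc assms(3) by auto
    moreover have "prv ((k - int n) mod int c) = (k - int (Suc n)) mod int c"
      unfolding prv_def by (simp add: mod_diff_left_eq algebra_simps)
    ultimately show ?case by simp
  qed
  show "I \<subseteq> M"
  proof
    fix j assume j: "j \<in> I"
    have "int (nat ((k - j) mod int c)) = (k - j) mod int c" using mod_in_I[of "k - j"] by auto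
    then have "(k - int (nat ((k - j) mod int c))) mod int c = (k - (k - j)) mod int c"
      by (simp only: mod_diff_right_eq)
    then show "j \<in> M" using *[of "nat ((k - j) mod int c)"] j by simp
  qed
qed (rule assms)

text \<open>A nonempty set closed under \<open>prv\<close> is all of \<open>I\<close>, so a proper
  one gains at least one edge.\<close>

lemma card_touch:
  assumes "M \<subseteq> I" "M \<noteq> {}" "M \<noteq> I"
  shows "card M + 1 \<le> card (touch M)"
proof -
  have "M \<subset> touch M" using closed_prv[OF assms(1,2)] assms(3) unfolding touch_def by auto
  then show ?thesis using psubset_card_mono[OF finite_touch[OF assms(1)], of M] by simp
qed

lemma touch_disjoint:
  assumes "M \<subseteq> I" "N \<subseteq> I" "M \<inter> N = {}"
    and a: "\<And>k l. k \<in> M \<Longrightarrow> l \<in> N \<Longrightarrow> prv l \<noteq> k \<and> prv k \<noteq> l"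
  shows "touch M \<inter> touch N = {}"
proof -
  have "prv k \<noteq> prv l" if "k \<in> M" "l \<in> N" for k l
    using inj_onD[OF prv_inj, of k l] that assms(1,2,3) by blast
  then show ?thesis unfolding touch_def using assms(3) a by fastforce
qed

text \<open>The insertion rule speaks of two different edges; at a position met twice, one of the
  two always differs from a given edge. Hence such positions are pairwise nonconsecutive and take
  two cycle edges each.\<close>

definition dbl :: "(int \<Rightarrow> 'a) \<Rightarrow> 'a set set \<Rightarrow> int set" where
  "dbl v A = {k \<in> I. \<exists>a \<in> A. \<exists>b \<in> A. a \<noteq> b \<and> v k \<in> a \<and> v k \<in> b}"

text \<open>An edge in this family has a position that no other edge of \<open>A\<close> meets.
  These edges escape the binomial bound, but each takes cycle edges of its own.\<close>

definition priv :: "(int \<Rightarrow> 'a) \<Rightarrow> 'a set set \<Rightarrow> 'a set set" where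
  "priv v A = {a \<in> A. \<not> idx v a \<subseteq> dbl v A}"

lemma dbl_I: "dbl v A \<subseteq> I" "finite (dbl v A)"
proof -
  show "dbl v A \<subseteq> I" unfolding dbl_def by auto
  then show "finite (dbl v A)" by (rule finite_subset) simp
qed

text \<open>Edges outside \<open>priv\<close> consist of \<open>u\<close>, elements of
  \<open>D\<close> and doubly met vertices; this gives the binomial. An edge in \<open>priv\<close>
  must fill up its \<open>r\<close> vertices with private positions, at least
  \<open>max 1 (r - 1 - (card D + card (dbl v A)))\<close> of them, and by \<open>card_touch\<close>
  these touch one cycle edge more. The cycle edges taken by all these and by \<open>B\<close> are
  disjoint within \<open>Av\<close>.\<close>

lemma count:
  assumes C: "cyc v e" and finA: "finite A" and cA: "\<And>a. a \<in> A \<Longrightarrow> card a = r" "\<And>a. a \<in> A \<Longrightarrow> u \<in> a"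
    "\<And>a. a \<in> A \<Longrightarrow> a \<subseteq> {u} \<union> D \<union> range v"
    and D: "finite D" "u \<notin> range v"
    and rule: "\<And>a b k. a \<in> A \<Longrightarrow> b \<in> A \<Longrightarrow> a \<noteq> b \<Longrightarrow> v k \<in> a \<Longrightarrow> v (k + 1) \<notin> b"
    and Av: "\<And>a. a \<in> A \<Longrightarrow> touch (idx v a) \<subseteq> Av" "\<And>a. a \<in> A \<Longrightarrow> touch (idx v a) \<inter> B = {}" "B \<subseteq> Av" "finite Av"
  shows "card A \<le> (card D + card (dbl v A) choose (r - 1)) + card (priv v A)" (is ?g1)
    and "2 * card (dbl v A) + card (priv v A) * (1 + max 1 (r - 1 - (card D + card (dbl v A)))) + card B \<le> card Av" (is ?g2)
    and "dbl v A \<noteq> {} \<Longrightarrow> 2 \<le> card A"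
    and "priv v A = {} \<Longrightarrow> a \<in> A \<Longrightarrow> a \<subseteq> {u} \<union> D \<union> v ` dbl v A"
    and "card (touch (dbl v A)) = 2 * card (dbl v A)" "touch (dbl v A) \<subseteq> Av"
proof -
  let ?N = "dbl v A" and ?P = "priv v A"
  have rule': "prv l \<noteq> k" if "a \<in> A" "b \<in> A" "a \<noteq> b" "k \<in> idx v a" "l \<in> idx v b" for a b k l
  proof
    assume "prv l = k"
    then have "v (k + 1) = v l" using cyc_prv[OF C, of l] by simp
    then show False using rule[OF that(1,2,3), of k] that(4,5) unfolding idx_def by auto
  qed
  have fr: "a = {u} \<union> (a \<inter> D) \<union> (a \<inter> range v)" if "a \<in> A" for a using cA(2,3)[OF that] by blast
  have ar: "a \<inter> range v = v ` idx v a" for a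
    unfolding idx_def using range_cyc(1)[OF C] by auto
  have cidx: "card (v ` idx v a) = card (idx v a)" for a
    using cyc_inj(1)[OF C] idx_I by (meson card_image inj_on_subset)
  have idxr: "card (idx v a) \<le> r - 1" if "a \<in> A" for a
  proof -
    have "v ` idx v a \<subseteq> a - {u}" using ar[of a] D(2) by auto
    moreover have fa: "finite a" using cA(1)[OF that] r3 by (auto intro: card_ge_0_finite)
    ultimately have "card (v ` idx v a) \<le> card (a - {u})" by (intro card_mono) auto
    then show ?thesis using cidx cA(1,2)[OF that] fa by simp
  qed
  have fin: "finite ?P" unfolding priv_def using finA by simp
  \<comment> \<open>Although \<open>k\<close> and \<open>l\<close> may share an edge of
    \<open>A\<close>, a second edge at \<open>l\<close> provides two different ones for the
    rule.\<close>
  have NN: "prv l \<noteq> k" if kl: "k \<in> ?N" "l \<in> ?N" for k l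
  proof -
    obtain a where a: "a \<in> A" "k \<in> idx v a" using kl(1) unfolding dbl_def idx_def by auto
    obtain b where "b \<in> A" "b \<noteq> a" "l \<in> idx v b" using kl(2) unfolding dbl_def idx_def by auto
    then show ?thesis using rule'[OF a(1), of b k l] a by auto
  qed
  have "?N \<inter> prv ` ?N = {}" using NN by auto
  then have "card (touch ?N) = card ?N + card (prv ` ?N)"
    unfolding touch_def using dbl_I by (intro card_Un_disjoint) auto
  moreover have "card (prv ` ?N) = card ?N" using prv_inj dbl_I(1) by (meson card_image inj_on_subset)
  ultimately show tN: "card (touch ?N) = 2 * card ?N" by simp
  show tNA: "touch ?N \<subseteq> Av"
  proof -
    have "touch ?N \<subseteq> (\<Union>a\<in>A. touch (idx v a))" unfolding dbl_def touch_def idx_def by auto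
    then show ?thesis using Av(1) by blast
  qed
  define Pa where "Pa a = idx v a - ?N" for a
  have PaI: "Pa a \<subseteq> I" for a unfolding Pa_def using idx_I by auto
  have d1: "touch ?N \<inter> touch (Pa a) = {}" if "a \<in> A" for a
  proof (rule touch_disjoint[OF dbl_I(1) PaI])
    show "?N \<inter> Pa a = {}" unfolding Pa_def by auto
    fix k l assume k: "k \<in> ?N" "l \<in> Pa a"
    then obtain b where "b \<in> A" "b \<noteq> a" "k \<in> idx v b" unfolding dbl_def idx_def by auto
    then show "prv l \<noteq> k \<and> prv k \<noteq> l" using rule'[of b a k l] rule'[of a b l k] that k unfolding Pa_def by auto
  qed
  have d2: "touch (Pa b) \<inter> touch (Pa a) = {}" if "a \<in> A" "b \<in> A" "a \<noteq> b" for a b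
  proof (rule touch_disjoint[OF PaI PaI])
    show "Pa b \<inter> Pa a = {}" unfolding Pa_def dbl_def idx_def using that by blast
    fix k l assume "k \<in> Pa b" "l \<in> Pa a"
    then show "prv l \<noteq> k \<and> prv k \<noteq> l" using rule'[of b a k l] rule'[of a b l k] that unfolding Pa_def by auto
  qed
  have PA: "a \<in> A" if "a \<in> ?P" for a using that unfolding priv_def by auto
  have big: "1 + max 1 (r - 1 - (card D + card ?N)) \<le> card (touch (Pa a))" if "a \<in> ?P" for a
  proof -
    have ne: "Pa a \<noteq> {}" using that unfolding priv_def Pa_def by auto
    have fP: "finite (Pa a)" unfolding Pa_def using finite_idx by auto
    have "card (Pa a) \<le> card (idx v a)" unfolding Pa_def using finite_idx by (intro card_mono) auto
    then have "card (Pa a) \<le> r - 1" using idxr[OF PA[OF that]] by simp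
    then have "Pa a \<noteq> I" using rt ct r3 by auto
    then have 1: "card (Pa a) + 1 \<le> card (touch (Pa a))" by (rule card_touch[OF PaI ne])
    have "card a \<le> card ({u} \<union> D \<union> v ` idx v a)"
      using fr[OF PA[OF that]] ar[of a] D(1) finite_idx by (intro card_mono) auto
    also have "\<dots> \<le> card ({u} \<union> D) + card (v ` idx v a)" by (rule card_Un_le)
    also have "\<dots> \<le> 1 + card D + card (idx v a)"
      using card_Un_le[of "{u}" D] cidx[of a] by simp
    also have "card (idx v a) \<le> card (Pa a \<union> ?N)" using dbl_I(2) fP unfolding Pa_def by (intro card_mono) auto
    also have "\<dots> \<le> card (Pa a) + card ?N" by (rule card_Un_le)
    finally have "r \<le> 1 + card D + (card (Pa a) + card ?N)" using cA(1)[OF PA[OF that]] by simp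
    moreover have "1 \<le> card (Pa a)" using ne fP by (simp add: Suc_le_eq card_gt_0_iff)
    ultimately show ?thesis using 1 by linarith
  qed
  let ?T = "\<Union>a\<in>?P. touch (Pa a)"
  have cT: "card ?T = (\<Sum>a\<in>?P. card (touch (Pa a)))"
    using d2 PA fin finite_touch[OF PaI] by (intro card_UN_disjoint) auto
  have "card ?P * (1 + max 1 (r - 1 - (card D + card ?N))) \<le> card ?T"
    unfolding cT using sum_bounded_below[OF big] by simp
  moreover have "card (touch ?N \<union> ?T \<union> B) = card (touch ?N) + card ?T + card B"
  proof -
    have fT: "finite ?T" using fin finite_touch[OF PaI] by auto
    have fN: "finite (touch ?N)" using finite_touch[OF dbl_I(1)] .
    have "touch ?N \<inter> ?T = {}" using d1 PA by blast
    moreover have sub: "touch ?N \<union> ?T \<subseteq> (\<Union>a\<in>A. touch (idx v a))"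
    proof -
      have "touch (Pa a) \<subseteq> touch (idx v a)" for a unfolding Pa_def by (intro touch_mono) auto
      moreover have "touch ?N \<subseteq> (\<Union>a\<in>A. touch (idx v a))" unfolding dbl_def touch_def idx_def by auto
      ultimately show ?thesis using PA by blast
    qed
    then have "(touch ?N \<union> ?T) \<inter> B = {}" using Av(2) by blast
    moreover have "finite B" using Av finite_subset by blast
    ultimately show ?thesis using fT fN by (simp add: card_Un_disjoint)
  qed
  moreover have "card (touch ?N \<union> ?T \<union> B) \<le> card Av"
  proof (rule card_mono[OF Av(4)])
    have "touch (Pa a) \<subseteq> touch (idx v a)" for a unfolding Pa_def by (intro touch_mono) auto
    then have "?T \<subseteq> Av" using Av(1) PA by blast
    then show "touch ?N \<union> ?T \<union> B \<subseteq> Av" using tNA Av(3) by blast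
  qed
  ultimately show ?g2 using tN by linarith
  show g4: "a \<subseteq> {u} \<union> D \<union> v ` ?N" if "?P = {}" "a \<in> A" for a
    using fr[OF that(2)] ar[of a] that unfolding priv_def by blast
  have sub: "A - ?P \<subseteq> {b. b \<subseteq> insert u (D - {u} \<union> v ` ?N) \<and> u \<in> b \<and> card b = r}"
  proof
    fix a assume a: "a \<in> A - ?P"
    then have "idx v a \<subseteq> ?N" "a \<in> A" unfolding priv_def by auto
    then have "a \<subseteq> insert u (D - {u} \<union> v ` ?N)" using fr[of a] ar[of a] by blast
    then show "a \<in> {b. b \<subseteq> insert u (D - {u} \<union> v ` ?N) \<and> u \<in> b \<and> card b = r}" using cA a by auto
  qed
  have fin2: "finite (insert u (D - {u} \<union> v ` ?N))" using D dbl_I(2) by auto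
  have "card (A - ?P) \<le> card {b. b \<subseteq> insert u (D - {u} \<union> v ` ?N) \<and> u \<in> b \<and> card b = r}"
    using sub fin2 by (intro card_mono) auto
  also have "\<dots> = card (insert u (D - {u} \<union> v ` ?N)) - 1 choose (r - 1)"
    using fin2 r3 by (intro card_subsets_containing) auto
  also have "\<dots> \<le> card D + card ?N choose (r - 1)"
  proof (rule binomial_right_mono)
    have "card (insert u (D - {u} \<union> v ` ?N)) \<le> Suc (card (D - {u} \<union> v ` ?N))" by (rule card_insert_le_m1) auto
    also have "\<dots> \<le> Suc (card D + card ?N)"
      using card_Un_le[of "D - {u}" "v ` ?N"] card_image_le[OF dbl_I(2), of v v A] card_mono[OF D(1), of "D - {u}"] by simp
    finally show "card (insert u (D - {u} \<union> v ` ?N)) - 1 \<le> card D + card ?N" by simp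
  qed
  finally have "card (A - ?P) \<le> card D + card ?N choose (r - 1)" .
  moreover have "card A = card (A - ?P) + card ?P" using finA fin unfolding priv_def
    by (metis (no_types, lifting) card_Diff_subset card_mono le_add_diff_inverse2 mem_Collect_eq subsetI)
  ultimately show ?g1 by simp
  show "2 \<le> card A" if N: "?N \<noteq> {}"
  proof -
    obtain a b where "a \<in> A" "b \<in> A" "a \<noteq> b" using N unfolding dbl_def by auto
    then have "card {a, b} \<le> card A" using finA by (intro card_mono) auto
    then show ?thesis using \<open>a \<noteq> b\<close> by simp
  qed
qed

end

text \<open>Each unit step adds a binomial with lower entry \<open>s - 1\<close> and upper entry at
  least \<open>s\<close>, hence at least \<open>s\<close>.\<close>

lemma choose_growth:
  fixes s :: nat
  assumes "1 \<le> s" "s \<le> x" "x \<le> t"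
  shows "(x choose s) + s * (t - x) \<le> t choose s"
  using assms(3)
proof (induction t rule: dec_induct)
  case (step t)
  have "s choose (s - 1) \<le> t choose (s - 1)" using step assms by (intro binomial_right_mono) auto
  then have "s \<le> t choose (s - 1)" using assms(1) by (cases s) auto
  moreover have "Suc t choose s = (t choose (s - 1)) + (t choose s)" using choose_pascal[of "Suc t" s] assms by simp
  ultimately show ?case using step by (simp add: Suc_diff_le)
qed simp

lemma choose_two_growth:
  assumes "x \<le> t"
  shows "(x choose 2) + x * (t - x) \<le> t choose 2"
  using assms
proof (induction t rule: dec_induct)
  case (step t)
  have "Suc t choose 2 = t + (t choose 2)" by (simp add: numeral_2_eq_2)
  then show ?case using step by (simp add: Suc_diff_le)
qed simp

text \<open>This separates \<open>r < t\<close>, where the degree is at least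
  \<open>2 * t - 1\<close>, from \<open>r = t\<close>, where the binomial is just
  \<open>t\<close>.\<close>

lemma choose_ge_two_cases:
  assumes "3 \<le> r" "r < (t::nat)"
  shows "t choose 2 \<le> t choose (r - 1)" "2 * t \<le> (t choose 2) + 2"
proof -
  show "t choose 2 \<le> t choose (r - 1)" using assms by (intro choose_ge_choose_two) auto
  obtain q where q: "t = q + 4" using assms le_Suc_ex[of 4 t] by (auto simp: add.commute)
  have "2 * (t choose 2) = (q + 4) * (q + 3)" unfolding choose_two_double q by (simp add: algebra_simps)
  then show "2 * t \<le> (t choose 2) + 2" using q by (auto simp: algebra_simps)
qed

lemma numeric_two_unused:
  fixes x p q a c t r :: nat
  assumes r: "3 \<le> r" "r \<le> t" and a: "a \<le> (x choose (r - 1)) + p"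
    and q: "2 * x + p * (1 + max 1 (r - 1 - x)) + q \<le> c" and c: "c \<le> 2 * t + 1"
    and d: "(t choose (r - 1)) + 1 \<le> a + q" and a2: "2 \<le> a"
  shows "c = 2 * t + 1 \<and> x = t \<and> p = 0 \<and> q = 1 \<and> a = t choose (r - 1)"
proof (cases "r - 1 \<le> x")
  case True
  have pm: "2 * p \<le> p * (1 + max 1 (r - 1 - x))" by simp
  have xt: "x \<le> t" using q c by linarith
  show ?thesis
  proof (cases "x = t")
    case True
    then have "p = 0" "q \<le> 1" using q c pm by linarith+
    then show ?thesis using True a d q c by auto
  next
    case False
    then have xl: "x < t" using xt by simp
    have g: "(x choose (r - 1)) + (r - 1) * (t - x) \<le> t choose (r - 1)"
      using choose_growth[of "r - 1" x t] r True xt by simp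
    have b: "a + q \<le> (x choose (r - 1)) + 2 * (t - x) + 1" using a q c pm xl by linarith
    consider "4 \<le> r" | "r = 3" "3 \<le> x" | "r = 3" "x = 2" using r True by linarith
    then show ?thesis
    proof cases
      case 1
      then have "3 \<le> r - 1" by linarith
      then have "3 * (t - x) \<le> (r - 1) * (t - x)" by (rule mult_le_mono1)
      then show ?thesis using g b d xl by linarith
    next
      case 2
      have "3 * (t - x) \<le> x * (t - x)" using 2(2) by (rule mult_le_mono1)
      moreover have e: "r - 1 = 2" using 2 by simp
      ultimately show ?thesis using choose_two_growth[OF xt] b[unfolded e] d[unfolded e] xl by linarith
    next
      case 3
      show ?thesis
      proof (cases "t = 3")
        case True
        have "1 \<le> p" using a a2 3 by simp
        then have "q \<le> 1" "p = 1" using q c pm 3 True by linarith+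
        then show ?thesis using a d 3 True by (simp add: choose_two)
      next
        case False
        then have "2 * t \<le> (t choose 2) + 2" using choose_ge_two_cases(2)[of 3 t] 3 r by simp
        then show ?thesis using b d 3 xl by simp
      qed
    qed
  qed
next
  case False
  then have a': "a \<le> p" and z: "x \<le> r - 2" using a by (auto simp: binomial_eq_0)
  then obtain k where k: "r - 1 - x = Suc k" using False by (cases "r - 1 - x") auto
  have "p * (1 + max 1 (r - 1 - x)) = p + p * Suc k + 0" unfolding k by simp
  moreover have "2 * Suc k \<le> p * Suc k" using a' a2 by (intro mult_right_mono) auto
  ultimately have "a + q + 2 * x + 2 * Suc k \<le> c" using q a' by linarith
  moreover have "r = x + k + 2" using k by linarith
  ultimately have b: "a + q + 2 * r \<le> 2 * t + 3" using c by simp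
  have "1 \<le> r - 1" "r - 1 < t" using r by linarith+
  then have "r \<le> t choose (r - 1)" using choose_ge_self[of "r - 1" t] r by linarith
  then have "r \<noteq> t" using b d r by linarith
  then show ?thesis using choose_ge_two_cases[of r t] b d r by linarith
qed

context ham
begin

definition unu :: "(int \<Rightarrow> 'a set) \<Rightarrow> 'a \<Rightarrow> 'a set set" where
  "unu e u = {a \<in> E. u \<in> a \<and> a \<notin> range e}"

definition onc :: "(int \<Rightarrow> 'a set) \<Rightarrow> 'a \<Rightarrow> int set" where
  "onc e u = {k \<in> I. u \<in> e k}"

lemma unuD: "a \<in> unu e u \<Longrightarrow> a \<in> E" "a \<in> unu e u \<Longrightarrow> u \<in> a" "a \<in> unu e u \<Longrightarrow> a \<notin> range e"
  unfolding unu_def by auto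

lemma finite_unu: "finite (unu e u)"
  unfolding unu_def using finE by simp

lemma onc_I: "onc e u \<subseteq> I" "finite (onc e u)"
proof -
  show "onc e u \<subseteq> I" unfolding onc_def by auto
  then show "finite (onc e u)" by (rule finite_subset) simp
qed

lemma deg_cyc:
  assumes "cyc v e"
  shows "card {a \<in> E. u \<in> a} = card (unu e u) + card (onc e u)"
proof -
  have "{a \<in> E. u \<in> a} = unu e u \<union> e ` onc e u"
    unfolding unu_def onc_def using range_cyc(2,8)[OF assms] by auto
  moreover have "unu e u \<inter> e ` onc e u = {}" unfolding unu_def by auto
  moreover have "card (e ` onc e u) = card (onc e u)"
    using cyc_inj(2)[OF assms] onc_I(1) by (meson card_image inj_on_subset)
  ultimately show ?thesis using finite_unu onc_I(2) by (simp add: card_Un_disjoint)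
qed

lemma deg_ge: "cyc v e \<Longrightarrow> u \<in> V \<Longrightarrow> (t choose (r - 1)) + 1 \<le> card (unu e u) + card (onc e u)"
  using deg[of u] deg_cyc[of v e u] by simp

lemma touch_onc:
  assumes C: "cyc v e" and u: "u \<in> V" "u \<notin> range v" and a: "a \<in> unu e u"
  shows "touch (idx v a) \<inter> onc e u = {}"
proof -
  have "k \<notin> onc e u" "prv k \<notin> onc e u" if "v k \<in> a" for k
    using insert_used[OF C u unuD(1,3,2)[OF a], of k] insert_used[OF C u unuD(1,3,2)[OF a], of "prv k"]
      cyc_prv[OF C, of k] that unfolding onc_def by auto
  then show ?thesis unfolding touch_def idx_def by auto
qed

lemma unu_rule:
  assumes C: "cyc v e" and u: "u \<in> V" "u \<notin> range v" and ab: "a \<in> unu e u" "b \<in> unu e u" "a \<noteq> b" "v k \<in> a"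
  shows "v (k + 1) \<notin> b"
  using insert_unused[OF C u] unuD[OF ab(1)] unuD[OF ab(2)] ab by blast

lemma c_le: "c \<le> 2 * t + 1" "c + 1 \<le> card V"
  using cV nV by auto

definition link :: "(int \<Rightarrow> 'a) \<Rightarrow> (int \<Rightarrow> 'a set) \<Rightarrow> 'a \<Rightarrow> int \<Rightarrow> 'a set \<Rightarrow> bool" where
  "link v e u k a \<longleftrightarrow> a \<in> E \<and> u \<in> a \<and> (a \<notin> range e \<and> v k \<in> a \<or> a = e k)"

lemma cross_link:
  assumes C: "cyc v e" and u: "u \<in> V" "u \<notin> range v" and ij: "i mod int c \<noteq> j mod int c"
    and l: "link v e u i a" "link v e u j b" "a \<noteq> b"
    and g: "g \<in> E" "g \<notin> range e" "g \<noteq> a" "g \<noteq> b" "v (i + 1) \<in> g"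
  shows "v (j + 1) \<notin> g"
proof
  assume gj: "v (j + 1) \<in> g"
  \<comment> \<open>The representative of \<open>j\<close> within the period that starts at
    \<open>i\<close>.\<close>
  define j' where "j' = i + (j - i) mod int c"
  have jm: "j' mod int c = j mod int c" unfolding j'_def by (simp add: mod_add_right_eq)
  have "(j - i) mod int c \<noteq> 0" using ij by (metis mod_eq_dvd_iff mod_0_imp_dvd)
  then have j': "i < j'" "j' < i + int c" unfolding j'_def using mod_in_I[of "j - i"] by auto
  have "(j' + 1) mod int c = (j + 1) mod int c" using jm by (metis mod_add_cong)
  then have eqs: "v j' = v j" "e j' = e j" "v (j' + 1) = v (j + 1)" using cycD(1,2)[OF C] jm by blast+
  show False
  proof (rule cross[OF C j' u, of a b g])
    show "distinct [a, b, g]" "set [a, b, g] \<subseteq> E" using l g unfolding link_def by auto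
    show "e k \<notin> {a, b, g}" if k: "i < k" "k < i + int c" "k \<noteq> j'" for k
    proof -
      have "e k \<noteq> e i" using mod_neq[OF k(1,2)] cycD(2)[OF C] by auto
      moreover have "e k \<noteq> e j'"
        using mod_neq[of k j'] mod_neq[of j' k] k j' cycD(2)[OF C] by (cases k j' rule: linorder_cases) auto
      ultimately show ?thesis using l g eqs unfolding link_def by auto
    qed
    show "v i \<in> a" "u \<in> a" "v j' \<in> b" "u \<in> b" "v (i + 1) \<in> g" "v (j' + 1) \<in> g"
      using l g gj cycD(5)[OF C] unfolding link_def eqs by auto
  qed
qed

text \<open>The reflection of \<open>cross_link\<close>: successors become predecessors, and the
  cycle edge that may attach \<open>u\<close> at \<open>i\<close> is the one from
  \<open>i - 1\<close>.\<close>

lemma cross_link_back: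
  assumes C: "cyc v e" and u: "u \<in> V" "u \<notin> range v" and ij: "i mod int c \<noteq> j mod int c"
    and l: "a \<in> E \<and> u \<in> a \<and> (a \<notin> range e \<and> v i \<in> a \<or> a = e (i - 1))"
      "b \<in> E \<and> u \<in> b \<and> (b \<notin> range e \<and> v j \<in> b \<or> b = e (j - 1))" "a \<noteq> b"
    and g: "g \<in> E" "g \<notin> range e" "g \<noteq> a" "g \<noteq> b" "v (i - 1) \<in> g"
  shows "v (j - 1) \<notin> g"
proof -
  let ?v = "\<lambda>i. v (- i)" and ?e = "\<lambda>i. e (- i - 1)"
  have re: "range ?e = range e"
  proof
    show "range e \<subseteq> range ?e"
    proof
      fix x assume "x \<in> range e"
      then obtain k where "x = e k" by auto
      then have "x = ?e (- k - 1)" by simp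
      then show "x \<in> range ?e" by blast
    qed
  qed auto
  have "?v (- j + 1) \<notin> g"
  proof (rule cross_link[OF cyc_reflect[OF C] u(1), of "- i" "- j" a b])
    show "u \<notin> range ?v" using u(2) by auto
    show "(- i) mod int c \<noteq> (- j) mod int c" using ij by (metis add.inverse_inverse mod_minus_cong)
    show "link ?v ?e u (- i) a" "link ?v ?e u (- j) b" using l unfolding link_def re by auto
    show "?v (- i + 1) \<in> g" using g by simp
  qed (use l g re in auto)
  then show ?thesis by simp
qed

lemma outside_only:
  assumes "cyc v e" "c = 2 * t + 1" "u \<in> V" "u \<notin> range v"
  shows "V = insert u (range v)"
proof -
  have "card (insert u (range v)) = c + 1" using range_cyc(3,5)[OF assms(1)] assms(4) by simp
  moreover have "insert u (range v) \<subseteq> V" using range_cyc(7)[OF assms(1)] assms(3) by auto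
  ultimately show ?thesis using nV(2) assms(2) finV by (metis card_seteq add.assoc one_add_one)
qed

lemma unu_count:
  assumes C: "cyc v e" and u: "u \<in> V" "u \<notin> range v" and H: "\<forall>a \<in> unu e u. a \<subseteq> insert u (range v)"
  defines "N \<equiv> dbl v (unu e u)" and "P \<equiv> priv v (unu e u)"
  shows "card (unu e u) \<le> (card N choose (r - 1)) + card P"
    "2 * card N + card P * (1 + max 1 (r - 1 - card N)) + card (onc e u) \<le> c"
    "P = {} \<Longrightarrow> a \<in> unu e u \<Longrightarrow> a \<subseteq> insert u (v ` N)"
    "card (touch N) = 2 * card N"
proof -
  have "card (unu e u) \<le> (card ({}::'a set) + card N choose (r - 1)) + card P"
    "2 * card N + card P * (1 + max 1 (r - 1 - (card ({}::'a set) + card N))) + card (onc e u) \<le> card I"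
    "P = {} \<Longrightarrow> a \<in> unu e u \<Longrightarrow> a \<subseteq> {u} \<union> {} \<union> v ` N"
    "card (touch N) = 2 * card N"
    unfolding N_def P_def
    by (rule count[where Av = I and e = e and u = u and B = "onc e u" and D = "{}"];
      (use C finite_unu unif unuD H u unu_rule[OF C u] touch_I[OF idx_I] touch_onc[OF C u] onc_I in \<open>auto\<close>)?)+
  then show "card (unu e u) \<le> (card N choose (r - 1)) + card P"
    "2 * card N + card P * (1 + max 1 (r - 1 - card N)) + card (onc e u) \<le> c"
    "P = {} \<Longrightarrow> a \<in> unu e u \<Longrightarrow> a \<subseteq> insert u (v ` N)"
    "card (touch N) = 2 * card N" by auto
qed

lemma touch_dbl_sub: "touch (dbl v A) \<subseteq> (\<Union>a\<in>A. touch (idx v a))"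
  unfolding dbl_def touch_def idx_def by auto

subsection \<open>Unused edges with at most one vertex outside the cycle\<close>

text \<open>The extremal configuration: the edges at \<open>u\<close> off the cycle form a complete star over \<open>t\<close> pairwise nonconsecutive cycle vertices.\<close>

definition full :: "(int \<Rightarrow> 'a) \<Rightarrow> (int \<Rightarrow> 'a set) \<Rightarrow> 'a \<Rightarrow> int set \<Rightarrow> int \<Rightarrow> bool" where
  "full v e u N b \<longleftrightarrow> cyc v e \<and> u \<in> V \<and> u \<notin> range v \<and> N \<subseteq> I \<and> card N = t \<and> b \<in> I \<and> onc e u = {b} \<and>
     touch N = I - {b} \<and> unu e u = {a. a \<subseteq> insert u (v ` N) \<and> u \<in> a \<and> card a = r} \<and>
     (\<forall>k \<in> N. \<exists>a1 \<in> unu e u. \<exists>a2 \<in> unu e u. a1 \<noteq> a2 \<and> v k \<in> a1 \<and> v k \<in> a2)"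

text \<open>\<open>numeric_two_unused\<close> leaves equality in every estimate, so the star is
  complete and touches all cycle edges except the single one through \<open>u\<close>.\<close>

lemma two_unused:
  assumes C: "cyc v e" and u: "u \<in> V" "u \<notin> range v" and H: "\<forall>a \<in> unu e u. a \<subseteq> insert u (range v)"
    and two: "2 \<le> card (unu e u)"
  shows "c = 2 * t + 1" "\<exists>b. full v e u (dbl v (unu e u)) b"
proof -
  let ?N = "dbl v (unu e u)" and ?P = "priv v (unu e u)"
  note uc = unu_count[OF C u H]
  have nm: "c = 2 * t + 1 \<and> card ?N = t \<and> card ?P = 0 \<and> card (onc e u) = 1 \<and> card (unu e u) = t choose (r - 1)"
    by (rule numeric_two_unused[OF r3 rt uc(1,2) c_le(1) deg_ge[OF C u(1)] two]) 
  show "c = 2 * t + 1" using nm by simp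
  have nm1: "card ?N = t" "card ?P = 0" "card (onc e u) = 1" "card (unu e u) = t choose (r - 1)" using nm by blast+
  have cI: "card (I - {b}) = 2 * t" if "b \<in> I" for b using that nm by simp
  have fP: "finite ?P" unfolding priv_def using finite_unu by simp
  have P0: "?P = {}" using nm1(2) fP by simp
  have sub: "unu e u \<subseteq> {a. a \<subseteq> insert u (v ` ?N) \<and> u \<in> a \<and> card a = r}"
  proof
    fix a assume a: "a \<in> unu e u"
    show "a \<in> {a. a \<subseteq> insert u (v ` ?N) \<and> u \<in> a \<and> card a = r}"
      using uc(3)[OF P0 a] unuD(2)[OF a] unif[OF unuD(1)[OF a]] by simp
  qed
  have cN: "card (v ` ?N) = t" using nm1(1) cyc_inj(1)[OF C] dbl_I by (metis card_image inj_on_subset)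
  have "card {a. a \<subseteq> insert u (v ` ?N) \<and> u \<in> a \<and> card a = r} = t choose (r - 1)"
  proof (subst card_subsets_containing)
    have "u \<notin> v ` ?N" using u(2) by auto
    then show "(card (insert u (v ` ?N)) - 1 choose (r - 1)) = t choose (r - 1)" using cN dbl_I by simp
  qed (use dbl_I r3 in auto)
  then have un: "unu e u = {a. a \<subseteq> insert u (v ` ?N) \<and> u \<in> a \<and> card a = r}"
    using sub nm1(4) dbl_I by (intro card_seteq) auto
  obtain b where b: "onc e u = {b}" using nm1(3) card_1_singletonE by metis
  then have bI: "b \<in> I" using onc_I by blast
  have "touch ?N \<inter> onc e u = {}" using touch_dbl_sub touch_onc[OF C u] by blast
  then have "touch ?N \<subseteq> I - {b}" using touch_I[OF dbl_I(1)] b by blast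
  moreover have "card (I - {b}) \<le> card (touch ?N)" using uc(4) nm1(1) cI[OF bI] by linarith
  ultimately have tn: "touch ?N = I - {b}" by (intro card_seteq) auto
  have "\<forall>k \<in> ?N. \<exists>a1 \<in> unu e u. \<exists>a2 \<in> unu e u. a1 \<noteq> a2 \<and> v k \<in> a1 \<and> v k \<in> a2"
    unfolding dbl_def by blast
  then show "\<exists>b. full v e u ?N b" unfolding full_def
    using C u dbl_I(1) nm1(1) bI b tn un by blast
qed

lemma fullD:
  assumes "full v e u N b"
  shows "cyc v e" "u \<in> V" "u \<notin> range v" "N \<subseteq> I" "card N = t" "b \<in> I" "onc e u = {b}" "touch N = I - {b}"
    "unu e u = {a. a \<subseteq> insert u (v ` N) \<and> u \<in> a \<and> card a = r}"
    "k \<in> N \<Longrightarrow> \<exists>a1 \<in> unu e u. \<exists>a2 \<in> unu e u. a1 \<noteq> a2 \<and> v k \<in> a1 \<and> v k \<in> a2"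
  using assms unfolding full_def
  by - ((elim conjE, assumption) | (elim conjE, drule (1) bspec, assumption))+

text \<open>Around the cycle, members and nonmembers of \<open>N\<close> alternate, except that edge
  \<open>b\<close> joins two nonmembers.\<close>

lemma full_nbr:
  assumes f: "full v e u N b" and k: "k \<in> I" "k \<notin> N"
  shows "prv k \<in> N \<or> prv k = b" "k = b \<or> (\<exists>l \<in> N. prv l = k)"
proof -
  note d = fullD[OF f]
  have "prv k \<in> touch N \<or> prv k = b" using d(8) prv_I by blast
  moreover have "l = k" if "prv l = prv k" "l \<in> N" for l using prv_inj that d(4) k by (meson inj_onD subsetD)
  ultimately show "prv k \<in> N \<or> prv k = b" unfolding touch_def using k by auto
  show "k = b \<or> (\<exists>l \<in> N. prv l = k)" using d(8) k unfolding touch_def by auto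
qed

lemma full_link:
  assumes f: "full v e u N b"
  shows "k \<in> N \<Longrightarrow> \<exists>a. link v e u k a \<and> a \<noteq> x \<and> a \<in> unu e u" "link v e u b (e b)"
proof -
  note d = fullD[OF f]
  show "\<exists>a. link v e u k a \<and> a \<noteq> x \<and> a \<in> unu e u" if "k \<in> N"
    using d(10)[OF that] unuD unfolding link_def by metis
  have "b \<in> onc e u" using d(7) by simp
  then show "link v e u b (e b)" unfolding link_def onc_def using cycD(4)[OF d(1)] by simp
qed

text \<open>The predecessors of \<open>k\<close> and \<open>l\<close> are in \<open>N\<close> or
  equal to \<open>b\<close>, so \<open>u\<close> is attached at both by different edges, and
  \<open>cross_link\<close> excludes \<open>g\<close>.\<close>

lemma full_indep:
  assumes f: "full v e u N b" and g: "g \<in> E" "g \<notin> range e" "u \<notin> g"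
    and kl: "k \<in> I" "k \<notin> N" "l \<in> I" "l \<notin> N" "k \<noteq> l" "v k \<in> g" "v l \<in> g"
  shows False
proof -
  note d = fullD[OF f]
  have ne: "prv k mod int c \<noteq> prv l mod int c" using prv_inj kl prv_I by (metis inj_onD mod_inj)
  have main: False if "link v e u (prv k) a1" "link v e u (prv l) a2" "a1 \<noteq> a2" for a1 a2
  proof -
    have "g \<noteq> a1" "g \<noteq> a2" using that g(3) unfolding link_def by auto
    then show False
      using cross_link[OF d(1-3) ne that g(1,2)] cyc_prv[OF d(1)] kl by metis
  qed
  have be: "a \<noteq> e b" if "a \<in> unu e u" for a using that unuD(3) by blast
  show False
  proof (cases "prv k = b")
    case True
    then have "prv l \<noteq> b" using ne by auto
    then have "prv l \<in> N" using full_nbr(1)[OF f kl(3,4)] by simp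
    then obtain a where "link v e u (prv l) a" "a \<in> unu e u" using full_link(1)[OF f] by metis
    then show False using main[of "e b" a] full_link(2)[OF f] True be by metis
  next
    case False
    then have kN: "prv k \<in> N" using full_nbr(1)[OF f kl(1,2)] by simp
    obtain a2 where "link v e u (prv l) a2"
      using full_nbr(1)[OF f kl(3,4)] full_link[OF f] by metis
    then show False using main full_link(1)[OF f kN, of a2] by metis
  qed
qed

lemma in_range_upd: "y \<in> range e \<Longrightarrow> y \<noteq> e k \<Longrightarrow> (\<And>i j. e i = e j \<longleftrightarrow> i mod int c = j mod int c) \<Longrightarrow> y \<in> range (upd e k x)"
proof -
  assume a: "y \<in> range e" "y \<noteq> e k" "\<And>i j. e i = e j \<longleftrightarrow> i mod int c = j mod int c"
  then obtain i where i: "y = e i" by auto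
  then have "upd e k x i = y" unfolding upd_def using a by auto
  then show ?thesis by blast
qed

lemma range_upd_sub: "range (upd e k x) \<subseteq> insert x (range e)"
  unfolding upd_def by auto

lemma card_star:
  assumes "finite S" "w \<notin> S" "y \<in> S" "2 \<le> r"
  shows "card {a. a \<subseteq> insert w S \<and> w \<in> a \<and> card a = r \<and> y \<in> a} = (card S - 1 choose (r - 2))"
proof -
  have "bij_betw (insert w) {a. a \<subseteq> S \<and> y \<in> a \<and> card a = r - 1} {a. a \<subseteq> insert w S \<and> w \<in> a \<and> card a = r \<and> y \<in> a}"
  proof (rule bij_betw_byWitness[where f' = "\<lambda>a. a - {w}"])
    show "insert w ` {a. a \<subseteq> S \<and> y \<in> a \<and> card a = r - 1} \<subseteq> {a. a \<subseteq> insert w S \<and> w \<in> a \<and> card a = r \<and> y \<in> a}"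
    proof
      fix b assume "b \<in> insert w ` {a. a \<subseteq> S \<and> y \<in> a \<and> card a = r - 1}"
      then obtain a where a: "b = insert w a" "a \<subseteq> S" "y \<in> a" "card a = r - 1" by auto
      then have "finite a" "w \<notin> a" using assms by (auto intro: finite_subset)
      then show "b \<in> {a. a \<subseteq> insert w S \<and> w \<in> a \<and> card a = r \<and> y \<in> a}" using a assms by auto
    qed
    show "(\<lambda>a. a - {w}) ` {a. a \<subseteq> insert w S \<and> w \<in> a \<and> card a = r \<and> y \<in> a} \<subseteq> {a. a \<subseteq> S \<and> y \<in> a \<and> card a = r - 1}"
      using assms by auto
  qed (use assms in auto)
  then have "card {a. a \<subseteq> insert w S \<and> w \<in> a \<and> card a = r \<and> y \<in> a} = card {a. a \<subseteq> S \<and> y \<in> a \<and> card a = r - 1}"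
    by (simp add: bij_betw_same_card)
  also have "\<dots> = (card S - 1 choose (r - 1 - 1))"
    using assms by (intro card_subsets_containing) auto
  finally show ?thesis by (simp add: numeral_2_eq_2)
qed

lemma full_swap:
  assumes f: "full v e u N b" and c: "c = 2 * t + 1"
    and k: "k \<in> I" "k \<notin> N" "prv k \<in> N" "prv l = k" "l \<in> N"
  shows "v k \<in> e b"
proof -
  note d = fullD[OF f]
  note inj = cycD(1)[OF d(1)] and inje = cycD(2)[OF d(1)]
  have lI: "l \<in> I" using k d(4) by auto
  have vpk: "v (prv k) = v (k - 1)" "e (prv k) = e (k - 1)" unfolding prv_def by (simp_all add: cyc_period[OF d(1)])
  have vl: "v l = v (k + 1)" using cyc_prv[OF d(1), of l] k(4) by simp
  obtain a where a: "a \<in> unu e u" "v (k - 1) \<in> a" using d(10)[OF k(3)] vpk by auto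
  obtain a' where a': "a' \<in> unu e u" "v (k + 1) \<in> a'" "a' \<noteq> a" using d(10)[OF k(5)] vl by metis
  define v' where "v' = upd v k u"
  define e' where "e' = upd (upd e (k - 1) a) k a'"
  define w where "w = v k"
  have C': "cyc v' e'" unfolding v'_def e'_def
    using a a' unuD by (intro cyc_swap_unused[OF d(1) d(3,2)]) auto
  have kk: "(k - 1) mod int c \<noteq> k mod int c" using mod_neq[of "k - 1" k] c5 by simp
  have w: "w \<in> V" "w \<notin> range v'" unfolding w_def v'_def upd_def using cycD(3)[OF d(1)] inj d(3) by auto
  have ep: "e' i = (if i mod int c = k mod int c then a' else if i mod int c = (k - 1) mod int c then a else e i)" for i
    unfolding e'_def upd_def by simp
  have ee: "e' i \<noteq> e (k - 1) \<and> e' i \<noteq> e k" for i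
  proof -
    have "a \<noteq> e x" "a' \<noteq> e x" for x using unuD(3)[OF a(1)] unuD(3)[OF a'(1)] by blast+
    moreover have "e i \<noteq> e (k - 1)" if "i mod int c \<noteq> (k - 1) mod int c" using inje that by simp
    moreover have "e i \<noteq> e k" if "i mod int c \<noteq> k mod int c" using inje that by simp
    ultimately show ?thesis unfolding ep by simp
  qed
  then have nr: "e (k - 1) \<notin> range e'" "e k \<notin> range e'" by (metis rangeE)+
  have rsub: "y \<in> range e' \<or> y = e k \<or> y = e (k - 1)" if y: "y \<in> range e" for y
  proof -
    obtain i where "y = e i" using y by auto
    then have "e' i = y \<or> y = e k \<or> y = e (k - 1)" unfolding ep using inje by auto
    then show ?thesis by blast
  qed
  have inu: "e (k - 1) \<in> unu e' w" "e k \<in> unu e' w" unfolding unu_def w_def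
    using cycD[OF d(1)] nr by auto
  have nee: "e (k - 1) \<noteq> e k" using inje kk by auto
  have "card {e (k - 1), e k} \<le> card (unu e' w)" using inu finite_unu by (intro card_mono) auto
  then have two: "2 \<le> card (unu e' w)" using nee by simp
  have Vw: "V = insert w (range v')" by (rule outside_only[OF C' c w])
  obtain b' where f': "full v' e' w (dbl v' (unu e' w)) b'"
  proof -
    have "\<forall>x \<in> unu e' w. x \<subseteq> insert w (range v')" using Vw subV unuD(1) by blast
    then show ?thesis using two_unused(2)[OF C' w _ two] that by blast
  qed
  define N' where "N' = dbl v' (unu e' w)"
  note f'' = f'[folded N'_def] 
  note d' = fullD[OF f'']
  have v'j: "v' j = v j" if "j \<in> I" "j \<noteq> k" for j unfolding v'_def upd_def using that k(1) by auto
  have v'k: "v' k = u" unfolding v'_def upd_def by simp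
  have wA: "w \<notin> x" if "x \<in> unu e u" for x
  proof
    assume "w \<in> x"
    then have "v k \<in> insert u (v ` N)" using that d(9) unfolding w_def by auto
    then have "v k \<in> v ` N" using d(3) by auto
    then have "k \<in> N" using inj_on_image_mem_iff[OF cyc_inj(1)[OF d(1)] k(1) d(4)] by simp
    then show False using k(2) by simp
  qed
  have good: "g \<notin> range e \<and> u \<notin> g" if "g \<in> unu e' w" "g \<noteq> e k" "g \<noteq> e (k - 1)" for g
  proof -
    have 1: "g \<notin> range e" using that rsub[of g] unuD(3)[OF that(1)] by auto
    have "u \<notin> g"
    proof
      assume "u \<in> g"
      then have "g \<in> unu e u" using 1 unuD(1)[OF that(1)] unfolding unu_def by simp
      then show False using wA[of g] unuD(2)[OF that(1)] by simp
    qed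
    then show ?thesis using 1 by simp
  qed
  have goodN: "j \<in> N" if "g \<in> unu e' w" "g \<noteq> e k" "g \<noteq> e (k - 1)" "j \<in> I" "v' j \<in> g" for g j
  proof (rule ccontr)
    assume "j \<notin> N"
    have gg: "g \<notin> range e" "u \<notin> g" using good[OF that(1-3)] by auto
    then have jk: "j \<noteq> k" using that(5) v'k by auto
    then show False
      using full_indep[OF f unuD(1)[OF that(1)] gg that(4) \<open>j \<notin> N\<close> k(1,2) jk] that(5) v'j[OF that(4) jk] unuD(2)[OF that(1)]
      unfolding w_def by simp
  qed
  \<comment> \<open>A vertex of the new star lies on at least \<open>t - 1\<close> star edges. If
    one of them is not a released edge, \<open>full_indep\<close> for the old cycle puts the
    position into \<open>N\<close>, because \<open>w\<close> already is a vertex off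
    \<open>N\<close>. Otherwise \<open>t = r = 3\<close>, and both released edges are known
    exactly.\<close>
  have N'N: "N' \<subseteq> N"
  proof
    fix j assume j: "j \<in> N'"
    then have jI: "j \<in> I" using d'(4) by auto
    let ?S = "{x \<in> unu e' w. v' j \<in> x}"
    have "?S = {x. x \<subseteq> insert w (v' ` N') \<and> w \<in> x \<and> card x = r \<and> v' j \<in> x}" using d'(9) by auto
    moreover have "card (v' ` N') = t" using d'(4,5) cyc_inj(1)[OF d'(1)] by (metis card_image inj_on_subset)
    moreover have "finite N'" using d'(4) finite_subset by blast
    moreover have "w \<notin> v' ` N'" using d'(3) by auto
    ultimately have cS: "card ?S = t - 1 choose (r - 2)"
      using card_star[of "v' ` N'" w "v' j"] j r3 by auto
    have tS: "t - 1 \<le> card ?S" unfolding cS using r3 rt by (intro choose_ge_self) auto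
    show "j \<in> N"
    proof (cases "?S \<subseteq> {e (k - 1), e k}")
      case False
      then show ?thesis using goodN jI by blast
    next
      case True
      show ?thesis
      proof (rule ccontr)
        assume jN: "j \<notin> N"
        have "card ?S \<le> card {e (k - 1), e k}" using True by (intro card_mono) auto
        then have "t - 1 \<le> 2" using tS by (simp add: card_insert_if split: if_splits)
        then have t3: "t = 3" "r = 3" using c5 rt r3 by linarith+
        have "card {e (k - 1), e k} \<le> 2" by (simp add: card_insert_if)
        then have "card {e (k - 1), e k} \<le> card ?S" using tS t3(1) by linarith
        then have "?S = {e (k - 1), e k}" by (intro card_seteq[OF _ True]) simp
        then have "e (k - 1) \<in> ?S" "e k \<in> ?S" by simp_all
        then have je: "v' j \<in> e (k - 1)" "v' j \<in> e k" by simp_all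
        have ku: "u \<notin> e (k - 1)"
        proof
          assume "u \<in> e (k - 1)"
          then have "prv k \<in> onc e u" unfolding onc_def using prv_I vpk by simp
          then show False using d(7,8) k(3) unfolding touch_def by auto
        qed
        have jk: "j \<noteq> k" using je ku v'k by auto
        have vj: "v' j = v j" using v'j[OF jI jk] .
        have jn: "v j \<noteq> v (k - 1)" "v j \<noteq> v (k + 1)" "v j \<noteq> v k" "v (k - 1) \<noteq> v (k + 1)" "v (k - 1) \<noteq> v k" "v (k + 1) \<noteq> v k"
        proof -
          have ii: "v j \<noteq> v y" if "y \<in> I" "y \<noteq> j" for y
            using inj_onD[OF cyc_inj(1)[OF d(1)], of j y] that jI by auto
          show "v j \<noteq> v (k - 1)" using ii[OF prv_I, of k] jN k(3) vpk by auto
          show "v j \<noteq> v (k + 1)" using ii[OF lI] jN k(5) vl by auto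
          show "v j \<noteq> v k" using ii[OF k(1)] jk by simp
          show "v (k - 1) \<noteq> v (k + 1)" "v (k - 1) \<noteq> v k" "v (k + 1) \<noteq> v k"
            using inj mod_neq[of "k - 1" "k + 1"] mod_neq[of "k - 1" k] mod_neq[of k "k + 1"] c5 by auto
        qed
        have e1: "e (k - 1) = {v k, v (k - 1), v j}"
        proof -
          have "{v k, v (k - 1), v j} \<subseteq> e (k - 1)" using je vj cycD(5)[OF d(1), of "k - 1"] cycD(7)[OF d(1), of k] by auto
          moreover have "card {v k, v (k - 1), v j} = 3" using jn by auto
          ultimately show ?thesis using unif[OF cycD(4)[OF d(1)]] finite_edge[OF cycD(4)[OF d(1)]] t3 by (metis card_subset_eq)
        qed
        have e2: "e k = {v k, v (k + 1), v j}"
        proof -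
          have "{v k, v (k + 1), v j} \<subseteq> e k" using je vj cycD(5,6)[OF d(1), of k] by auto
          moreover have "card {v k, v (k + 1), v j} = 3" using jn by auto
          ultimately show ?thesis using unif[OF cycD(4)[OF d(1)]] finite_edge[OF cycD(4)[OF d(1)]] t3 by (metis card_subset_eq)
        qed
        have sub: "e (k - 1) \<subseteq> insert w (v' ` N')" "e k \<subseteq> insert w (v' ` N')" using inu d'(9) by auto
        \<comment> \<open>The completeness of the new star supplies this triple. On the old cycle it
          can stand at position \<open>k - 1\<close>; this releases \<open>e (k - 1)\<close>, which
          has two vertices off \<open>N\<close>, against \<open>full_indep\<close>.\<close>
        have "{v k, v (k - 1), v (k + 1)} \<in> unu e' w"
          unfolding d'(9) using sub e1 e2 jn t3 unfolding w_def by auto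
        moreover have "{v k, v (k - 1), v (k + 1)} \<noteq> e k" "{v k, v (k - 1), v (k + 1)} \<noteq> e (k - 1)"
          using e1 e2 jn by auto
        ultimately have g: "{v k, v (k - 1), v (k + 1)} \<notin> range e" "u \<notin> {v k, v (k - 1), v (k + 1)}"
          "{v k, v (k - 1), v (k + 1)} \<in> E"
          using good[of "{v k, v (k - 1), v (k + 1)}"] unuD(1)[of "{v k, v (k - 1), v (k + 1)}"] by simp_all
        let ?g = "{v k, v (k - 1), v (k + 1)}"
        let ?e = "upd e (k - 1) ?g"
        have C2: "cyc v ?e" using g by (intro cyc_upd_edge[OF d(1)]) auto
        have un2: "unu ?e u = unu e u"
        proof -
          have "x \<in> range ?e \<longleftrightarrow> x \<in> range e" if "u \<in> x" for x
          proof -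
            have "x \<noteq> e (k - 1)" "x \<noteq> ?g" using that ku g(2) by auto
            then show ?thesis using in_range_upd[of x e "k - 1" ?g, OF _ _ inje] range_upd_sub[of e "k - 1" ?g] by blast
          qed
          then show ?thesis unfolding unu_def by auto
        qed
        have on2: "onc ?e u = onc e u" unfolding onc_def upd_def using g(2) ku inje by auto
        have f2: "full v ?e u N b" using f C2 unfolding full_def un2 on2 by - (elim conjE, intro conjI; assumption)
        have "e (k - 1) \<notin> range ?e"
        proof
          assume "e (k - 1) \<in> range ?e"
          then obtain i where i: "e (k - 1) = ?e i" by auto
          have "?g \<noteq> e (k - 1)" using g(1) by auto
          then show False using i inje unfolding upd_def by (auto split: if_splits)
        qed
        then show False
          using full_indep[OF f2 cycD(4)[OF d(1)] _ ku k(1,2) jI jN jk[symmetric]] e1 by auto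
      qed
    qed
  qed
  have fN: "finite N" using d(4) finite_subset by blast
  have NN: "N' = N" using N'N d(5) d'(5) fN by (intro card_subset_eq) auto
  have bb: "b' = b" using d(6,8) d'(6,8) unfolding NN by blast
  have "w \<in> e' b" using d'(7) unfolding bb onc_def by blast
  moreover have "e' b = e b"
  proof -
    have "k \<in> touch N" "prv k \<in> touch N" unfolding touch_def using k by auto
    then have "b \<noteq> k" "b \<noteq> prv k" using d(8) by auto
    then have "b mod int c \<noteq> k mod int c" "b mod int c \<noteq> (k - 1) mod int c"
      using d(6) k(1) mod_inj unfolding prv_def by auto
    then show ?thesis unfolding ep by simp
  qed
  ultimately show ?thesis unfolding w_def by simp
qed

text \<open>All \<open>t + 1\<close> cycle vertices off \<open>N\<close>, and \<open>u\<close>, lie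
  on \<open>e b\<close>, which has only \<open>r \<le> t\<close> vertices.\<close>

lemma no_full: "\<not> full v e u N b" if c: "c = 2 * t + 1"
proof
  assume f: "full v e u N b"
  note d = fullD[OF f]
  have "v k \<in> e b" if k: "k \<in> I" "k \<notin> N" for k
  proof -
    consider "k = b" | "prv k = b" | l where "prv k \<in> N" "prv l = k" "l \<in> N"
      using full_nbr[OF f k] by blast
    then show ?thesis
    proof cases
      case 1
      then show ?thesis using cycD(5)[OF d(1)] by simp
    next
      case 2
      then show ?thesis using cycD(6)[OF d(1), of b] cyc_prv[OF d(1), of k] by simp
    next
      case 3
      then show ?thesis using full_swap[OF f c k] by simp
    qed
  qed
  then have "v ` (I - N) \<subseteq> e b" by blast
  moreover have "u \<in> e b"
  proof -
    have "b \<in> onc e u" unfolding d(7) by simp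
    then show ?thesis unfolding onc_def by simp
  qed
  ultimately have "insert u (v ` (I - N)) \<subseteq> e b" by simp
  then have "card (insert u (v ` (I - N))) \<le> r"
    using card_mono[OF finite_edge[OF cycD(4)[OF d(1)]]] unif[OF cycD(4)[OF d(1)]] by metis
  moreover have "card (insert u (v ` (I - N))) = Suc (card (I - N))"
    using d(3) card_image[OF inj_on_subset[OF cyc_inj(1)[OF d(1)], of "I - N"]]
    by (subst card_insert_disjoint) auto
  moreover have "card (I - N) = t + 1"
    using d(4,5) c finite_subset[OF d(4)] by (subst card_Diff_subset) auto
  ultimately show False using rt by simp
qed

definition plus :: "int set \<Rightarrow> int set" where
  "plus B = {k \<in> I. prv k \<in> B}"

lemma plus_I: "plus B \<subseteq> I" "finite (plus B)"
proof -
  show "plus B \<subseteq> I" unfolding plus_def by auto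
  then show "finite (plus B)" by (rule finite_subset) simp
qed

lemma prv_plus: "B \<subseteq> I \<Longrightarrow> prv ` plus B = B"
proof
  assume B: "B \<subseteq> I"
  show "B \<subseteq> prv ` plus B"
  proof
    fix k assume k: "k \<in> B"
    have "prv ((k + 1) mod int c) = k" unfolding prv_def using k B by (auto simp: mod_diff_left_eq)
    then show "k \<in> prv ` plus B" unfolding plus_def using k mod_in_I by (metis (no_types, lifting) image_eqI mem_Collect_eq)
  qed
qed (auto simp: plus_def)

lemma card_plus: "B \<subseteq> I \<Longrightarrow> card (plus B) = card B"
  using prv_plus card_image[OF inj_on_subset[OF prv_inj plus_I(1)], of B] by simp

lemma touch_plus: "B \<subseteq> I \<Longrightarrow> touch (plus B) = B \<union> plus B"
  unfolding touch_def using prv_plus by auto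

lemma finite_I: "B \<subseteq> I \<Longrightarrow> finite B"
  by (meson finite_atLeastLessThan_int finite_subset)

lemma I_mod: "i \<in> I \<Longrightarrow> j \<in> I \<Longrightarrow> i \<noteq> j \<Longrightarrow> i mod int c \<noteq> j mod int c"
  by auto

lemma onc_link: "cyc v e \<Longrightarrow> i \<in> onc e u \<Longrightarrow> link v e u i (e i)"
  unfolding link_def onc_def using cycD(4) by auto

lemma onc_indep:
  assumes C: "cyc v e" and u: "u \<in> V" "u \<notin> range v" and g: "g \<in> E" "g \<notin> range e"
  shows "k \<in> plus (onc e u) \<Longrightarrow> l \<in> plus (onc e u) \<Longrightarrow> v k \<in> g \<Longrightarrow> v l \<in> g \<Longrightarrow> k = l"
    and "k \<in> onc e u \<Longrightarrow> l \<in> onc e u \<Longrightarrow> v k \<in> g \<Longrightarrow> v l \<in> g \<Longrightarrow> k = l"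
    and "a \<in> unu e u \<Longrightarrow> g \<noteq> a \<Longrightarrow> k \<in> plus (onc e u) \<Longrightarrow> l \<in> plus (idx v a) \<Longrightarrow> v k \<in> g \<Longrightarrow> v l \<notin> g"
    and "a \<in> unu e u \<Longrightarrow> g \<noteq> a \<Longrightarrow> k \<in> onc e u \<Longrightarrow> l \<in> prv ` idx v a \<Longrightarrow> v k \<in> g \<Longrightarrow> v l \<notin> g"
proof -
  have ge: "g \<noteq> e i" for i using g(2) by blast
  show "k = l" if kl: "k \<in> plus (onc e u)" "l \<in> plus (onc e u)" "v k \<in> g" "v l \<in> g"
  proof (rule ccontr)
    assume "k \<noteq> l"
    then have ne: "prv k \<noteq> prv l" using kl plus_I(1) inj_onD[OF prv_inj, of k l] by blast
    have on: "prv k \<in> onc e u" "prv l \<in> onc e u" using kl unfolding plus_def by auto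
    have m: "prv k mod int c \<noteq> prv l mod int c" using I_mod[OF prv_I prv_I ne] .
    have "e (prv k) \<noteq> e (prv l)" using m cycD(2)[OF C] by simp
    then show False
      using cross_link[OF C u m onc_link[OF C on(1)] onc_link[OF C on(2)] _ g ge ge] kl(3,4) cyc_prv[OF C] by simp
  qed
  show "k = l" if kl: "k \<in> onc e u" "l \<in> onc e u" "v k \<in> g" "v l \<in> g"
  proof (rule ccontr)
    assume ne: "k \<noteq> l"
    have kI: "k \<in> I" "l \<in> I" using kl onc_I by blast+
    have m: "(k + 1) mod int c \<noteq> (l + 1) mod int c" using I_mod[OF kI ne] mod_shift[of k "l + 1"] by simp
    have "e k \<noteq> e l" using I_mod[OF kI ne] cycD(2)[OF C] by simp
    moreover have "u \<in> e k" "u \<in> e l" using kl unfolding onc_def by auto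
    ultimately show False
      using cross_link_back[OF C u m, of "e k" "e l" g] cycD(4)[OF C] g ge kl by simp
  qed
  show "v l \<notin> g" if kl: "a \<in> unu e u" "g \<noteq> a" "k \<in> plus (onc e u)" "l \<in> plus (idx v a)" "v k \<in> g"
  proof -
    have on: "prv k \<in> onc e u" "prv l \<in> idx v a" using kl unfolding plus_def by auto
    have "touch (idx v a) \<inter> onc e u = {}" by (rule touch_onc[OF C u kl(1)])
    then have ne: "prv k \<noteq> prv l" using on unfolding touch_def by auto
    have m: "prv k mod int c \<noteq> prv l mod int c" using I_mod[OF prv_I prv_I ne] .
    have la: "link v e u (prv l) a" unfolding link_def using unuD[OF kl(1)] on(2) unfolding idx_def by auto
    have "e (prv k) \<noteq> a" using unuD(3)[OF kl(1)] by blast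
    then show ?thesis
      using cross_link[OF C u m onc_link[OF C on(1)] la _ g ge kl(2)] kl(5) cyc_prv[OF C] by simp
  qed
  show "v l \<notin> g" if kl: "a \<in> unu e u" "g \<noteq> a" "k \<in> onc e u" "l \<in> prv ` idx v a" "v k \<in> g"
  proof -
    obtain j where j: "j \<in> idx v a" "l = prv j" using kl(4) by auto
    have jI: "j \<in> I" "v j \<in> a" using j unfolding idx_def by auto
    have kI: "k \<in> I" using kl onc_I by blast
    have "touch (idx v a) \<inter> onc e u = {}" by (rule touch_onc[OF C u kl(1)])
    then have "k \<noteq> prv j" using j kl(3) unfolding touch_def by auto
    then have "k mod int c \<noteq> (j - 1) mod int c" using kI jI unfolding prv_def by auto
    then have m: "(k + 1) mod int c \<noteq> j mod int c" using mod_shift[of k j] by simp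
    have "e k \<noteq> a" using unuD(3)[OF kl(1)] by blast
    moreover have "u \<in> e k" using kl unfolding onc_def by auto
    ultimately have "v (j - 1) \<notin> g"
      using cross_link_back[OF C u m, of "e k" a g] cycD(4)[OF C] g ge kl unuD[OF kl(1)] jI by simp
    then show ?thesis unfolding j(2) prv_def by (simp add: cyc_period[OF C])
  qed
qed

lemma handshake: "(\<Sum>x\<in>V. card {e \<in> E. x \<in> e}) = card E * r"
proof -
  have "(\<Sum>x\<in>V. card {e \<in> E. x \<in> e}) = (\<Sum>x\<in>V. \<Sum>e\<in>E. if x \<in> e then 1 else 0)"
    by (intro sum.cong refl) (simp add: finE sum.If_cases Int_def)
  also have "\<dots> = (\<Sum>e\<in>E. \<Sum>x\<in>V. if x \<in> e then 1 else 0)" by (rule sum.swap)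
  also have "\<dots> = (\<Sum>e\<in>E. r)"
  proof (intro sum.cong refl)
    fix e assume e: "e \<in> E"
    then have "{x \<in> V. x \<in> e} = e" using subV by blast
    then show "(\<Sum>x\<in>V. if x \<in> e then 1 else 0) = r"
      using unif[OF e] by (simp add: finV sum.If_cases Int_def)
  qed
  finally show ?thesis by simp
qed

lemma tau_ge: "t \<le> t choose (r - 1)"
proof -
  have "1 \<le> r - 1" "r - 1 < t" using r3 rt by linarith+
  then show ?thesis by (rule choose_ge_self)
qed

text \<open>Degrees are at least \<open>t + 1\<close> while edges have at most \<open>t\<close>
  vertices, so \<open>card E \<le> card V + 2\<close> would give
  \<open>card V \<le> 2 * t\<close>.\<close>

lemma card_E: "card V + 3 \<le> card E"
proof (rule ccontr)
  assume "\<not> card V + 3 \<le> card E"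
  then have "card E \<le> card V + 2" by simp
  then have "card E * r \<le> (card V + 2) * t" using rt by (intro mult_le_mono) auto
  moreover have "card V * (t + 1) \<le> card E * r"
  proof -
    have "(\<Sum>x\<in>V. t + 1) \<le> (\<Sum>x\<in>V. card {e \<in> E. x \<in> e})"
    proof (rule sum_mono)
      fix x assume "x \<in> V"
      then show "t + 1 \<le> card {e \<in> E. x \<in> e}" using deg[of x] tau_ge by linarith
    qed
    then show ?thesis unfolding handshake by simp
  qed
  ultimately have "card V \<le> 2 * t" by (simp add: algebra_simps)
  then show False using nV by simp
qed

definition sparse :: "(int \<Rightarrow> 'a) \<Rightarrow> (int \<Rightarrow> 'a set) \<Rightarrow> bool" where
  "sparse v e \<longleftrightarrow> (\<forall>a \<in> E. a \<notin> range e \<longrightarrow> (\<forall>x \<in> a - range v. \<forall>y \<in> a - range v. x = y))"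

definition inner :: "(int \<Rightarrow> 'a) \<Rightarrow> (int \<Rightarrow> 'a set) \<Rightarrow> 'a set set" where
  "inner v e = {g \<in> E. g \<notin> range e \<and> g \<subseteq> range v}"

lemma innerD: "g \<in> inner v e \<Longrightarrow> g \<in> E" "g \<in> inner v e \<Longrightarrow> g \<notin> range e" "g \<in> inner v e \<Longrightarrow> g \<subseteq> range v"
  unfolding inner_def by auto

lemma idx_image: "cyc v e \<Longrightarrow> v ` idx v a = a \<inter> range v"
  unfolding idx_def using range_cyc(1) by auto

lemma inner_idx:
  assumes "cyc v e" "g \<in> inner v e"
  shows "v ` idx v g = g" "card (idx v g) = r"
proof -
  show 1: "v ` idx v g = g" unfolding idx_def using innerD(3)[OF assms(2)] range_cyc(1)[OF assms(1)] by auto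
  have "card (v ` idx v g) = card (idx v g)" using cyc_inj(1)[OF assms(1)] idx_I by (meson card_image inj_on_subset)
  then show "card (idx v g) = r" using 1 unif[OF innerD(1)[OF assms(2)]] by simp
qed

lemma unused_le_one:
  assumes C: "cyc v e" and s: "sparse v e" and u: "u \<in> V" "u \<notin> range v"
  shows "\<forall>a \<in> unu e u. a \<subseteq> insert u (range v)" "card (unu e u) \<le> 1"
proof -
  show 1: "\<forall>a \<in> unu e u. a \<subseteq> insert u (range v)"
    using s u(2) unfolding sparse_def unu_def by blast
  show "card (unu e u) \<le> 1"
  proof (rule ccontr)
    assume "\<not> card (unu e u) \<le> 1"
    then have "2 \<le> card (unu e u)" by simp
    note tu = two_unused[OF C u 1 this]
    show False using tu(2) no_full[OF tu(1)] by blast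
  qed
qed

lemma card_inner:
  assumes C: "cyc v e" and s: "sparse v e"
  shows "3 \<le> card (inner v e)"
proof -
  let ?O = "V - range v"
  have "E \<subseteq> range e \<union> inner v e \<union> (\<Union>u\<in>?O. unu e u)"
    unfolding inner_def unu_def using subV by blast
  then have "card E \<le> card (range e \<union> inner v e \<union> (\<Union>u\<in>?O. unu e u))"
    using range_cyc(6)[OF C] finE finV finite_unu by (intro card_mono) (auto simp: inner_def)
  also have "\<dots> \<le> card (range e \<union> inner v e) + card (\<Union>u\<in>?O. unu e u)" by (rule card_Un_le)
  also have "card (range e \<union> inner v e) \<le> card (range e) + card (inner v e)" by (rule card_Un_le)
  also have "card (\<Union>u\<in>?O. unu e u) \<le> (\<Sum>u\<in>?O. card (unu e u))" by (rule card_UN_le) (use finV in auto)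
  also have "\<dots> \<le> (\<Sum>u\<in>?O. 1)" using unused_le_one(2)[OF C s] by (intro sum_mono) auto
  also have "\<dots> = card V - c" using range_cyc(3,5,7)[OF C] finV by (simp add: card_Diff_subset)
  finally have "card E \<le> c + card (inner v e) + (card V - c)" using range_cyc(4)[OF C] by simp
  then show ?thesis using card_E cV by linarith
qed

lemma sparse_full: "cyc v e \<Longrightarrow> c = 2 * t + 1 \<Longrightarrow> sparse v e"
  unfolding sparse_def using outside_only subV by (metis Diff_iff insertE subsetD)

lemma card_le_one: "(\<And>x y. x \<in> S \<Longrightarrow> y \<in> S \<Longrightarrow> x = y) \<Longrightarrow> card S \<le> 1"
  by (metis card.empty card_1_singleton_iff dual_order.refl is_singletonI' is_singleton_altdef zero_le_one)

lemma numeric_one_unused: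
  assumes "(t choose (r - 1)) + 2 * r \<le> c + 2"
  shows "t = 3" "r = 3" "c = 7"
proof -
  have "r = t"
  proof (rule ccontr)
    assume "r \<noteq> t"
    then have "r < t" using rt by simp
    then show False using choose_ge_two_cases[OF r3 \<open>r < t\<close>] assms c_le r3 by linarith
  qed
  moreover then have "t = 3" using assms c_le tau_ge c5 by linarith
  ultimately show "t = 3" "r = 3" by auto
  then show "c = 7" using assms c_le by (simp add: choose_two)
qed

text \<open>At least \<open>t choose (r - 1)\<close> cycle edges contain \<open>u\<close>. Together
  with the neighbours of the vertices of \<open>a\<close>, their ends on one side form
  \<open>card (onc e u) + r - 1\<close> positions of which a suitable inner edge contains only one;
  its other \<open>r - 1\<close> vertices need room elsewhere. This fits into \<open>c\<close>
  positions only for \<open>t = 3\<close>.\<close>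

lemma one_unused:
  assumes C: "cyc v e" and s: "sparse v e" and u: "u \<in> V" "u \<notin> range v" and a: "unu e u = {a}"
  shows "t = 3" "r = 3" "c = 7" "card (onc e u) = 3" "card (idx v a) = 2"
proof -
  let ?B = "onc e u" and ?N = "idx v a"
  have aU: "a \<in> unu e u" using a by simp
  have q: "t choose (r - 1) \<le> card ?B" using deg_ge[OF C u(1)] a by simp
  have cN: "card ?N = r - 1"
  proof -
    have "a = insert u (v ` ?N)"
      using unused_le_one(1)[OF C s u] aU unuD(2)[OF aU] idx_image[OF C, of a] by blast
    moreover have "u \<notin> v ` ?N" using u(2) by auto
    moreover have "card (v ` ?N) = card ?N" using cyc_inj(1)[OF C] idx_I by (meson card_image inj_on_subset)
    ultimately have "card a = Suc (card ?N)" using finite_idx by (metis card_insert_disjoint finite_imageI)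
    then show ?thesis using unif[OF unuD(1)[OF aU]] by simp
  qed
  have tB: "touch ?N \<inter> ?B = {}" by (rule touch_onc[OF C u aU])
  have BI: "?B \<subseteq> I" by (rule onc_I)
  have ga: "g \<noteq> a" if "g \<in> inner v e" for g using innerD(3)[OF that] unuD(2)[OF aU] u(2) by blast
  have small: "card ?B + r - 1 + (r - 1) \<le> c"
    if X: "X \<subseteq> I" "card X = card ?B + (r - 1)" and g: "g \<in> inner v e" "k \<in> idx v g"
      and k: "idx v g \<inter> X \<subseteq> {k}" for X g k
  proof -
    have "idx v g - {k} \<subseteq> I - X" using k idx_I by blast
    then have "card (idx v g - {k}) \<le> card (I - X)" by (intro card_mono) auto
    moreover have "card (I - X) = c - card X" using X finite_I by (subst card_Diff_subset) auto
    moreover have "card (idx v g - {k}) = r - 1" using inner_idx(2)[OF C g(1)] g(2) finite_idx by simp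
    moreover have "card X \<le> c" using card_mono[OF _ X(1)] by simp
    ultimately show ?thesis using X(2) r3 by linarith
  qed
  have small': "t = 3 \<and> r = 3 \<and> c = 7 \<and> card ?B = 3" if "card ?B + r - 1 + (r - 1) \<le> c"
  proof -
    have "(t choose (r - 1)) + 2 * r \<le> c + 2" using that q r3 by linarith
    note n = numeric_one_unused[OF this]
    have "t choose (r - 1) = 3" using n by (simp add: choose_two)
    then show ?thesis using n q that by simp
  qed
  \<comment> \<open>If all inner edges avoided both ends of the cycle edges through
    \<open>u\<close>, the remaining positions would be so few that each inner edge fills them; then
    all inner edges are equal, against \<open>card_inner\<close>.\<close>
  have "\<exists>g \<in> inner v e. idx v g \<inter> (?B \<union> plus ?B) \<noteq> {}"
  proof (rule ccontr)
    assume n: "\<not> ?thesis"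
    let ?Z = "I - (?B \<union> plus ?B)"
    have sub: "idx v g \<subseteq> ?Z" if "g \<in> inner v e" for g using that n idx_I by blast
    obtain g0 where g0: "g0 \<in> inner v e" using card_inner[OF C s] by fastforce
    have B0: "?B \<noteq> {}" using q tau_ge c5 by (metis card.empty le_trans not_numeral_le_zero)
    have BI': "plus ?B \<noteq> I"
    proof
      assume "plus ?B = I"
      then have "idx v g0 = {}" using sub[OF g0] by auto
      then show False using inner_idx(2)[OF C g0] r3 by simp
    qed
    have B1: "plus ?B \<noteq> {}" using B0 card_plus[OF BI] onc_I(2)[of e u] by (metis card_0_eq card.empty)
    have cT: "card ?B + 1 \<le> card (?B \<union> plus ?B)"
      using card_touch[OF plus_I(1) B1 BI'] card_plus[OF BI] touch_plus[OF BI] by simp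
    have cZ: "card ?Z = c - card (?B \<union> plus ?B)"
      using BI plus_I onc_I(2)[of e u] by (subst card_Diff_subset) auto
    have rZ: "r \<le> card ?Z" using card_mono[OF _ sub[OF g0]] inner_idx(2)[OF C g0] by simp
    then have le: "(t choose (r - 1)) + r + 1 \<le> c" using cZ cT q r3 by linarith
    have rt': "r = t"
    proof (rule ccontr)
      assume "r \<noteq> t"
      then have "r < t" using rt by simp
      then show False using choose_ge_two_cases[OF r3 \<open>r < t\<close>] le c_le r3 by linarith
    qed
    have "card ?Z \<le> r" using cZ cT q tau_ge c_le rt' by linarith
    then have eq: "idx v g = ?Z" if "g \<in> inner v e" for g
      using card_seteq[OF _ sub[OF that]] inner_idx(2)[OF C that] by simp
    have "g = g'" if "g \<in> inner v e" "g' \<in> inner v e" for g g'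
      using inner_idx(1)[OF C that(1)] inner_idx(1)[OF C that(2)] eq[OF that(1)] eq[OF that(2)] by simp
    then have "card (inner v e) \<le> 1" by (rule card_le_one)
    then show False using card_inner[OF C s] by simp
  qed
  then obtain g k where g: "g \<in> inner v e" "k \<in> idx v g" "k \<in> ?B \<union> plus ?B" by blast
  have kg: "v k \<in> g" using g(2) unfolding idx_def by simp
  note ind = onc_indep[OF C u innerD(1,2)[OF g(1)]]
  have "card ?B + r - 1 + (r - 1) \<le> c"
  proof (cases "k \<in> ?B")
    case True
    have X: "?B \<union> prv ` ?N \<subseteq> I" using BI prv_I by auto
    have "card (?B \<union> prv ` ?N) = card ?B + card (prv ` ?N)"
      using tB onc_I(2) finite_idx unfolding touch_def by (intro card_Un_disjoint) auto
    moreover have "card (prv ` ?N) = card ?N" using prv_inj idx_I by (meson card_image inj_on_subset)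
    ultimately have cX: "card (?B \<union> prv ` ?N) = card ?B + (r - 1)" using cN by simp
    have "idx v g \<inter> (?B \<union> prv ` ?N) \<subseteq> {k}"
    proof
      fix l assume l: "l \<in> idx v g \<inter> (?B \<union> prv ` ?N)"
      then have "v l \<in> g" unfolding idx_def by simp
      then show "l \<in> {k}" using ind(2)[OF True _ kg] ind(4)[OF aU ga[OF g(1)] True _ kg] l by blast
    qed
    then show ?thesis using small[OF X cX g(1,2)] by simp
  next
    case False
    then have kp: "k \<in> plus ?B" using g(3) by simp
    have X: "plus ?B \<union> plus ?N \<subseteq> I" using plus_I by auto
    have "plus ?B \<inter> plus ?N = {}" using tB unfolding plus_def touch_def by auto
    then have "card (plus ?B \<union> plus ?N) = card ?B + card ?N"
      using card_plus[OF BI] card_plus[OF idx_I] plus_I by (simp add: card_Un_disjoint)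
    then have cX: "card (plus ?B \<union> plus ?N) = card ?B + (r - 1)" using cN by simp
    have "idx v g \<inter> (plus ?B \<union> plus ?N) \<subseteq> {k}"
    proof
      fix l assume l: "l \<in> idx v g \<inter> (plus ?B \<union> plus ?N)"
      then have "v l \<in> g" unfolding idx_def by simp
      then show "l \<in> {k}" using ind(1)[OF kp _ kg] ind(3)[OF aU ga[OF g(1)] kp _ kg] l by blast
    qed
    then show ?thesis using small[OF X cX g(1,2)] by simp
  qed
  note s3 = small'[OF this]
  show "t = 3" "r = 3" "c = 7" "card ?B = 3" using s3 by auto
  show "card ?N = 2" using cN s3 by simp
qed

end

text \<open>
  The variables record which vertices of a 7-cycle lie in an unused edge of size three; the excluded pairs
  come from the crossing argument.
\<close>

lemma clique_two:
  assumes "\<not> (g1 \<and> g3)" "\<not> (g1 \<and> g4)" "\<not> (g1 \<and> g5)" "\<not> (g1 \<and> g6)" "\<not> (g3 \<and> g4)" "\<not> (g3 \<and> g5)" "\<not> (g3 \<and> g6)" "\<not> (g4 \<and> g5)" "\<not> (g4 \<and> g6)" "\<not> (g5 \<and> g6)"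
    "(if g0 then 1 else 0) + (if g1 then 1 else 0) + (if g2 then 1 else 0) + (if g3 then 1 else 0) + (if g4 then 1 else 0) + (if g5 then 1 else 0) + (if g6 then 1 else (0::nat)) = 3"
  shows "g0 \<and> g2"
  using assms by (cases g0; cases g1; cases g2; cases g3; cases g4; cases g5; cases g6; simp)

lemma clique_three:
  assumes "\<not> (g1 \<and> g2)" "\<not> (g1 \<and> g4)" "\<not> (g1 \<and> g5)" "\<not> (g1 \<and> g6)" "\<not> (g2 \<and> g4)" "\<not> (g2 \<and> g5)" "\<not> (g2 \<and> g6)" "\<not> (g4 \<and> g5)" "\<not> (g4 \<and> g6)" "\<not> (g5 \<and> g6)"
    "(if g0 then 1 else 0) + (if g1 then 1 else 0) + (if g2 then 1 else 0) + (if g3 then 1 else 0) + (if g4 then 1 else 0) + (if g5 then 1 else 0) + (if g6 then 1 else (0::nat)) = 3"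
  shows "g0 \<and> g3"
  using assms by (cases g0; cases g1; cases g2; cases g3; cases g4; cases g5; cases g6; simp)

lemma clique_one_a:
  assumes "\<not> (g0 \<and> g3)" "\<not> (g0 \<and> g4)" "\<not> (g0 \<and> g5)" "\<not> (g1 \<and> g4)" "\<not> (g1 \<and> g5)" "\<not> (g1 \<and> g6)" "\<not> (g2 \<and> g4)" "\<not> (g2 \<and> g5)" "\<not> (g2 \<and> g6)" "\<not> (g3 \<and> g4)" "\<not> (g3 \<and> g5)" "\<not> (g3 \<and> g6)" "\<not> (g4 \<and> g5)" "\<not> (g4 \<and> g6)" "\<not> (g5 \<and> g6)"
    "(if g0 then 1 else 0) + (if g1 then 1 else 0) + (if g2 then 1 else 0) + (if g3 then 1 else 0) + (if g4 then 1 else 0) + (if g5 then 1 else 0) + (if g6 then 1 else (0::nat)) = 3"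
  shows "(g0 \<and> g1 \<and> g2 \<and> \<not> g3 \<and> \<not> g4 \<and> \<not> g5 \<and> \<not> g6) \<or> (\<not> g0 \<and> g1 \<and> g2 \<and> g3 \<and> \<not> g4 \<and> \<not> g5 \<and> \<not> g6)"
  using assms by (cases g0; cases g1; cases g2; cases g3; cases g4; cases g5; cases g6; simp)

lemma clique_one_b:
  assumes "\<not> (g0 \<and> g2)" "\<not> (g0 \<and> g3)" "\<not> (g0 \<and> g4)" "\<not> (g1 \<and> g3)" "\<not> (g1 \<and> g4)" "\<not> (g1 \<and> g5)" "\<not> (g2 \<and> g3)" "\<not> (g2 \<and> g4)" "\<not> (g2 \<and> g5)" "\<not> (g2 \<and> g6)" "\<not> (g3 \<and> g4)" "\<not> (g3 \<and> g5)" "\<not> (g3 \<and> g6)" "\<not> (g4 \<and> g5)" "\<not> (g4 \<and> g6)"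
    "(if g0 then 1 else 0) + (if g1 then 1 else 0) + (if g2 then 1 else 0) + (if g3 then 1 else 0) + (if g4 then 1 else 0) + (if g5 then 1 else 0) + (if g6 then 1 else (0::nat)) = 3"
  shows "(g0 \<and> g1 \<and> \<not> g2 \<and> \<not> g3 \<and> \<not> g4 \<and> \<not> g5 \<and> g6) \<or> (g0 \<and> \<not> g1 \<and> \<not> g2 \<and> \<not> g3 \<and> \<not> g4 \<and> g5 \<and> g6)"
  using assms by (cases g0; cases g1; cases g2; cases g3; cases g4; cases g5; cases g6; simp)

lemma clique_one_c:
  assumes "\<not> (g0 \<and> g2)" "\<not> (g0 \<and> g4)" "\<not> (g0 \<and> g5)" "\<not> (g1 \<and> g3)" "\<not> (g1 \<and> g5)" "\<not> (g1 \<and> g6)" "\<not> (g2 \<and> g3)" "\<not> (g2 \<and> g4)" "\<not> (g2 \<and> g5)" "\<not> (g2 \<and> g6)" "\<not> (g3 \<and> g5)" "\<not> (g3 \<and> g6)" "\<not> (g4 \<and> g5)" "\<not> (g4 \<and> g6)" "\<not> (g5 \<and> g6)"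
    "(if g0 then 1 else 0) + (if g1 then 1 else 0) + (if g2 then 1 else 0) + (if g3 then 1 else 0) + (if g4 then 1 else 0) + (if g5 then 1 else 0) + (if g6 then 1 else (0::nat)) = 3"
  shows "False"
  using assms by (cases g0; cases g1; cases g2; cases g3; cases g4; cases g5; cases g6; simp)

lemma clique_one_d:
  assumes "\<not> (g0 \<and> g2)" "\<not> (g0 \<and> g3)" "\<not> (g0 \<and> g5)" "\<not> (g1 \<and> g3)" "\<not> (g1 \<and> g4)" "\<not> (g1 \<and> g6)" "\<not> (g2 \<and> g3)" "\<not> (g2 \<and> g4)" "\<not> (g2 \<and> g5)" "\<not> (g2 \<and> g6)" "\<not> (g3 \<and> g4)" "\<not> (g3 \<and> g5)" "\<not> (g3 \<and> g6)" "\<not> (g4 \<and> g6)" "\<not> (g5 \<and> g6)"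
    "(if g0 then 1 else 0) + (if g1 then 1 else 0) + (if g2 then 1 else 0) + (if g3 then 1 else 0) + (if g4 then 1 else 0) + (if g5 then 1 else 0) + (if g6 then 1 else (0::nat)) = 3"
  shows "False"
  using assms by (cases g0; cases g1; cases g2; cases g3; cases g4; cases g5; cases g6; simp)

context ham
begin

lemma handshake_cyc:
  assumes "cyc v e"
  shows "(\<Sum>x\<in>V. card (onc e x)) = c * r"
proof -
  have "(\<Sum>x\<in>V. card (onc e x)) = (\<Sum>x\<in>V. \<Sum>k\<in>I. if x \<in> e k then 1 else 0)"
    unfolding onc_def by (intro sum.cong refl) (simp add: sum.If_cases Int_def)
  also have "\<dots> = (\<Sum>k\<in>I. \<Sum>x\<in>V. if x \<in> e k then 1 else 0)" by (rule sum.swap)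
  also have "\<dots> = (\<Sum>k\<in>I. r)"
  proof (intro sum.cong refl)
    fix k
    have "{x \<in> V. x \<in> e k} = e k" using subV[OF cycD(4)[OF assms]] by blast
    then show "(\<Sum>x\<in>V. if x \<in> e k then 1 else 0) = r"
      using unif[OF cycD(4)[OF assms]] by (simp add: finV sum.If_cases Int_def)
  qed
  finally show ?thesis by simp
qed

text \<open>The constraints of \<open>onc_indep\<close> for arbitrary integer positions, so that
  they can be applied to concrete numbers.\<close>

lemma raw_indep:
  assumes C: "cyc v e" and u: "u \<in> V" "u \<notin> range v" and g: "g \<in> E" "g \<notin> range e" "u \<notin> g"
    and i: "u \<in> e i"
  shows "u \<in> e j \<Longrightarrow> i mod int c \<noteq> j mod int c \<Longrightarrow> v (i + 1) \<in> g \<Longrightarrow> v (j + 1) \<notin> g"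
    and "u \<in> e j \<Longrightarrow> i mod int c \<noteq> j mod int c \<Longrightarrow> v i \<in> g \<Longrightarrow> v j \<notin> g"
    and "a \<in> unu e u \<Longrightarrow> v l \<in> a \<Longrightarrow> v (i + 1) \<in> g \<Longrightarrow> v (l + 1) \<notin> g"
    and "a \<in> unu e u \<Longrightarrow> v l \<in> a \<Longrightarrow> v i \<in> g \<Longrightarrow> v (l - 1) \<notin> g"
proof -
  have ge: "g \<noteq> e k" for k using g(2) by blast
  have L: "link v e u k (e k)" if "u \<in> e k" for k unfolding link_def using that cycD(4)[OF C] by simp
  show "v (j + 1) \<notin> g" if "u \<in> e j" "i mod int c \<noteq> j mod int c" "v (i + 1) \<in> g"
    using cross_link[OF C u that(2) L[OF i] L[OF that(1)] _ g(1,2) ge ge that(3)] cycD(2)[OF C] that(2) by simp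
  show "v j \<notin> g" if "u \<in> e j" "i mod int c \<noteq> j mod int c" "v i \<in> g"
  proof -
    have "(i + 1) mod int c \<noteq> (j + 1) mod int c" using that(2) mod_shift[of i "j + 1"] by simp
    moreover have "e i \<noteq> e j" using that(2) cycD(2)[OF C] by simp
    ultimately show ?thesis
      using cross_link_back[OF C u, of "i + 1" "j + 1" "e i" "e j" g] cycD(4)[OF C] g ge that i by simp
  qed
  have ne: "i mod int c \<noteq> l mod int c" "(i + 1) mod int c \<noteq> l mod int c" if "a \<in> unu e u" "v l \<in> a" for a l
    using insert_used[OF C u unuD(1,3,2)[OF that(1)] i] that(2) cycD(1)[OF C] by metis+
  show "v (l + 1) \<notin> g" if "a \<in> unu e u" "v l \<in> a" "v (i + 1) \<in> g"
  proof -
    have "link v e u l a" unfolding link_def using unuD[OF that(1)] that(2) by simp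
    moreover have "e i \<noteq> a" "g \<noteq> a" using unuD[OF that(1)] g(3) by auto
    ultimately show ?thesis
      using cross_link[OF C u ne(1)[OF that(1,2)] L[OF i] _ _ g(1,2) ge _ that(3)] by simp
  qed
  show "v (l - 1) \<notin> g" if "a \<in> unu e u" "v l \<in> a" "v i \<in> g"
  proof -
    have "e i \<noteq> a" "g \<noteq> a" using unuD[OF that(1)] g(3) by auto
    then show ?thesis
      using cross_link_back[OF C u ne(2)[OF that(1,2)], of "e i" a g] cycD(4)[OF C] g ge that i unuD[OF that(1)] by simp
  qed
qed

lemma no_one_unused_aux:
  assumes C: "cyc v e" and s: "sparse v e" and u: "u \<in> V" "u \<notin> range v" and a: "unu e u = {a}"
    and d: "v 0 \<in> a" "v d \<in> a" "d = 1 \<or> d = 2 \<or> d = 3"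
  shows False
proof -
  note o = one_unused[OF C s u a]
  have aU: "a \<in> unu e u" using a by simp
  have c7: "int c = 7" using o(3) by simp
  have I7: "I = {0, 1, 2, 3, 4, 5, 6}" unfolding c7 by auto
  have per: "v 7 = v 0" "v (- 1) = v 6" using cycD(1)[OF C] c7 by auto
  have nB: "u \<notin> e 6" "u \<notin> e 0" "u \<notin> e (d - 1)" "u \<notin> e d"
  proof -
    have "v (- 1 + 1) \<in> a" using d by simp
    then have "u \<notin> e (- 1)" using insert_used(2)[OF C u unuD(1,3,2)[OF aU], of "- 1"] by blast
    moreover have "e (- 1) = e 6" using cycD(2)[OF C] c7 by auto
    ultimately show "u \<notin> e 6" by simp
    show "u \<notin> e 0" using insert_used(1)[OF C u unuD(1,3,2)[OF aU], of 0] d by blast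
    show "u \<notin> e d" using insert_used(1)[OF C u unuD(1,3,2)[OF aU], of d] d by blast
    have "v (d - 1 + 1) \<in> a" using d by simp
    then show "u \<notin> e (d - 1)" using insert_used(2)[OF C u unuD(1,3,2)[OF aU], of "d - 1"] by blast
  qed
  have cnt: "card {k \<in> I. P k} = (if P 0 then 1 else 0) + (if P 1 then 1 else 0) + (if P 2 then 1 else 0) + (if P 3 then 1 else 0)
      + (if P 4 then 1 else 0) + (if P 5 then 1 else 0) + (if P 6 then 1 else (0::nat))" for P
  proof -
    have "card {k \<in> I. P k} = (\<Sum>k\<in>I. if P k then 1 else 0)" by (simp add: sum.If_cases Int_def)
    then show ?thesis unfolding I7 by simp
  qed
  have B3: "(if u \<in> e 0 then 1 else 0) + (if u \<in> e 1 then 1 else 0) + (if u \<in> e 2 then 1 else 0) + (if u \<in> e 3 then 1 else 0)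
      + (if u \<in> e 4 then 1 else 0) + (if u \<in> e 5 then 1 else 0) + (if u \<in> e 6 then 1 else (0::nat)) = 3"
    using o(4) unfolding onc_def cnt .
  have G3: "(if v 0 \<in> g then 1 else 0) + (if v 1 \<in> g then 1 else 0) + (if v 2 \<in> g then 1 else 0) + (if v 3 \<in> g then 1 else 0)
      + (if v 4 \<in> g then 1 else 0) + (if v 5 \<in> g then 1 else 0) + (if v 6 \<in> g then 1 else (0::nat)) = 3" if "g \<in> inner v e" for g
    using inner_idx(2)[OF C that] unfolding idx_def cnt o(2) .
  have ug: "u \<notin> g" if "g \<in> inner v e" for g using innerD(3)[OF that] u(2) by blast
  have R: "(u \<in> e i \<longrightarrow> u \<in> e j \<longrightarrow> v (i + 1) \<in> g \<longrightarrow> v (j + 1) \<notin> g) \<and> (u \<in> e i \<longrightarrow> u \<in> e j \<longrightarrow> v i \<in> g \<longrightarrow> v j \<notin> g)"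
    if "g \<in> inner v e" "i mod 7 \<noteq> j mod 7" for g i j
    using raw_indep(1,2)[OF C u innerD(1,2)[OF that(1)] ug[OF that(1)], of i j] that(2) unfolding c7 by blast
  have S: "(u \<in> e i \<longrightarrow> v (i + 1) \<in> g \<longrightarrow> v 1 \<notin> g \<and> v (d + 1) \<notin> g) \<and> (u \<in> e i \<longrightarrow> v i \<in> g \<longrightarrow> v 6 \<notin> g \<and> v (d - 1) \<notin> g)"
    if "g \<in> inner v e" for g i
    using raw_indep(3,4)[OF C u innerD(1,2)[OF that(1)] ug[OF that(1)], of i a 0]
      raw_indep(3,4)[OF C u innerD(1,2)[OF that(1)] ug[OF that(1)], of i a d] aU d(1,2) per(2) by auto
  have dd: "v 0 \<in> g \<and> v d \<in> g" if d23: "d = 2 \<or> d = 3" and g: "g \<in> inner v e" for g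
    using d23
  proof
    assume d2: "d = 2"
    have B: "u \<in> e 3" "u \<in> e 4" "u \<in> e 5" using B3 nB d2 by (auto split: if_splits)
    have p0: "\<not> (v 1 \<in> g \<and> v 3 \<in> g)" using S[OF g, of 3] B d2 by auto
    have p1: "\<not> (v 1 \<in> g \<and> v 4 \<in> g)" using S[OF g, of 3] B d2 by auto
    have p2: "\<not> (v 1 \<in> g \<and> v 5 \<in> g)" using S[OF g, of 4] B d2 by auto
    have p3: "\<not> (v 1 \<in> g \<and> v 6 \<in> g)" using S[OF g, of 5] B d2 by auto
    have p4: "\<not> (v 3 \<in> g \<and> v 4 \<in> g)" using R[OF g, of 3 4] B d2 by auto
    have p5: "\<not> (v 3 \<in> g \<and> v 5 \<in> g)" using R[OF g, of 3 5] B d2 by auto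
    have p6: "\<not> (v 3 \<in> g \<and> v 6 \<in> g)" using S[OF g, of 3] B d2 by auto
    have p7: "\<not> (v 4 \<in> g \<and> v 5 \<in> g)" using R[OF g, of 3 4] B d2 by auto
    have p8: "\<not> (v 4 \<in> g \<and> v 6 \<in> g)" using R[OF g, of 3 5] B d2 by auto
    have p9: "\<not> (v 5 \<in> g \<and> v 6 \<in> g)" using R[OF g, of 4 5] B d2 by auto
    show ?thesis unfolding d2
      by (rule clique_two[OF p0 p1 p2 p3 p4 p5 p6 p7 p8 p9  G3[OF g]])
  next
    assume d3: "d = 3"
    have B: "u \<in> e 1" "u \<in> e 4" "u \<in> e 5" using B3 nB d3 by (auto split: if_splits)
    have p0: "\<not> (v 1 \<in> g \<and> v 2 \<in> g)" using S[OF g, of 1] B d3 by auto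
    have p1: "\<not> (v 1 \<in> g \<and> v 4 \<in> g)" using R[OF g, of 1 4] B d3 by auto
    have p2: "\<not> (v 1 \<in> g \<and> v 5 \<in> g)" using R[OF g, of 1 5] B d3 by auto
    have p3: "\<not> (v 1 \<in> g \<and> v 6 \<in> g)" using S[OF g, of 1] B d3 by auto
    have p4: "\<not> (v 2 \<in> g \<and> v 4 \<in> g)" using S[OF g, of 1] B d3 by auto
    have p5: "\<not> (v 2 \<in> g \<and> v 5 \<in> g)" using R[OF g, of 1 4] B d3 by auto
    have p6: "\<not> (v 2 \<in> g \<and> v 6 \<in> g)" using R[OF g, of 1 5] B d3 by auto
    have p7: "\<not> (v 4 \<in> g \<and> v 5 \<in> g)" using R[OF g, of 4 5] B d3 by auto
    have p8: "\<not> (v 4 \<in> g \<and> v 6 \<in> g)" using S[OF g, of 4] B d3 by auto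
    have p9: "\<not> (v 5 \<in> g \<and> v 6 \<in> g)" using R[OF g, of 4 5] B d3 by auto
    show ?thesis unfolding d3
      by (rule clique_three[OF p0 p1 p2 p3 p4 p5 p6 p7 p8 p9  G3[OF g]])
  qed
  have Vu: "V = insert u (range v)" using outside_only[OF C _ u] o by simp
  show False
  proof (cases "d = 1")
    case False
    then have d23: "d = 2 \<or> d = 3" using d(3) by simp
    have v0d: "v 0 \<noteq> v d" using cycD(1)[OF C] c7 d23 by auto
    have U: "v 0 \<in> g \<and> v d \<in> g" if "g \<in> E" "g \<notin> range e" for g
    proof (cases "u \<in> g")
      case True
      then have "g \<in> unu e u" unfolding unu_def using that by simp
      then show ?thesis using a d by simp
    next
      case False
      then have "g \<in> inner v e" unfolding inner_def using that subV[OF that(1)] Vu by auto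
      then show ?thesis using dd[OF d23] by simp
    qed
    \<comment> \<open>Only one triple contains \<open>v 0\<close>, \<open>v d\<close> and
      \<open>x\<close>, so at least three of the four or more edges at \<open>x\<close> are cycle
      edges.\<close>
    have big: "3 \<le> card (onc e x)" if x: "x \<in> V - {v 0, v d}" for x
    proof -
      have uq: "g = {v 0, v d, x}" if "g \<in> unu e x" for g
      proof -
        have "{v 0, v d, x} \<subseteq> g" using U[OF unuD(1,3)[OF that]] unuD(2)[OF that] by simp
        moreover have "card {v 0, v d, x} = 3" using v0d x by auto
        ultimately show ?thesis
          using card_subset_eq[OF finite_edge[OF unuD(1)[OF that]]] unif[OF unuD(1)[OF that]] o(2) by metis
      qed
      have "card (unu e x) \<le> 1"
      proof (rule card_le_one)
        fix g h assume gh: "g \<in> unu e x" "h \<in> unu e x"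
        show "g = h" by (rule trans[OF uq[OF gh(1)] uq[OF gh(2), symmetric]])
      qed
      moreover have "t choose (r - 1) = 3" using o(1,2) by (simp add: choose_two)
      ultimately show ?thesis using deg_ge[OF C, of x] x by simp
    qed
    have two: "2 \<le> card (onc e (v k))" for k
    proof -
      have "{k mod int c, prv k} \<subseteq> onc e (v k)" unfolding onc_def prv_def
        using mod_in_I cycD(5,7)[OF C, of k] by (auto simp: cyc_period[OF C])
      then have "card {k mod int c, prv k} \<le> card (onc e (v k))" using onc_I by (intro card_mono)
      moreover have "k mod int c \<noteq> prv k" unfolding prv_def using mod_neq[of "k - 1" k] c7 by simp
      ultimately show ?thesis by simp
    qed
    have "(\<Sum>x\<in>V. card (onc e x)) = (\<Sum>x\<in>V - {v 0, v d}. card (onc e x)) + (\<Sum>x\<in>{v 0, v d}. card (onc e x))"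
      using cycD(3)[OF C] finV by (intro sum.subset_diff) auto
    moreover have "card (V - {v 0, v d}) * 3 \<le> (\<Sum>x\<in>V - {v 0, v d}. card (onc e x))"
      using sum_bounded_below[of "V - {v 0, v d}" 3 "\<lambda>x. card (onc e x)"] big by simp
    moreover have "card (V - {v 0, v d}) = 6"
    proof -
      have "card V = 8" unfolding Vu using u(2) range_cyc(3,5)[OF C] o by simp
      then show ?thesis using v0d cycD(3)[OF C] finV by (subst card_Diff_subset) auto
    qed
    moreover have "4 \<le> (\<Sum>x\<in>{v 0, v d}. card (onc e x))" using two[of 0] two[of d] v0d by simp
    ultimately show False using handshake_cyc[OF C] o by simp
  next
    case True
    have idx7: "idx v g = {k. (k = 0 \<and> v 0 \<in> g) \<or> (k = 1 \<and> v 1 \<in> g) \<or> (k = 2 \<and> v 2 \<in> g) \<or> (k = 3 \<and> v 3 \<in> g)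
       \<or> (k = 4 \<and> v 4 \<in> g) \<or> (k = 5 \<and> v 5 \<in> g) \<or> (k = 6 \<and> v 6 \<in> g)}" for g
      unfolding idx_def I7 by auto
    have n01: "u \<notin> e 0" "u \<notin> e 1" "u \<notin> e 6" using nB True by auto
    have "\<exists>S1 S2. \<forall>g \<in> inner v e. idx v g = S1 \<or> idx v g = S2"
    proof -
      consider (a) "u \<in> e 3" "u \<in> e 4" "u \<in> e 5" | (b) "u \<in> e 2" "u \<in> e 3" "u \<in> e 4"
        | (c) "u \<in> e 2" "u \<in> e 4" "u \<in> e 5" | (d) "u \<in> e 2" "u \<in> e 3" "u \<in> e 5"
        using B3 n01 by (auto split: if_splits)
      then show ?thesis
      proof cases
        case a
        have "idx v g = {0, 1, 2} \<or> idx v g = {1, 2, 3}" if g: "g \<in> inner v e" for g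
        proof -
          have p0: "\<not> (v 0 \<in> g \<and> v 3 \<in> g)" using S[OF g, of 3] a True by auto
          have p1: "\<not> (v 0 \<in> g \<and> v 4 \<in> g)" using S[OF g, of 4] a True by auto
          have p2: "\<not> (v 0 \<in> g \<and> v 5 \<in> g)" using S[OF g, of 5] a True by auto
          have p3: "\<not> (v 1 \<in> g \<and> v 4 \<in> g)" using S[OF g, of 3] a True by auto
          have p4: "\<not> (v 1 \<in> g \<and> v 5 \<in> g)" using S[OF g, of 4] a True by auto
          have p5: "\<not> (v 1 \<in> g \<and> v 6 \<in> g)" using S[OF g, of 5] a True by auto
          have p6: "\<not> (v 2 \<in> g \<and> v 4 \<in> g)" using S[OF g, of 3] a True by auto
          have p7: "\<not> (v 2 \<in> g \<and> v 5 \<in> g)" using S[OF g, of 4] a True by auto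
          have p8: "\<not> (v 2 \<in> g \<and> v 6 \<in> g)" using S[OF g, of 5] a True by auto
          have p9: "\<not> (v 3 \<in> g \<and> v 4 \<in> g)" using R[OF g, of 3 4] a True by auto
          have p10: "\<not> (v 3 \<in> g \<and> v 5 \<in> g)" using R[OF g, of 3 5] a True by auto
          have p11: "\<not> (v 3 \<in> g \<and> v 6 \<in> g)" using S[OF g, of 3] a True by auto
          have p12: "\<not> (v 4 \<in> g \<and> v 5 \<in> g)" using R[OF g, of 3 4] a True by auto
          have p13: "\<not> (v 4 \<in> g \<and> v 6 \<in> g)" using R[OF g, of 3 5] a True by auto
          have p14: "\<not> (v 5 \<in> g \<and> v 6 \<in> g)" using R[OF g, of 4 5] a True by auto
          have "(v 0 \<in> g \<and> v 1 \<in> g \<and> v 2 \<in> g \<and> v 3 \<notin> g \<and> v 4 \<notin> g \<and> v 5 \<notin> g \<and> v 6 \<notin> g) \<or>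
            (v 0 \<notin> g \<and> v 1 \<in> g \<and> v 2 \<in> g \<and> v 3 \<in> g \<and> v 4 \<notin> g \<and> v 5 \<notin> g \<and> v 6 \<notin> g)"
            by (rule clique_one_a[OF p0 p1 p2 p3 p4 p5 p6 p7 p8 p9 p10 p11 p12 p13 p14  G3[OF g]])
          then show ?thesis unfolding idx7 by auto
        qed
        then show ?thesis by blast
      next
        case b
        have "idx v g = {0, 1, 6} \<or> idx v g = {0, 5, 6}" if g: "g \<in> inner v e" for g
        proof -
          have p0: "\<not> (v 0 \<in> g \<and> v 2 \<in> g)" using S[OF g, of 2] b True by auto
          have p1: "\<not> (v 0 \<in> g \<and> v 3 \<in> g)" using S[OF g, of 3] b True by auto
          have p2: "\<not> (v 0 \<in> g \<and> v 4 \<in> g)" using S[OF g, of 4] b True by auto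
          have p3: "\<not> (v 1 \<in> g \<and> v 3 \<in> g)" using S[OF g, of 2] b True by auto
          have p4: "\<not> (v 1 \<in> g \<and> v 4 \<in> g)" using S[OF g, of 3] b True by auto
          have p5: "\<not> (v 1 \<in> g \<and> v 5 \<in> g)" using S[OF g, of 4] b True by auto
          have p6: "\<not> (v 2 \<in> g \<and> v 3 \<in> g)" using R[OF g, of 2 3] b True by auto
          have p7: "\<not> (v 2 \<in> g \<and> v 4 \<in> g)" using R[OF g, of 2 4] b True by auto
          have p8: "\<not> (v 2 \<in> g \<and> v 5 \<in> g)" using S[OF g, of 4] b True by auto
          have p9: "\<not> (v 2 \<in> g \<and> v 6 \<in> g)" using S[OF g, of 2] b True by auto
          have p10: "\<not> (v 3 \<in> g \<and> v 4 \<in> g)" using R[OF g, of 2 3] b True by auto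
          have p11: "\<not> (v 3 \<in> g \<and> v 5 \<in> g)" using R[OF g, of 2 4] b True by auto
          have p12: "\<not> (v 3 \<in> g \<and> v 6 \<in> g)" using S[OF g, of 3] b True by auto
          have p13: "\<not> (v 4 \<in> g \<and> v 5 \<in> g)" using R[OF g, of 3 4] b True by auto
          have p14: "\<not> (v 4 \<in> g \<and> v 6 \<in> g)" using S[OF g, of 4] b True by auto
          have "(v 0 \<in> g \<and> v 1 \<in> g \<and> v 2 \<notin> g \<and> v 3 \<notin> g \<and> v 4 \<notin> g \<and> v 5 \<notin> g \<and> v 6 \<in> g) \<or>
            (v 0 \<in> g \<and> v 1 \<notin> g \<and> v 2 \<notin> g \<and> v 3 \<notin> g \<and> v 4 \<notin> g \<and> v 5 \<in> g \<and> v 6 \<in> g)"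
            by (rule clique_one_b[OF p0 p1 p2 p3 p4 p5 p6 p7 p8 p9 p10 p11 p12 p13 p14  G3[OF g]])
          then show ?thesis unfolding idx7 by auto
        qed
        then show ?thesis by blast
      next
        case c
        have "False" if g: "g \<in> inner v e" for g
        proof -
          have p0: "\<not> (v 0 \<in> g \<and> v 2 \<in> g)" using S[OF g, of 2] c True by auto
          have p1: "\<not> (v 0 \<in> g \<and> v 4 \<in> g)" using S[OF g, of 4] c True by auto
          have p2: "\<not> (v 0 \<in> g \<and> v 5 \<in> g)" using S[OF g, of 5] c True by auto
          have p3: "\<not> (v 1 \<in> g \<and> v 3 \<in> g)" using S[OF g, of 2] c True by auto
          have p4: "\<not> (v 1 \<in> g \<and> v 5 \<in> g)" using S[OF g, of 4] c True by auto
          have p5: "\<not> (v 1 \<in> g \<and> v 6 \<in> g)" using S[OF g, of 5] c True by auto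
          have p6: "\<not> (v 2 \<in> g \<and> v 3 \<in> g)" using S[OF g, of 2] c True by auto
          have p7: "\<not> (v 2 \<in> g \<and> v 4 \<in> g)" using R[OF g, of 2 4] c True by auto
          have p8: "\<not> (v 2 \<in> g \<and> v 5 \<in> g)" using R[OF g, of 2 5] c True by auto
          have p9: "\<not> (v 2 \<in> g \<and> v 6 \<in> g)" using S[OF g, of 2] c True by auto
          have p10: "\<not> (v 3 \<in> g \<and> v 5 \<in> g)" using R[OF g, of 2 4] c True by auto
          have p11: "\<not> (v 3 \<in> g \<and> v 6 \<in> g)" using R[OF g, of 2 5] c True by auto
          have p12: "\<not> (v 4 \<in> g \<and> v 5 \<in> g)" using R[OF g, of 4 5] c True by auto
          have p13: "\<not> (v 4 \<in> g \<and> v 6 \<in> g)" using S[OF g, of 4] c True by auto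
          have p14: "\<not> (v 5 \<in> g \<and> v 6 \<in> g)" using R[OF g, of 4 5] c True by auto
          show False by (rule clique_one_c[OF p0 p1 p2 p3 p4 p5 p6 p7 p8 p9 p10 p11 p12 p13 p14  G3[OF g]])
        qed
        then show ?thesis by blast
      next
        case d
        have "False" if g: "g \<in> inner v e" for g
        proof -
          have p0: "\<not> (v 0 \<in> g \<and> v 2 \<in> g)" using S[OF g, of 2] d True by auto
          have p1: "\<not> (v 0 \<in> g \<and> v 3 \<in> g)" using S[OF g, of 3] d True by auto
          have p2: "\<not> (v 0 \<in> g \<and> v 5 \<in> g)" using S[OF g, of 5] d True by auto
          have p3: "\<not> (v 1 \<in> g \<and> v 3 \<in> g)" using S[OF g, of 2] d True by auto
          have p4: "\<not> (v 1 \<in> g \<and> v 4 \<in> g)" using S[OF g, of 3] d True by auto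
          have p5: "\<not> (v 1 \<in> g \<and> v 6 \<in> g)" using S[OF g, of 5] d True by auto
          have p6: "\<not> (v 2 \<in> g \<and> v 3 \<in> g)" using R[OF g, of 2 3] d True by auto
          have p7: "\<not> (v 2 \<in> g \<and> v 4 \<in> g)" using S[OF g, of 3] d True by auto
          have p8: "\<not> (v 2 \<in> g \<and> v 5 \<in> g)" using R[OF g, of 2 5] d True by auto
          have p9: "\<not> (v 2 \<in> g \<and> v 6 \<in> g)" using S[OF g, of 2] d True by auto
          have p10: "\<not> (v 3 \<in> g \<and> v 4 \<in> g)" using R[OF g, of 2 3] d True by auto
          have p11: "\<not> (v 3 \<in> g \<and> v 5 \<in> g)" using R[OF g, of 3 5] d True by auto
          have p12: "\<not> (v 3 \<in> g \<and> v 6 \<in> g)" using R[OF g, of 2 5] d True by auto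
          have p13: "\<not> (v 4 \<in> g \<and> v 6 \<in> g)" using R[OF g, of 3 5] d True by auto
          have p14: "\<not> (v 5 \<in> g \<and> v 6 \<in> g)" using S[OF g, of 5] d True by auto
          show False by (rule clique_one_d[OF p0 p1 p2 p3 p4 p5 p6 p7 p8 p9 p10 p11 p12 p13 p14  G3[OF g]])
        qed
        then show ?thesis by blast
      qed
    qed
    then obtain S1 S2 where S12: "\<forall>g \<in> inner v e. idx v g = S1 \<or> idx v g = S2" by blast
    have "inner v e \<subseteq> {v ` S1, v ` S2}"
    proof
      fix g assume g: "g \<in> inner v e"
      then have "g = v ` S1 \<or> g = v ` S2" using S12 inner_idx(1)[OF C g] by metis
      then show "g \<in> {v ` S1, v ` S2}" by simp
    qed
    then have "card (inner v e) \<le> card {v ` S1, v ` S2}" by (intro card_mono) auto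
    also have "\<dots> \<le> 2" by (simp add: card_insert_if)
    finally show False using card_inner[OF C s] by simp
  qed
qed

lemma no_one_unused:
  assumes C: "cyc v e" and s: "sparse v e" and u: "u \<in> V" "u \<notin> range v"
  shows "unu e u = {}"
proof (rule ccontr)
  assume "unu e u \<noteq> {}"
  then have "card (unu e u) \<noteq> 0" using finite_unu[of e u] by simp
  then have "card (unu e u) = 1" using unused_le_one(2)[OF C s u] by linarith
  then obtain a where a: "unu e u = {a}" by (rule card_1_singletonE)
  note o = one_unused[OF C s u a]
  have c7: "int c = 7" using o(3) by simp
  obtain i j where ij: "idx v a = {i, j}" "i \<noteq> j" using o(5) by (meson card_2_iff)
  have main: False if k: "v k \<in> a" "v (k + d) \<in> a" "d = 1 \<or> d = 2 \<or> d = 3" for k d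
  proof -
    have r1: "range (\<lambda>i. v (i + k)) = range v" "range (\<lambda>i. e (i + k)) = range e"
      by (auto simp: image_iff) (metis diff_add_cancel)+
    show False
      by (rule no_one_unused_aux[OF cyc_shift[OF C, of k], of u a d])
        (use s u a k r1 in \<open>auto simp: sparse_def unu_def add.commute\<close>)
  qed
  have ij2: "v i \<in> a" "v j \<in> a" "0 \<le> i" "i < 7" "0 \<le> j" "j < 7" using ij unfolding idx_def c7 by auto
  have per: "v (k + 7) = v k" for k using cyc_period(1)[OF C, of k] unfolding c7 .
  \<comment> \<open>On a 7-cycle, two positions are at distance at most 3 one way round.\<close>
  have "(j - i = 1 \<or> j - i = 2 \<or> j - i = 3) \<or> (i - j = 1 \<or> i - j = 2 \<or> i - j = 3) \<or>
    (i + 7 - j = 1 \<or> i + 7 - j = 2 \<or> i + 7 - j = 3) \<or> (j + 7 - i = 1 \<or> j + 7 - i = 2 \<or> j + 7 - i = 3)"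
    using ij2(3-6) ij(2) by presburger
  then consider "j - i = 1 \<or> j - i = 2 \<or> j - i = 3" | "i - j = 1 \<or> i - j = 2 \<or> i - j = 3"
    | "i + 7 - j = 1 \<or> i + 7 - j = 2 \<or> i + 7 - j = 3" | "j + 7 - i = 1 \<or> j + 7 - i = 2 \<or> j + 7 - i = 3"
    by blast
  then show False
    using main[of i "j - i"] main[of j "i - j"] main[of j "i + 7 - j"] main[of i "j + 7 - i"] ij2 per
    by cases (simp_all add: algebra_simps)
qed

text \<open>All edges at \<open>u\<close> are cycle edges, so \<open>B\<close> has at least
  \<open>t + 1\<close> elements. An inner edge has at most one vertex in \<open>B\<close>, at most
  one in \<open>P\<close>, and the rest outside \<open>B \<union> P\<close>. With
  \<open>c \<le> 2 * t + 1\<close> this leaves hardly any room, and a configuration that determines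
  the inner edge completely is impossible because there are three.\<close>

lemma zero_facts:
  assumes C: "cyc v e" and s: "sparse v e" and u: "u \<in> V" "u \<notin> range v"
  defines "B \<equiv> onc e u" and "P \<equiv> plus (onc e u)"
  shows "r = t" "c = 2 * t + 1" "card B = t + 1" "card (P - B) + card (I - (B \<union> P)) = t"
    "card (P - B) = 1 \<or> card (P - B) = 2" "card (B - P) = card (P - B)"
    "g \<in> inner v e \<Longrightarrow> card (idx v g \<inter> B) \<le> 1" "g \<in> inner v e \<Longrightarrow> card (idx v g \<inter> P) \<le> 1"
proof -
  let ?Z = "I - (B \<union> P)"
  have un: "unu e u = {}" by (rule no_one_unused[OF C s u])
  have q: "(t choose (r - 1)) + 1 \<le> card B" using deg_ge[OF C u(1)] un unfolding B_def by simp
  have BI: "B \<subseteq> I" "finite B" unfolding B_def by (rule onc_I)+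
  have PI: "P \<subseteq> I" "finite P" unfolding P_def by (rule plus_I)+
  have cP: "card P = card B" unfolding P_def B_def by (rule card_plus[OF onc_I(1)])
  have i1: "card (idx v g \<inter> B) \<le> 1" and i2: "card (idx v g \<inter> P) \<le> 1" if g: "g \<in> inner v e" for g
  proof -
    note ind = onc_indep[OF C u innerD(1,2)[OF g]]
    show "card (idx v g \<inter> B) \<le> 1"
      by (rule card_le_one) (use ind(2) in \<open>auto simp: idx_def B_def\<close>)
    show "card (idx v g \<inter> P) \<le> 1"
      by (rule card_le_one) (use ind(1) in \<open>auto simp: idx_def P_def\<close>)
  qed
  show "card (idx v g \<inter> B) \<le> 1" "card (idx v g \<inter> P) \<le> 1" if "g \<in> inner v e" for g
    using i1[OF that] i2[OF that] by auto
  obtain g0 where g0: "g0 \<in> inner v e" using card_inner[OF C s] by fastforce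
  have Pne: "P \<noteq> I"
  proof
    assume "P = I"
    then have "idx v g0 \<inter> P = idx v g0" using idx_I by blast
    then show False using i2[OF g0] inner_idx(2)[OF C g0] r3 by simp
  qed
  have P0: "P \<noteq> {}" using cP q by (metis Suc_eq_plus1 card.empty not_less_eq_eq zero_le)
  have cBP: "card (B \<union> P) = card B + card (P - B)"
    using card_Un_disjoint[of B "P - B"] BI PI by simp
  have "card (B \<union> P) = card P + card (B - P)"
    using card_Un_disjoint[of P "B - P"] BI PI by (simp add: Un_commute)
  then show rho: "card (B - P) = card (P - B)" using cBP cP by simp
  have "card P + 1 \<le> card (touch P)" by (rule card_touch[OF PI(1) P0 Pne])
  then have rho1: "1 \<le> card (P - B)" using touch_plus[OF onc_I(1), of e u] cBP cP unfolding P_def B_def by simp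
  have cZ: "card ?Z + card B + card (P - B) = c"
  proof -
    have "card ?Z = c - card (B \<union> P)" using BI PI by (subst card_Diff_subset) auto
    moreover have "card (B \<union> P) \<le> c" using card_mono[of I "B \<union> P"] BI PI by simp
    ultimately show ?thesis using cBP by linarith
  qed
  have G: "r \<le> card (idx v g \<inter> ?Z) + card (idx v g \<inter> B \<union> idx v g \<inter> P)" if "g \<in> inner v e" for g
  proof -
    have "idx v g = (idx v g \<inter> ?Z) \<union> (idx v g \<inter> B \<union> idx v g \<inter> P)" using idx_I by blast
    then show ?thesis using card_Un_le[of "idx v g \<inter> ?Z" "idx v g \<inter> B \<union> idx v g \<inter> P"] inner_idx(2)[OF C that] by simp
  qed
  have G2: "card (idx v g \<inter> B \<union> idx v g \<inter> P) \<le> 2" if "g \<in> inner v e" for g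
    using card_Un_le[of "idx v g \<inter> B" "idx v g \<inter> P"] i1[OF that] i2[OF that] by linarith
  have GZ: "card (idx v g \<inter> ?Z) \<le> card ?Z" for g by (intro card_mono) auto
  have r2: "r \<le> card ?Z + 2" using G[OF g0] G2[OF g0] GZ[of g0] by linarith
  \<comment> \<open>Here every inner edge would consist of all positions outside
    \<open>B \<union> P\<close> and the single elements of \<open>P - B\<close> and
    \<open>B - P\<close>.\<close>
  have nu: "\<not> (r = card ?Z + 2 \<and> card (P - B) = 1)"
  proof
    assume a: "r = card ?Z + 2 \<and> card (P - B) = 1"
    obtain p where p: "P - B = {p}" using a by (meson card_1_singletonE)
    obtain b where b: "B - P = {b}" using a rho by (metis card_1_singletonE)
    have "idx v g = ?Z \<union> {p, b}" if g: "g \<in> inner v e" for g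
    proof -
      have e2: "card (idx v g \<inter> B \<union> idx v g \<inter> P) = 2" and eZ: "card (idx v g \<inter> ?Z) = card ?Z"
        using G[OF g] G2[OF g] GZ[of g] a by linarith+
      have Zeq: "idx v g \<inter> ?Z = ?Z" using eZ by (intro card_subset_eq) auto
      have cs: "card (idx v g \<inter> B) = 1" "card (idx v g \<inter> P) = 1"
        using e2 card_Un_le[of "idx v g \<inter> B" "idx v g \<inter> P"] i1[OF g] i2[OF g] by linarith+
      obtain x where x: "idx v g \<inter> B = {x}" using cs(1) by (rule card_1_singletonE)
      obtain y where y: "idx v g \<inter> P = {y}" using cs(2) by (rule card_1_singletonE)
      have xy: "x \<noteq> y"
      proof
        assume "x = y"
        then have "card (idx v g \<inter> B \<union> idx v g \<inter> P) = 1" unfolding x y by simp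
        then show False using e2 by simp
      qed
      have xin: "x \<in> idx v g" "x \<in> B" and yin: "y \<in> idx v g" "y \<in> P" using x y by auto
      have "x \<notin> P" using xin(1) y xy by (metis IntI singletonD)
      then have xb: "x = b" using xin(2) b by (metis DiffI singletonD)
      have "y \<notin> B" using yin(1) x xy by (metis IntI singletonD)
      then have yp: "y = p" using yin(2) p by (metis DiffI singletonD)
      have d: "idx v g = (idx v g \<inter> ?Z) \<union> (idx v g \<inter> B \<union> idx v g \<inter> P)" using idx_I by blast
      show ?thesis using d unfolding Zeq x y xb yp by (simp add: insert_commute)
    qed
    then have "g = g'" if "g \<in> inner v e" "g' \<in> inner v e" for g g'
      using inner_idx(1)[OF C that(1)] inner_idx(1)[OF C that(2)] that by metis
    then have "card (inner v e) \<le> 1" by (rule card_le_one)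
    then show False using card_inner[OF C s] by simp
  qed
  show rt': "r = t"
  proof (rule ccontr)
    assume "r \<noteq> t"
    then have "r < t" using rt by simp
    then have "2 * t \<le> (t choose (r - 1)) + 2" using choose_ge_two_cases[OF r3 \<open>r < t\<close>] by linarith
    then have "card (P - B) = 1" "r = card ?Z + 2" using q cZ r2 rho1 c_le r3 by linarith+
    then show False using nu by blast
  qed
  have tau: "t \<le> t choose (r - 1)" by (rule tau_ge)
  have "card (P - B) \<noteq> 1 \<or> r \<noteq> card ?Z + 2" using nu by blast
  then show rz: "card (P - B) + card ?Z = t" using q cZ r2 rho1 c_le rt' tau by linarith
  then show "c = 2 * t + 1" "card B = t + 1" using q cZ c_le tau by linarith+
  show "card (P - B) = 1 \<or> card (P - B) = 2" using rz r2 rho1 rt' by linarith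
qed

text \<open>For \<open>k\<close> in \<open>B \<inter> P\<close>, both cycle edges at
  \<open>v k\<close> contain \<open>u\<close>, so \<open>u\<close> and \<open>v k\<close> can be
  exchanged without changing an edge, and \<open>v k\<close> behaves like an outside vertex. Finally
  all these vertices lie on exactly the cycle edges in \<open>B\<close>, like \<open>u\<close>, and
  an edge at a position of \<open>B - P\<close> would need more than \<open>r\<close>
  vertices.\<close>

lemma not_sparse:
  assumes C: "cyc v e"
  shows "\<not> sparse v e"
proof
  assume s: "sparse v e"
  have "card (range v) < card V" using range_cyc(3)[OF C] cV by simp
  then obtain u where u: "u \<in> V" "u \<notin> range v" using range_cyc(5)[OF C] by (meson card_mono leD subsetI)
  define B where "B = onc e u"
  define P where "P = plus (onc e u)"
  define Y where "Y = I - B \<inter> P"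
  define Z where "Z = I - (B \<union> P)"
  note z = zero_facts[OF C s u, folded B_def P_def]
  have rt': "r = t" and c: "c = 2 * t + 1" using z by auto
  have BI: "B \<subseteq> I" "finite B" unfolding B_def by (rule onc_I)+
  have PI: "P \<subseteq> I" "finite P" unfolding P_def by (rule plus_I)+
  have none: "unu e' w = {}" if "cyc v' e'" "w \<in> V" "w \<notin> range v'" for v' e' w
    using no_one_unused[OF that(1) sparse_full[OF that(1) c] that(2,3)] .
  have outk: "v k \<in> V \<and> v k \<notin> range (upd v k u)" for k
    using cycD(3)[OF C] cycD(1)[OF C] u(2) unfolding upd_def by auto
  have kB: "u \<in> e (k - 1) \<and> u \<in> e k" if "k \<in> B \<inter> P" for k
  proof -
    have "prv k \<in> onc e u" "k \<in> onc e u" using that unfolding B_def P_def plus_def by auto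
    then show ?thesis unfolding onc_def prv_def by (simp add: cyc_period[OF C])
  qed
  have avoid: "v k \<notin> g" if k: "k \<in> B \<inter> P" and g: "g \<in> E" "g \<notin> range e" for k g
  proof
    assume "v k \<in> g"
    then have "g \<in> unu e (v k)" unfolding unu_def using g by simp
    moreover have "cyc (upd v k u) e" using cyc_swap[OF C u(2,1)] kB[OF k] by blast
    ultimately show False using none[of "upd v k u" e "v k"] outk by auto
  qed
  have Vu: "V = insert u (range v)" by (rule outside_only[OF C c u])
  have inn: "g \<in> inner v e" if "g \<in> E" "g \<notin> range e" for g
  proof -
    have "u \<notin> g" using none[OF C u] that unfolding unu_def by auto
    then show ?thesis unfolding inner_def using that subV[OF that(1)] Vu by auto
  qed
  have four: "4 \<le> card (inner v e)"
  proof -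
    have "E \<subseteq> range e \<union> inner v e" using inn by blast
    then have "card E \<le> card (range e \<union> inner v e)" using range_cyc(6)[OF C] finE by (intro card_mono) (auto simp: inner_def)
    also have "\<dots> \<le> card (range e) + card (inner v e)" by (rule card_Un_le)
    finally have "card E \<le> c + card (inner v e)" using range_cyc(4)[OF C] by simp
    then show ?thesis using card_E cV by linarith
  qed
  have GY: "idx v g \<subseteq> Y" if g: "g \<in> inner v e" for g
  proof
    fix k assume k: "k \<in> idx v g"
    then have "k \<in> I" "v k \<in> g" unfolding idx_def by auto
    then show "k \<in> Y" unfolding Y_def using avoid[OF _ innerD(1,2)[OF g], of k] by auto
  qed
  have idx_inj: "inj_on (idx v) (inner v e)"
    by (rule inj_onI) (metis inner_idx(1)[OF C])
  have cY: "card Y = card (P - B) + t"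
  proof -
    have "Y = Z \<union> (P - B) \<union> (B - P)" unfolding Y_def Z_def using BI PI by blast
    moreover have "card (Z \<union> (P - B) \<union> (B - P)) = card Z + card (P - B) + card (B - P)"
      unfolding Z_def using BI PI by (subst card_Un_disjoint; (subst card_Un_disjoint)?) auto
    ultimately show ?thesis using z(4,6) unfolding Z_def by simp
  qed
  \<comment> \<open>An inner edge that can replace \<open>e i\<close>. If \<open>P - B\<close> has
    one element, inner edges are \<open>Y\<close> without one vertex; if it has two, they are among
    the four sets \<open>Z \<union> {p, l}\<close>. As there are four inner edges, one contains both
    ends of \<open>e i\<close>.\<close>
  have pair: "\<exists>g \<in> inner v e. v i \<in> g \<and> v (i + 1) \<in> g" if i: "i \<in> I" "i \<notin> B" for i
  proof -
    define j where "j = (i + 1) mod int c"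
    have jI: "j \<in> I" unfolding j_def by (rule mod_in_I)
    have pj: "prv j = i" unfolding prv_def j_def using i(1) by (simp add: mod_diff_left_eq)
    have vj: "v (i + 1) = v j" unfolding j_def using cyc_period(3)[OF C] by simp
    have jP: "j \<notin> P" unfolding P_def plus_def using pj i(2) B_def by auto
    have ij: "i \<in> Y" "j \<in> Y" unfolding Y_def using i jI jP by auto
    have "\<exists>g \<in> inner v e. i \<in> idx v g \<and> j \<in> idx v g"
    proof (cases "card (P - B) = 1")
      case True
      show ?thesis
      proof (rule ccontr)
        assume n: "\<not> ?thesis"
        have "idx v g \<in> {Y - {i}, Y - {j}}" if g: "g \<in> inner v e" for g
        proof -
          obtain k where k: "k = i \<or> k = j" "k \<notin> idx v g" using n g by blast
          have "idx v g \<subseteq> Y - {k}" using GY[OF g] k by blast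
          moreover have "card (Y - {k}) = t" using cY True k ij by auto
          moreover have "finite (Y - {k})" unfolding Y_def by simp
          ultimately have "idx v g = Y - {k}" using inner_idx(2)[OF C g] rt' by (intro card_subset_eq) auto
          then show ?thesis using k by auto
        qed
        then have "idx v ` inner v e \<subseteq> {Y - {i}, Y - {j}}" by blast
        then have "card (idx v ` inner v e) \<le> card {Y - {i}, Y - {j}}" by (intro card_mono) auto
        also have "\<dots> \<le> 2" by (simp add: card_insert_if)
        finally show False using four card_image[OF idx_inj] by simp
      qed
    next
      case False
      then have rho: "card (P - B) = 2" "card (B - P) = 2" "card Z = t - 2" using z(4,5,6) unfolding Z_def by auto
      have dec: "\<exists>p \<in> P - B. \<exists>l \<in> B - P. idx v g = Z \<union> {p, l}" if g: "g \<in> inner v e" for g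
      proof -
        let ?G = "idx v g"
        have G: "?G = (?G \<inter> Z) \<union> (?G \<inter> (P - B) \<union> ?G \<inter> (B - P))" using GY[OF g] BI PI unfolding Y_def Z_def by blast
        have l1: "card (?G \<inter> (P - B)) \<le> 1"
          by (rule order_trans[OF card_mono z(8)[OF g]]) (use finite_idx in auto)
        have l2: "card (?G \<inter> (B - P)) \<le> 1"
          by (rule order_trans[OF card_mono z(7)[OF g]]) (use finite_idx in auto)
        have fZ: "finite Z" unfolding Z_def by simp
        have l3: "card (?G \<inter> Z) \<le> card Z" using fZ by (intro card_mono) auto
        have "card ?G \<le> card (?G \<inter> Z) + (card (?G \<inter> (P - B)) + card (?G \<inter> (B - P)))"
          using card_Un_le[of "?G \<inter> Z" "?G \<inter> (P - B) \<union> ?G \<inter> (B - P)"] card_Un_le[of "?G \<inter> (P - B)" "?G \<inter> (B - P)"]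
            arg_cong[OF G, of card] by linarith
        then have e: "card (?G \<inter> Z) = card Z" "card (?G \<inter> (P - B)) = 1" "card (?G \<inter> (B - P)) = 1"
          using l1 l2 l3 inner_idx(2)[OF C g] rho rt' c5 by linarith+
        have Zeq: "?G \<inter> Z = Z" using e(1) fZ by (intro card_subset_eq) auto
        obtain p where p: "?G \<inter> (P - B) = {p}" using e(2) by (rule card_1_singletonE)
        obtain l where l: "?G \<inter> (B - P) = {l}" using e(3) by (rule card_1_singletonE)
        have "?G = Z \<union> {p, l}" using G unfolding Zeq p l by (simp add: insert_commute)
        moreover have "p \<in> P - B" "l \<in> B - P" using p l by blast+
        ultimately show ?thesis by blast
      qed
      define f where "f = (\<lambda>(p, l). Z \<union> {p, l})"
      have sub: "idx v ` inner v e \<subseteq> f ` ((P - B) \<times> (B - P))"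
      proof
        fix x assume "x \<in> idx v ` inner v e"
        then obtain g where g: "g \<in> inner v e" "x = idx v g" by blast
        obtain p l where "p \<in> P - B" "l \<in> B - P" "idx v g = Z \<union> {p, l}" using dec[OF g(1)] by blast
        then have "x = f (p, l)" "(p, l) \<in> (P - B) \<times> (B - P)" using g(2) unfolding f_def by auto
        then show "x \<in> f ` ((P - B) \<times> (B - P))" by blast
      qed
      have fin: "finite ((P - B) \<times> (B - P))" using BI PI by simp
      have "card (f ` ((P - B) \<times> (B - P))) \<le> 4"
        using card_image_le[OF fin, of f] rho by (simp add: card_cartesian_product)
      then have "idx v ` inner v e = f ` ((P - B) \<times> (B - P))"
        using four card_image[OF idx_inj] sub fin by (intro card_seteq) auto
      then have all: "\<exists>g \<in> inner v e. idx v g = Z \<union> {p, l}" if "p \<in> P - B" "l \<in> B - P" for p l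
      proof -
        have "f (p, l) \<in> idx v ` inner v e" using that \<open>idx v ` inner v e = _\<close> by blast
        then show ?thesis unfolding f_def by auto
      qed
      have ne: "P - B \<noteq> {}" "B - P \<noteq> {}" using rho(1,2) by (metis card.empty zero_neq_numeral)+
      have "\<exists>p \<in> P - B. i \<in> Z \<union> {p}" using i ne(1) unfolding Z_def by blast
      moreover have "\<exists>l \<in> B - P. j \<in> Z \<union> {l}" using jI jP ne(2) unfolding Z_def by blast
      ultimately obtain p l where pl: "p \<in> P - B" "l \<in> B - P" "i \<in> Z \<union> {p}" "j \<in> Z \<union> {l}" by blast
      obtain g where "g \<in> inner v e" "idx v g = Z \<union> {p, l}" using all[OF pl(1,2)] by blast
      then show ?thesis using pl by blast
    qed
    then show ?thesis unfolding vj idx_def by blast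
  qed
  have late: "v k \<notin> e i" if k: "k \<in> B \<inter> P" and i: "i \<in> I" "i \<notin> B" for k i
  proof
    assume vk: "v k \<in> e i"
    obtain g where g: "g \<in> inner v e" "v i \<in> g" "v (i + 1) \<in> g" using pair[OF i] by blast
    let ?e = "upd e i g"
    have C2: "cyc v ?e" by (rule cyc_upd_edge[OF C innerD(2,1)[OF g(1)] g(2,3)])
    have ug: "u \<notin> e i" using i unfolding B_def onc_def by auto
    have keep: "?e j = e j" if "u \<in> e j" for j
    proof -
      have "e j \<noteq> e i" using that ug by auto
      then show ?thesis unfolding upd_def using cycD(2)[OF C] by auto
    qed
    have "u \<in> ?e (k - 1)" "u \<in> ?e k" using keep[of "k - 1"] keep[of k] kB[OF k] by auto
    then have C3: "cyc (upd v k u) ?e" by (rule cyc_swap[OF C2 u(2,1)])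
    have "e i \<notin> range ?e"
    proof
      assume "e i \<in> range ?e"
      then obtain j where j: "e i = ?e j" by auto
      have "e i \<noteq> g" using innerD(2)[OF g(1)] by blast
      then show False using j cycD(2)[OF C] unfolding upd_def by (auto split: if_splits)
    qed
    then have "e i \<in> unu ?e (v k)" unfolding unu_def using vk cycD(4)[OF C] by simp
    then show False using none[OF C3] outk by auto
  qed
  have onB: "onc e (v k) = B" if k: "k \<in> B \<inter> P" for k
  proof -
    have sub: "onc e (v k) \<subseteq> B" using late[OF k] unfolding onc_def[of e "v k"] by blast
    have "unu e (v k) = {}" unfolding unu_def using avoid[OF k] by blast
    then have "t + 1 \<le> card (onc e (v k))" using deg_ge[OF C cycD(3)[OF C, of k]] tau_ge by simp
    then show ?thesis using sub z(3) BI(2) by (intro card_seteq) auto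
  qed
  have "card (B - P) \<noteq> 0" using z(5,6) by linarith
  then have "B - P \<noteq> {}" by (metis card.empty)
  then obtain i where i: "i \<in> B" "i \<notin> P" by blast
  have "insert u (insert (v i) (v ` (B \<inter> P))) \<subseteq> e i"
  proof -
    have "v k \<in> e i" if "k \<in> B \<inter> P" for k using onB[OF that] i(1) unfolding onc_def[of e "v k"] by blast
    moreover have "u \<in> e i" using i(1) unfolding B_def onc_def by simp
    ultimately show ?thesis using cycD(5)[OF C] by blast
  qed
  then have "card (insert u (insert (v i) (v ` (B \<inter> P)))) \<le> r"
    using card_mono[OF finite_edge[OF cycD(4)[OF C]]] unif[OF cycD(4)[OF C]] by metis
  moreover have "card (insert u (insert (v i) (v ` (B \<inter> P)))) = card (B \<inter> P) + 2"
  proof -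
    have "card (v ` (B \<inter> P)) = card (B \<inter> P)"
      using cyc_inj(1)[OF C] BI by (meson card_image inf.coboundedI1 inj_on_subset)
    moreover have "v i \<notin> v ` (B \<inter> P)"
      using inj_on_image_mem_iff[OF cyc_inj(1)[OF C], of i "B \<inter> P"] i BI by blast
    moreover have "u \<notin> insert (v i) (v ` (B \<inter> P))" using u(2) by auto
    ultimately show ?thesis using BI(2) by simp
  qed
  moreover have "card B = card (B \<inter> P) + card (B - P)" using card_Int_Diff[OF BI(2)] by simp
  ultimately show False using z(3,5,6) rt' by linarith
qed

subsection \<open>Paths outside the cycle\<close>

definition qpath :: "(int \<Rightarrow> 'a) \<Rightarrow> (int \<Rightarrow> 'a set) \<Rightarrow> 'a list \<Rightarrow> 'a set list \<Rightarrow> bool" where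
  "qpath v e us fs \<longleftrightarrow> bp us fs \<and> distinct us \<and> set us \<subseteq> V - range v \<and> distinct fs \<and> set fs \<subseteq> E - range e"

text \<open>Longest only with respect to this one cycle; at least two vertices are demanded so that
  the two ends differ.\<close>

definition qlong :: "(int \<Rightarrow> 'a) \<Rightarrow> (int \<Rightarrow> 'a set) \<Rightarrow> 'a list \<Rightarrow> 'a set list \<Rightarrow> bool" where
  "qlong v e us fs \<longleftrightarrow> cyc v e \<and> qpath v e us fs \<and> 2 \<le> length us \<and> (\<forall>us' fs'. qpath v e us' fs' \<longrightarrow> length us' \<le> length us)"

lemma qpathD:
  assumes "qpath v e us fs"
  shows "bp us fs" "distinct us" "set us \<subseteq> V" "set us \<inter> range v = {}" "distinct fs" "set fs \<subseteq> E" "set fs \<inter> range e = {}"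
    "length us = Suc (length fs)" "hd us \<in> set us" "last us \<in> set us"
  using assms bp_length[of us fs] bp_not_Nil[of us fs] unfolding qpath_def by auto

lemma qlongD:
  assumes "qlong v e us fs"
  shows "cyc v e" "qpath v e us fs" "2 \<le> length us" "qpath v e us' fs' \<Longrightarrow> length us' \<le> length us"
  using assms unfolding qlong_def by auto

lemma qpath_rev: "qpath v e us fs \<Longrightarrow> qpath v e (rev us) (rev fs)"
  unfolding qpath_def using bp_rev by auto

lemma qlong_rev: "qlong v e us fs \<Longrightarrow> qlong v e (rev us) (rev fs)"
  unfolding qlong_def using qpath_rev by auto

lemma range_shift: "range (\<lambda>i. (f::int \<Rightarrow> 'b) (i + s)) = range f"
proof
  show "range f \<subseteq> range (\<lambda>i. f (i + s))"
  proof
    fix x assume "x \<in> range f"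
    then obtain k where "x = f k" by auto
    then have "x = f ((k - s) + s)" by simp
    then show "x \<in> range (\<lambda>i. f (i + s))" by blast
  qed
qed auto

lemma qlong_shift: "qlong v e us fs \<Longrightarrow> qlong (\<lambda>i. v (i + s)) (\<lambda>i. e (i + s)) us fs"
  unfolding qlong_def qpath_def range_shift using cyc_shift by blast

lemma ex_qlong:
  assumes C: "cyc v e"
  shows "\<exists>us fs. qlong v e us fs"
proof -
  have "\<not> sparse v e" by (rule not_sparse[OF C])
  then obtain a x y where a: "a \<in> E" "a \<notin> range e" "x \<in> a - range v" "y \<in> a - range v" "x \<noteq> y"
    unfolding sparse_def by blast
  have "x \<in> V" "y \<in> V" using subV[OF a(1)] a by auto
  then have "qpath v e [x, y] [a]" unfolding qpath_def using a by auto
  then have ex: "\<exists>fs. qpath v e [x, y] fs" by blast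
  have "\<forall>us. (\<exists>fs. qpath v e us fs) \<longrightarrow> length us < Suc (card V)"
  proof (intro allI impI)
    fix us assume "\<exists>fs. qpath v e us fs"
    then obtain fs where q: "qpath v e us fs" by blast
    have "card (set us) \<le> card V" using qpathD(3)[OF q] finV by (intro card_mono)
    then show "length us < Suc (card V)" using distinct_card[OF qpathD(2)[OF q]] by simp
  qed
  then have "\<exists>us. (\<exists>fs. qpath v e us fs) \<and> (\<forall>us'. (\<exists>fs. qpath v e us' fs) \<longrightarrow> length us' \<le> length us)"
    using ex by (rule ex_has_greatest_nat[rotated])
  then obtain us fs where m: "qpath v e us fs" "\<forall>us'. (\<exists>fs. qpath v e us' fs) \<longrightarrow> length us' \<le> length us" by blast
  then have "length [x, y] \<le> length us" using ex by blast
  then have "qlong v e us fs" unfolding qlong_def using C m by auto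
  then show ?thesis by blast
qed

lemma qlong_len:
  assumes "qlong v e us fs"
  shows "length us + c \<le> card V" "length us \<le> t" "c + length us \<le> 2 * t + 2"
proof -
  note d = qlongD[OF assms] and q = qpathD[OF qlongD(2)[OF assms]]
  have "card (set us \<union> range v) \<le> card V"
    using q(3) range_cyc(7)[OF d(1)] finV by (intro card_mono) auto
  moreover have "card (set us \<union> range v) = length us + c"
    using q(4) range_cyc(3,5)[OF d(1)] distinct_card[OF q(2)] by (simp add: card_Un_disjoint)
  ultimately show "length us + c \<le> card V" by simp
  then show "length us \<le> t" "c + length us \<le> 2 * t + 2" using nV ct by auto
qed

text \<open>The edges that could extend the path beyond its last vertex; maximality therefore
  confines them to the path and the cycle. The first vertex is treated by reversing the
  path.\<close>

definition far :: "(int \<Rightarrow> 'a set) \<Rightarrow> 'a list \<Rightarrow> 'a set list \<Rightarrow> 'a set set" where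
  "far e us fs = unu e (last us) - set fs"

lemma far_sub:
  assumes Q: "qlong v e us fs" and a: "a \<in> far e us fs"
  shows "a \<subseteq> set us \<union> range v" "a \<in> E" "a \<notin> range e" "a \<notin> set fs" "last us \<in> a"
proof -
  note d = qlongD[OF Q] and q = qpathD[OF qlongD(2)[OF Q]]
  show a': "a \<in> E" "a \<notin> range e" "a \<notin> set fs" "last us \<in> a" using a unuD[of a e "last us"] unfolding far_def by auto
  show "a \<subseteq> set us \<union> range v"
  proof
    fix y assume y: "y \<in> a"
    show "y \<in> set us \<union> range v"
    proof (rule ccontr)
      assume n: "y \<notin> set us \<union> range v"
      have "bp (us @ [y]) (fs @ a # [])" using q(1) a' y by (intro bp_append) auto
      then have "qpath v e (us @ [y]) (fs @ [a])" unfolding qpath_def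
        using q n y a' subV[OF a'(1)] by auto
      then show False using d(4) by fastforce
    qed
  qed
qed

lemma qbridge:
  assumes C: "cyc v e" and Q: "qpath v e us fs" and ij: "i < j" "j \<le> i + int c"
    and a: "a \<in> E" "a \<notin> set fs" "hd us \<in> a" "v i \<in> a" and b: "b \<in> E" "b \<notin> set fs" "last us \<in> b" "v j \<in> b"
    and ab: "a \<noteq> b" and no: "\<And>k. j \<le> k \<Longrightarrow> k < i + int c \<Longrightarrow> e k \<noteq> a \<and> e k \<noteq> b"
  shows "int (length us) + 1 \<le> j - i"
proof -
  note q = qpathD[OF Q]
  show ?thesis
  proof (rule bridge[OF C ij q(1-4), of a b])
    show "distinct (a # b # fs)" using ab a b q by auto
    show "set (a # b # fs) \<subseteq> E" using a b q by auto
    show "e k \<notin> set (a # b # fs)" if "j \<le> k" "k < i + int c" for k using no[OF that] q(7) by auto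
  qed (use a b in auto)
qed

lemma bridge_VV:
  assumes C: "cyc v e" and Q: "qpath v e us fs" and ij: "i < j" "j \<le> i + int c"
    and a: "a \<in> E" "a \<notin> range e" "a \<notin> set fs" "hd us \<in> a" "v i \<in> a"
    and b: "b \<in> E" "b \<notin> range e" "b \<notin> set fs" "last us \<in> b" "v j \<in> b" and ab: "a \<noteq> b"
  shows "int (length us) + 1 \<le> j - i"
  using a b ab by (intro qbridge[OF C Q ij, of a b]) auto

text \<open>The attachment through \<open>e i\<close> is taken at the end for which
  \<open>e i\<close> lies on the replaced arc: \<open>v i\<close> going forward,
  \<open>v (i + 1)\<close> going backward. Hence the second bound is smaller by one.\<close>

lemma bridge_EV:
  assumes C: "cyc v e" and Q: "qpath v e us fs" and i: "hd us \<in> e i"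
    and b: "b \<in> E" "b \<notin> range e" "b \<notin> set fs" "last us \<in> b" "v j \<in> b"
  shows "i < j \<Longrightarrow> j \<le> i + int c \<Longrightarrow> int (length us) + 1 \<le> j - i"
    and "j \<le> i \<Longrightarrow> i < j + int c \<Longrightarrow> int (length us) \<le> i - j"
proof -
  note q = qpathD[OF Q]
  have nb: "e k \<noteq> b" for k using b(2) by blast
  have nf: "e k \<notin> set fs" for k using q(7) by blast
  show "int (length us) + 1 \<le> j - i" if ij: "i < j" "j \<le> i + int c"
  proof (rule qbridge[OF C Q ij, of "e i" b])
    show "e k \<noteq> e i \<and> e k \<noteq> b" if "j \<le> k" "k < i + int c" for k
      using that ij mod_neq[of i k] cycD(2)[OF C] nb by auto
  qed (use i b nb nf cycD[OF C] in auto)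
  show "int (length us) \<le> i - j" if ij: "j \<le> i" "i < j + int c"
  proof -
    have "int (length (rev us)) + 1 \<le> (i + 1) - j"
    proof (rule qbridge[OF C qpath_rev[OF Q], of j "i + 1" b "e i"])
      show "e k \<noteq> b \<and> e k \<noteq> e i" if "i + 1 \<le> k" "k < j + int c" for k
        using that ij mod_neq[of i k] cycD(2)[OF C] nb by auto
    qed (use i b nb nf cycD[OF C] ij q in \<open>auto simp: hd_rev last_rev\<close>)
    then show ?thesis by simp
  qed
qed

text \<open>The attachments are \<open>v i\<close> and \<open>v (j + 1)\<close>, so that both edges
  lie on the replaced arc.\<close>

lemma bridge_EE:
  assumes C: "cyc v e" and Q: "qpath v e us fs" and i: "hd us \<in> e i" "last us \<in> e j" and ij: "i < j" "j < i + int c"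
  shows "int (length us) \<le> j - i"
proof -
  note q = qpathD[OF Q]
  have nf: "e k \<notin> set fs" for k using q(7) by blast
  have "int (length us) + 1 \<le> (j + 1) - i"
  proof (rule qbridge[OF C Q, of i "j + 1" "e i" "e j"])
    show "e i \<noteq> e j" using mod_neq[OF ij] cycD(2)[OF C] by simp
    show "e k \<noteq> e i \<and> e k \<noteq> e j" if "j + 1 \<le> k" "k < i + int c" for k
      using that ij mod_neq[of i k] mod_neq[of j k] cycD(2)[OF C] by auto
  qed (use i nf cycD[OF C] ij in auto)
  then show ?thesis by simp
qed

lemma bridge_EE_I:
  assumes C: "cyc v e" and Q: "qpath v e us fs" and x: "x \<in> onc e (hd us)" "y \<in> onc e (last us)" "x \<noteq> y"
  shows "int (length us) \<le> \<bar>x - y\<bar>" "\<bar>x - y\<bar> \<le> int c - int (length us)"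
proof -
  note q = qpathD[OF Q]
  have xI: "x \<in> I" "y \<in> I" "hd us \<in> e x" "last us \<in> e y" using x unfolding onc_def by auto
  have xc: "hd us \<in> e (x + int c)" "last us \<in> e (y + int c)" using xI cyc_period(2)[OF C] by auto
  have rv: "hd (rev us) = last us" "last (rev us) = hd us" "length (rev us) = length us" using q by (auto simp: hd_rev last_rev)
  have "int (length us) \<le> y - x \<and> y - x \<le> int c - int (length us)" if "x < y"
    using bridge_EE[OF C Q xI(3,4)] bridge_EE[OF C qpath_rev[OF Q], unfolded rv, OF xI(4) xc(1)] that xI(1,2) by auto
  moreover have "int (length us) \<le> x - y \<and> x - y \<le> int c - int (length us)" if "y < x"
    using bridge_EE[OF C qpath_rev[OF Q], unfolded rv, OF xI(4,3)] bridge_EE[OF C Q xI(3) xc(2)] that xI(1,2) by auto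
  ultimately show "int (length us) \<le> \<bar>x - y\<bar>" "\<bar>x - y\<bar> \<le> int c - int (length us)" using x(3) by linarith+
qed

text \<open>These path edges use no cycle position, so they are counted together with
  \<open>far\<close> in the binomial; the remaining ones, \<open>badf\<close>, are a separate
  loss.\<close>

definition goodf :: "'a list \<Rightarrow> 'a set list \<Rightarrow> 'a set set" where
  "goodf us fs = {f \<in> set fs. last us \<in> f \<and> f \<subseteq> set us}"

definition badf :: "'a list \<Rightarrow> 'a set list \<Rightarrow> 'a set set" where
  "badf us fs = {f \<in> set fs. last us \<in> f \<and> \<not> f \<subseteq> set us}"

text \<open>For \<open>r = 3\<close>, a path edge through the last vertex consists of it and two
  consecutive path vertices, hence stays on the path, unless it is the last path edge.\<close>

lemma badf_le:
  assumes Q: "qpath v e us fs"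
  shows "card (badf us fs) \<le> length us - 1" "r = 3 \<Longrightarrow> card (badf us fs) \<le> 1"
proof -
  note q = qpathD[OF Q]
  have "card (badf us fs) \<le> card (set fs)" unfolding badf_def by (intro card_mono) auto
  also have "\<dots> = length us - 1" using distinct_card[OF q(5)] q(8) by simp
  finally show "card (badf us fs) \<le> length us - 1" .
  assume r: "r = 3"
  have "badf us fs \<subseteq> {fs ! (length us - 2)}"
  proof
    fix f assume f: "f \<in> badf us fs"
    then obtain j where j: "j < length fs" "f = fs ! j" unfolding badf_def by (auto simp: in_set_conv_nth)
    have "j = length us - 2"
    proof (rule ccontr)
      assume ne: "j \<noteq> length us - 2"
      then have jl: "Suc j < length us - 1" using j(1) q(8) by linarith
      have l: "last us = us ! (length us - 1)" using q by (intro last_conv_nth) auto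
      have "{us ! j, us ! Suc j, last us} \<subseteq> f" using bp_nth[OF q(1) j(1)] f j(2) unfolding badf_def by auto
      moreover have "card {us ! j, us ! Suc j, last us} = 3"
        unfolding l using q(2) jl by (simp add: nth_eq_iff_index_eq)
      moreover have "card f = 3" "finite f" using unif[of f] finite_edge[of f] q(6) f r unfolding badf_def by auto
      ultimately have "f = {us ! j, us ! Suc j, last us}" by (metis card_subset_eq)
      then have "f \<subseteq> set us" using jl q(10) by auto
      then show False using f unfolding badf_def by simp
    qed
    then show "f \<in> {fs ! (length us - 2)}" using j by simp
  qed
  then have "card (badf us fs) \<le> card {fs ! (length us - 2)}" by (intro card_mono) auto
  then show "card (badf us fs) \<le> 1" by simp
qed

lemma count_ball:
  assumes C: "cyc v e" and finA: "finite A" and A: "\<forall>a \<in> A. card a = r \<and> u \<in> a \<and> a \<subseteq> {u} \<union> D \<union> range v"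
    and D: "finite D" "u \<notin> range v"
    and nb: "\<forall>a \<in> A. \<forall>b \<in> A. a \<noteq> b \<longrightarrow> (\<forall>k. v k \<in> a \<longrightarrow> v (k + 1) \<notin> b)"
    and Av: "\<forall>a \<in> A. touch (idx v a) \<subseteq> Av \<and> touch (idx v a) \<inter> B = {}" "B \<subseteq> Av" "finite Av"
  shows "card A \<le> (card D + card (dbl v A) choose (r - 1)) + card (priv v A)"
    and "2 * card (dbl v A) + card (priv v A) * (1 + max 1 (r - 1 - (card D + card (dbl v A)))) + card B \<le> card Av"
    and "dbl v A \<noteq> {} \<Longrightarrow> 2 \<le> card A"
    and "priv v A = {} \<Longrightarrow> \<forall>a \<in> A. a \<subseteq> {u} \<union> D \<union> v ` dbl v A"
    and "card (touch (dbl v A)) = 2 * card (dbl v A)"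
    and "touch (dbl v A) \<subseteq> Av"
proof -
  have m: "\<And>a. a \<in> A \<Longrightarrow> card a = r" "\<And>a. a \<in> A \<Longrightarrow> u \<in> a" "\<And>a. a \<in> A \<Longrightarrow> a \<subseteq> {u} \<union> D \<union> range v" using A by blast+
  have n: "\<And>a b k. a \<in> A \<Longrightarrow> b \<in> A \<Longrightarrow> a \<noteq> b \<Longrightarrow> v k \<in> a \<Longrightarrow> v (k + 1) \<notin> b" using nb by blast
  have w: "\<And>a. a \<in> A \<Longrightarrow> touch (idx v a) \<subseteq> Av" "\<And>a. a \<in> A \<Longrightarrow> touch (idx v a) \<inter> B = {}" using Av(1) by blast+
  show "card A \<le> (card D + card (dbl v A) choose (r - 1)) + card (priv v A)" by (rule count(1)[OF C finA, where u = u and D = D and Av = Av and B = B]) (fact m n w D Av(2,3))+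
  show "2 * card (dbl v A) + card (priv v A) * (1 + max 1 (r - 1 - (card D + card (dbl v A)))) + card B \<le> card Av" by (rule count(2)[OF C finA, where u = u and D = D and Av = Av and B = B]) (fact m n w D Av(2,3))+
  show "2 \<le> card A" if "dbl v A \<noteq> {}" by (rule count(3)[OF C finA, where u = u and D = D and Av = Av and B = B]) (fact m n w D Av(2,3) that)+
  show "\<forall>a \<in> A. a \<subseteq> {u} \<union> D \<union> v ` dbl v A" if "priv v A = {}"
  proof
    fix a assume a: "a \<in> A"
    show "a \<subseteq> {u} \<union> D \<union> v ` dbl v A" by (rule count(4)[OF C finA, where u = u and D = D and Av = Av and B = B]) (fact m n w D Av(2,3) that a)+
  qed
  show "card (touch (dbl v A)) = 2 * card (dbl v A)" by (rule count(5)[OF C finA, where u = u and D = D and Av = Av and B = B]) (fact m n w D Av(2,3))+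
  show "touch (dbl v A) \<subseteq> Av" by (rule count(6)[OF C finA, where u = u and D = D and Av = Av and B = B]) (fact m n w D Av(2,3))+
qed

text \<open>\<open>count\<close> at the last vertex with the other \<open>l - 1\<close> path
  vertices as \<open>D\<close>. \<open>Av\<close> contains the cycle edges that the bridging
  distances leave available, and \<open>X\<close> sets aside edges that are treated
  separately.\<close>

lemma family_count:
  assumes Q: "qlong v e us fs" and Av: "finite Av" "B \<subseteq> Av" "B \<subseteq> onc e (last us)"
    and t: "\<And>a. a \<in> far e us fs - X \<Longrightarrow> touch (idx v a) \<subseteq> Av"
  defines "A \<equiv> (far e us fs - X) \<union> goodf us fs" and "l \<equiv> length us"
  shows "card A \<le> (l - 1 + card (dbl v A) choose (r - 1)) + card (priv v A)"
    "2 * card (dbl v A) + card (priv v A) * (1 + max 1 (r - 1 - (l - 1 + card (dbl v A)))) + card B \<le> card Av"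
    "dbl v A \<noteq> {} \<Longrightarrow> 2 \<le> card A"
    "priv v A = {} \<Longrightarrow> a \<in> A \<Longrightarrow> a \<subseteq> set us \<union> v ` dbl v A"
    "card (touch (dbl v A)) = 2 * card (dbl v A)" "touch (dbl v A) \<subseteq> Av"
    "card (unu e (last us)) \<le> card A + card (badf us fs) + card (X \<inter> unu e (last us))"
proof -
  note d = qlongD[OF Q] and q = qpathD[OF qlongD(2)[OF Q]]
  let ?u = "last us" and ?D = "set us - {last us}"
  have u: "?u \<in> V" "?u \<notin> range v" using q(3,4,10) by auto
  have Au: "A \<subseteq> unu e ?u"
    unfolding A_def far_def goodf_def unu_def using q(6,7) by auto
  have cD: "card ?D = l - 1" unfolding l_def using distinct_card[OF q(2)] q(10) by simp
  have idxg: "idx v f = {}" if "f \<in> goodf us fs" for f using that q(4) unfolding goodf_def idx_def by auto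
  have tA: "touch (idx v a) \<subseteq> Av" if "a \<in> A" for a
    using that t[of a] idxg[of a] unfolding A_def touch_def by auto
  have tB: "touch (idx v a) \<inter> B = {}" if "a \<in> A" for a
    using touch_onc[OF d(1) u, of a] that Au Av(3) by blast
  have sub: "a \<subseteq> {?u} \<union> ?D \<union> range v" if "a \<in> A" for a
    using that far_sub(1)[OF Q, of a] unfolding A_def goodf_def by auto
  have cA: "card a = r" "?u \<in> a" if "a \<in> A" for a using that Au unuD unif by blast+
  have finA: "finite A" using Au finite_unu finite_subset by blast
  have rule: "v (k + 1) \<notin> b" if "a \<in> A" "b \<in> A" "a \<noteq> b" "v k \<in> a" for a b k
    using unu_rule[OF d(1) u _ _ that(3,4)] that(1,2) Au by blast
  have cnt: "\<forall>a \<in> A. card a = r \<and> ?u \<in> a \<and> a \<subseteq> {?u} \<union> ?D \<union> range v" using cA sub by blast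
  have cnt2: "\<forall>a \<in> A. \<forall>b \<in> A. a \<noteq> b \<longrightarrow> (\<forall>k. v k \<in> a \<longrightarrow> v (k + 1) \<notin> b)" using rule by blast
  have cnt3: "\<forall>a \<in> A. touch (idx v a) \<subseteq> Av \<and> touch (idx v a) \<inter> B = {}" using tA tB by blast
  have fD: "finite ?D" by simp
  note cnt = count_ball[OF d(1) finA cnt fD u(2) cnt2 cnt3 Av(2,1)]
  show "card A \<le> (l - 1 + card (dbl v A) choose (r - 1)) + card (priv v A)"
    "2 * card (dbl v A) + card (priv v A) * (1 + max 1 (r - 1 - (l - 1 + card (dbl v A)))) + card B \<le> card Av"
    "dbl v A \<noteq> {} \<Longrightarrow> 2 \<le> card A"
    "card (touch (dbl v A)) = 2 * card (dbl v A)" "touch (dbl v A) \<subseteq> Av"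
    using cnt(1,2,3,5,6) unfolding cD by simp_all
  show "a \<subseteq> set us \<union> v ` dbl v A" if "priv v A = {}" "a \<in> A" for a
  proof -
    have "a \<subseteq> {?u} \<union> ?D \<union> v ` dbl v A" using cnt(4)[OF that(1)] that(2) by blast
    then show ?thesis using q(10) by auto
  qed
  have "unu e ?u \<subseteq> A \<union> badf us fs \<union> (X \<inter> unu e ?u)"
  proof
    fix a assume a: "a \<in> unu e ?u"
    show "a \<in> A \<union> badf us fs \<union> (X \<inter> unu e ?u)"
    proof (cases "a \<in> set fs")
      case True
      then show ?thesis using unuD(2)[OF a] unfolding A_def goodf_def badf_def by auto
    next
      case False
      then show ?thesis using a unfolding A_def far_def by auto
    qed
  qed
  then have "card (unu e ?u) \<le> card (A \<union> badf us fs \<union> (X \<inter> unu e ?u))"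
    using finA finite_unu by (intro card_mono) (auto simp: badf_def)
  also have "\<dots> \<le> card (A \<union> badf us fs) + card (X \<inter> unu e ?u)" by (rule card_Un_le)
  also have "card (A \<union> badf us fs) \<le> card A + card (badf us fs)" by (rule card_Un_le)
  finally show "card (unu e ?u) \<le> card A + card (badf us fs) + card (X \<inter> unu e ?u)" by simp
qed

end

section \<open>Arithmetic for the end of an outside path\<close>

lemma choose_two_ge_self: "5 \<le> t \<Longrightarrow> t \<le> (t - 1 choose 2)"
proof -
  assume "5 \<le> t"
  then obtain q where q: "t = q + 5" using le_Suc_ex[of 5 t] by (auto simp: add.commute)
  have "2 * (t - 1 choose 2) = (q + 4) * (q + 3)" unfolding choose_two_double q by (simp add: algebra_simps)
  then show ?thesis using q by (auto simp: algebra_simps)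
qed

lemma choose_two_gt: "5 \<le> t \<Longrightarrow> 2 * t \<le> (t choose 2)"
proof -
  assume "5 \<le> t"
  then obtain q where q: "t = q + 5" using le_Suc_ex[of 5 t] by (auto simp: add.commute)
  have "2 * (t choose 2) = (q + 5) * (q + 4)" unfolding choose_two_double q by (simp add: algebra_simps)
  then show ?thesis using q by (auto simp: algebra_simps)
qed

text \<open>\<open>l\<close> path vertices, \<open>L\<close> available cycle edges, \<open>x\<close>
  doubly met positions, \<open>p\<close> private edges, \<open>f\<close> path edges that leave the
  path; of the \<open>q\<close> cycle edges through the end at most one, at position 0, is outside
  the available range. If \<open>L > 0\<close> then \<open>L + 3 * l \<le> 2 * t + 3\<close>: a path
  vertex adds one point to the binomial but costs three cycle edges, where a doubly met position
  costs two. Hence mostly cases with \<open>r = t\<close> survive.\<close>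

lemma numeric_end:
  fixes x p q q' A f l c t r L :: nat
  assumes r: "3 \<le> r" "r \<le> t" and l: "2 \<le> l" "l \<le> t" and c: "c + l \<le> 2 * t + 2"
    and L: "L + 2 * l \<le> c + 1 \<or> L = 0"
    and A: "A \<le> (l - 1 + x choose (r - 1)) + p"
    and cap: "2 * x + p * (1 + max 1 (r - 1 - (l - 1 + x))) + q' \<le> L"
    and q: "q \<le> q' + 1" and f: "f \<le> l - 1" "r = 3 \<Longrightarrow> f \<le> 1"
    and d: "(t choose (r - 1)) + 1 \<le> A + q + f" and x2: "0 < x \<Longrightarrow> 2 \<le> A"
  shows "(r = t \<and> l = t \<and> 4 \<le> t \<and> L = 0 \<and> 1 \<le> A \<and> f = l - 1) \<or> (r = t \<and> l = 2 \<and> A = 1) \<or>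
     (A = 0 \<and> (r = t \<or> (t = 4 \<and> r = 3 \<and> l = 2)))"
proof (cases "L = 0")
  case True
  then have z: "x = 0" "p = 0" "q' = 0" using cap by auto
  show ?thesis
  proof (cases "A = 0")
    case True
    then have "(t choose (r - 1)) + 1 \<le> l" using d q z f(1) l by linarith
    moreover have "t \<le> t choose (r - 1)" using r by (intro choose_ge_self) auto
    ultimately have False using l by linarith
      then show ?thesis by simp
  next
    case False
    have b: "A \<le> l - 1 choose (r - 1)" using A z by simp
    have mono: "l - 1 choose (r - 1) \<le> t - 1 choose (r - 1)" using l by (intro binomial_right_mono) auto
    have pas: "t choose (r - 1) = (t - 1 choose (r - 2)) + (t - 1 choose (r - 1))"
      using choose_pascal[of t "r - 1"] r by (simp add: numeral_2_eq_2)
    have sl: "t - 1 \<le> t - 1 choose (r - 2)" using r by (intro choose_ge_self) auto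
    consider "r = 3" | "4 \<le> r" "r < t" | "4 \<le> r" "r = t" using r by linarith
    then show ?thesis
    proof cases
      case 1
      then have "f \<le> 1" using f by simp
      then have False using b mono pas sl d q z r 1 by linarith
      then show ?thesis by simp
    next
      case 2
      have "t - 1 choose 2 \<le> t - 1 choose (r - 2)" using 2 by (intro choose_ge_choose_two) auto
      moreover have "t \<le> t - 1 choose 2" using 2 by (intro choose_two_ge_self) auto
      ultimately have False using b mono pas d q z f(1) l by linarith
      then show ?thesis by simp
    next
      case 3
      have "l = t"
      proof (rule ccontr)
        assume "l \<noteq> t"
        then have "l - 1 < r - 1" using l 3 by linarith
        then have "l - 1 choose (r - 1) = 0" by (rule binomial_eq_0)
        then show False using b False by linarith
      qed
      moreover have "A \<le> 1" using b 3 \<open>l = t\<close> by simp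
      moreover have "t \<le> t choose (r - 1)" using r by (intro choose_ge_self) auto
      ultimately have "f = l - 1" "1 \<le> A" using d q z f(1) False 3 by linarith+
      then show ?thesis using \<open>l = t\<close> True 3 by simp
    qed
  qed
next
  case False
  then have L': "L + 3 * l \<le> 2 * t + 3" using L c by linarith
  have pm: "2 * p \<le> p * (1 + max 1 (r - 1 - (l - 1 + x)))" by simp
  define z where "z = l - 1 + x"
  have zx: "z + 1 = l + x" using l unfolding z_def by simp
  show ?thesis
  proof (cases "r - 1 \<le> z")
    case True
    have zt: "z < t" using cap L' pm zx l by linarith
    have b: "A + q + f + 2 * z + l \<le> (z choose (r - 1)) + 2 * t + 2 + f"
      using A[folded z_def] q cap pm L' zx by linarith
    have g: "(z choose (r - 1)) + (r - 1) * (t - z) \<le> t choose (r - 1)"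
      using choose_growth[of "r - 1" z t] r True zt by simp
    consider "4 \<le> r" | "r = 3" "3 \<le> z" | "r = 3" "z = 2" using r True by linarith
    then show ?thesis
    proof cases
      case 1
      then have "3 \<le> r - 1" by linarith
      then have "3 * (t - z) \<le> (r - 1) * (t - z)" by (rule mult_le_mono1)
      then have False using g b d f(1) l zt by linarith
      then show ?thesis by simp
    next
      case 2
      have "3 * (t - z) \<le> z * (t - z)" using 2(2) by (rule mult_le_mono1)
      moreover have e: "r - 1 = 2" using 2 by simp
      moreover have "(z choose 2) + z * (t - z) \<le> t choose 2" using zt by (intro choose_two_growth) simp
      moreover have "f \<le> 1" using f 2 by simp
      ultimately have False using b[unfolded e] d[unfolded e] zt l by linarith
      then show ?thesis by simp
    next
      case 3
      have e: "r - 1 = 2" and f1: "f \<le> 1" using 3 f by auto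
      have z2: "z choose 2 = 1" using 3 by simp
      show ?thesis
      proof (cases "t = 3")
        case True
        have A': "A \<le> 1 + p" using A[folded z_def] e z2 by simp
        consider "l = 2" "x = 1" | "l = 3" "x = 0" using 3 zx l by linarith
        then show ?thesis
        proof cases
          case 1
          then have "1 \<le> p" using x2 A' by simp
          then have False using cap pm L' 1 True by linarith
      then show ?thesis by simp
        next
          case 2
          then have False using False L' True by linarith
      then show ?thesis by simp
        qed
      next
        case False
        then have "2 * t \<le> (t choose 2) + 2" using choose_ge_two_cases(2)[of 3 t] r 3 by simp
        then have False using b[unfolded e z2] d[unfolded e] 3 f1 l by linarith
      then show ?thesis by simp
      qed
    qed
  next
    case False
    define k where "k = r - 1 - z"
    have k1: "1 \<le> k" and rk: "r = z + k + 1" using False r unfolding k_def by linarith+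
    have A': "A \<le> p" using A[folded z_def] False by (simp add: binomial_eq_0)
    have cp: "2 * x + (p + p * k) + q' \<le> L" using cap k1 unfolding z_def[symmetric] k_def[symmetric] by (simp add: max_def)
    have tau: "t \<le> t choose (r - 1)" using r by (intro choose_ge_self) auto
    have tau2: "2 * t \<le> (t choose (r - 1)) + 2" if "r < t" using choose_ge_two_cases[OF r(1) that] by linarith
    consider "p = 0" | "p = 1" | "2 \<le> p" by linarith
    then show ?thesis
    proof cases
      case 1
      then have A0: "A = 0" using A' by simp
      show ?thesis
      proof (cases "r = t")
        case True
        then show ?thesis using A0 by simp
      next
        case False
        then have rt: "r < t" using r by simp
        have b: "(t choose (r - 1)) + 1 + 2 * l \<le> 2 * t + 3" using d A0 q cp L' f(1) l by linarith
        then have l2: "l = 2" using tau2[OF rt] l by linarith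
        have "t < 5"
        proof (rule ccontr)
          assume "\<not> t < 5"
          then have "2 * t \<le> t choose 2" by (intro choose_two_gt) simp
          moreover have "t choose 2 \<le> t choose (r - 1)" using choose_ge_two_cases(1)[OF r(1) rt] .
          ultimately show False using b l by linarith
        qed
        then have "t = 4" "r = 3" using rt r by linarith+
        then show ?thesis using A0 l2 by simp
      qed
    next
      case 2
      then have cp1: "2 * x + 1 + k + q' \<le> L" using cp by simp
      have b: "A + q + f + l + x + r \<le> 2 * t + 3" using A' 2 q cp1 L' f(1) l rk zx by linarith
      have "r = t"
      proof (rule ccontr)
        assume "r \<noteq> t"
        then have "r < t" using r by simp
        then show False using tau2 b d r l by linarith
      qed
      then have "l = 2" using b d tau l by linarith
      moreover have "A = 0 \<or> A = 1" using A' 2 by linarith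
      ultimately show ?thesis using \<open>r = t\<close> by blast
    next
      case 3
      have "2 * k \<le> p * k" using 3 by (rule mult_le_mono1)
      then have b: "A + q + f + 2 * r \<le> 2 * t + 3" using A' q cp L' f(1) l rk zx by linarith
      have "r = t"
      proof (rule ccontr)
        assume "r \<noteq> t"
        then have "r < t" using r by simp
        then show False using tau2 b d r l by linarith
      qed
      then have False using b d tau r by linarith
      then show ?thesis by simp
    qed
  qed
qed

text \<open>Let \<open>a\<close> and \<open>b\<close> be the extreme elements of
  \<open>Y - {0}\<close>. \<open>X\<close> misses the gaps of length \<open>l\<close> before
  \<open>a\<close> and after \<open>b\<close>, and between \<open>a\<close> and \<open>b\<close> it
  is disjoint from \<open>Y - {0}\<close> shifted by one, as \<open>l \<ge> 2\<close>. This bounds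
  \<open>X\<close> and \<open>Y - {0}\<close> together by \<open>c + 3 - 2 * l\<close>; the element
  0 of \<open>Y\<close> may add one.\<close>

lemma two_sets_spread:
  fixes X Y :: "int set" and c l :: int
  assumes X: "X \<subseteq> {0..<c}" "0 \<in> X" and Y: "Y \<subseteq> {0..<c}" "y0 \<in> Y" "y0 \<noteq> 0" and l: "2 \<le> l"
    and sep: "\<And>x y. x \<in> X \<Longrightarrow> y \<in> Y \<Longrightarrow> x \<noteq> y \<Longrightarrow> l \<le> \<bar>x - y\<bar> \<and> \<bar>x - y\<bar> \<le> c - l"
  shows "int (card X) + int (card Y) + 2 * l \<le> c + 4"
proof -
  define Y' where "Y' = Y - {0}"
  have fin: "finite X" "finite Y'" using X Y finite_subset unfolding Y'_def by (meson finite_Diff finite_atLeastLessThan_int finite_subset)+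
  have ne: "Y' \<noteq> {}" using Y unfolding Y'_def by auto
  define a b where "a = Min Y'" and "b = Max Y'"
  have ab: "a \<in> Y'" "b \<in> Y'" "\<And>y. y \<in> Y' \<Longrightarrow> a \<le> y \<and> y \<le> b" unfolding a_def b_def using fin ne by auto
  have al: "l \<le> a" "b \<le> c - l" "a \<le> b"
    using sep[OF X(2), of a] sep[OF X(2), of b] ab Y(1) unfolding Y'_def by auto
  have sub: "X \<subseteq> {0} \<union> {1..a - l} \<union> (X \<inter> {a..b}) \<union> {b + l..c - 1}"
  proof
    fix x assume x: "x \<in> X"
    have "x = a \<or> l \<le> \<bar>x - a\<bar>" "x = b \<or> l \<le> \<bar>x - b\<bar>" using sep[OF x, of a] sep[OF x, of b] ab unfolding Y'_def by auto
    then show "x \<in> {0} \<union> {1..a - l} \<union> (X \<inter> {a..b}) \<union> {b + l..c - 1}" using x X(1) al l by auto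
  qed
  have "card X \<le> card ({0} \<union> {1..a - l} \<union> (X \<inter> {a..b}) \<union> {b + l..c - 1})" using sub fin by (intro card_mono) auto
  also have "\<dots> \<le> card ({0} \<union> {1..a - l} \<union> (X \<inter> {a..b})) + card {b + l..c - 1}" by (rule card_Un_le)
  also have "card ({0} \<union> {1..a - l} \<union> (X \<inter> {a..b})) \<le> card ({0} \<union> {1..a - l}) + card (X \<inter> {a..b})" by (rule card_Un_le)
  also have "card ({0::int} \<union> {1..a - l}) \<le> card {0::int} + card {1..a - l}" by (rule card_Un_le)
  finally have cX: "int (card X) \<le> 1 + (a - l) + int (card (X \<inter> {a..b})) + (c - b - l)" using al by simp
  have "(X \<inter> {a..b}) \<inter> (+) 1 ` Y' = {}"
  proof -
    have False if "x \<in> X" "y \<in> Y'" "x = 1 + y" for x y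
      using sep[of x y] that l unfolding Y'_def by auto
    then show ?thesis by blast
  qed
  then have "card (X \<inter> {a..b}) + card ((+) 1 ` Y') = card ((X \<inter> {a..b}) \<union> (+) 1 ` Y')"
    using fin by (intro card_Un_disjoint[symmetric]) auto
  also have "\<dots> \<le> card {a..b + 1}" using ab by (intro card_mono) force+
  also have "card ((+) 1 ` Y') = card Y'" by (rule card_image) simp
  finally have "int (card (X \<inter> {a..b})) + int (card Y') \<le> b - a + 2" using al by simp
  moreover have "card Y \<le> card Y' + 1"
  proof -
    have "card Y \<le> card (insert 0 Y')" using fin unfolding Y'_def by (intro card_mono) auto
    also have "\<dots> \<le> card Y' + 1" using fin by (simp add: card_insert_if)
    finally show ?thesis .
  qed
  ultimately show ?thesis using cX by linarith
qed

lemma card_minus_one: "finite S \<Longrightarrow> card S \<le> card (S - {x}) + 1"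
  using card_Suc_Diff1[of S x] by (cases "x \<in> S") auto

context ham
begin

section \<open>Ends of the outside path that lie on a cycle edge\<close>

lemma far_shift: "far (\<lambda>i. e (i + s)) us fs = far e us fs"
  unfolding far_def unu_def range_shift ..

lemma unu_shift: "unu (\<lambda>i. e (i + s)) u = unu e u"
  unfolding unu_def range_shift ..

lemma card_onc_shift: "cyc v e \<Longrightarrow> card (onc (\<lambda>i. e (i + s)) u) = card (onc e u)"
  using deg_cyc[of v e u] deg_cyc[OF cyc_shift[of v e s], of u] unu_shift[of e s u] by simp

text \<open>By \<open>bridge_EV\<close> the attachments have positions from \<open>l + 1\<close> to
  \<open>c - l\<close>; the edge before the first of these is at \<open>l\<close>.\<close>

lemma far_touch:
  assumes Q: "qlong v e us fs" and h: "hd us \<in> e 0" and a: "a \<in> far e us fs"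
  shows "touch (idx v a) \<subseteq> {int (length us)..int c - int (length us)}"
proof
  let ?l = "int (length us)"
  note d = qlongD[OF Q] and f = far_sub[OF Q a]
  have l2: "2 \<le> ?l" using d(3) by simp
  have main: "?l + 1 \<le> k \<and> k \<le> int c - ?l" if k: "k \<in> idx v a" for k
  proof -
    have kI: "0 \<le> k" "k < int c" "v k \<in> a" using k unfolding idx_def by auto
    have "k \<noteq> 0"
    proof
      assume "k = 0"
      then show False using bridge_EV(2)[OF d(1,2) h f(2-5) kI(3)] kI l2 by simp
    qed
    then have 1: "?l + 1 \<le> k" using bridge_EV(1)[OF d(1,2) h f(2-5) kI(3)] kI by simp
    have "v (k - int c) \<in> a" using kI(3) cyc_period(1)[OF d(1), of "k - int c"] by simp
    then have "?l \<le> 0 - (k - int c)" using kI \<open>k \<noteq> 0\<close> by (intro bridge_EV(2)[OF d(1,2) h f(2-5)]) auto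
    then show ?thesis using 1 by simp
  qed
  fix m assume "m \<in> touch (idx v a)"
  then consider "m \<in> idx v a" | k where "k \<in> idx v a" "m = prv k" unfolding touch_def by auto
  then show "m \<in> {?l..int c - ?l}"
  proof cases
    case 1
    then show ?thesis using main[of m] by auto
  next
    case 2
    have "prv k = k - 1" unfolding prv_def using main[OF 2(1)] l2 by (intro mod_pos_pos_trivial) auto
    then show ?thesis using main[OF 2(1)] 2 by auto
  qed
qed

lemma onc_spread:
  assumes Q: "qlong v e us fs" and h: "hd us \<in> e 0"
  shows "onc e (last us) - {0} \<subseteq> {int (length us)..int c - int (length us)}"
proof
  fix y assume y: "y \<in> onc e (last us) - {0}"
  have 0: "0 \<in> onc e (hd us)" unfolding onc_def using h c5 by simp
  have y0: "0 \<le> y" using y onc_I by fastforce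
  show "y \<in> {int (length us)..int c - int (length us)}"
    using bridge_EE_I[OF qlongD(1,2)[OF Q] 0, of y] y y0 by auto
qed

lemma card_range_ends: "card {int l..int c - int l} + 2 * l \<le> c + 1 \<or> card {int l..int c - int l} = 0"
  by (cases "2 * l \<le> c + 1") auto

lemma end_cases_aux:
  assumes Q: "qlong v e us fs" and h: "hd us \<in> e 0"
  shows "(r = t \<and> length us = 2 \<and> card (far e us fs) = 1) \<or>
     (far e us fs = {} \<and> (r = t \<or> (t = 4 \<and> r = 3 \<and> length us = 2)))"
proof -
  note d = qlongD[OF Q] and q = qpathD[OF qlongD(2)[OF Q]] and ln = qlong_len[OF Q]
  let ?l = "length us" and ?u = "last us" and ?R = "{int (length us)..int c - int (length us)}"
  let ?A = "(far e us fs - {}) \<union> goodf us fs"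
  have Au: "?A \<subseteq> unu e ?u" unfolding far_def goodf_def unu_def using q(6,7) by auto
  have finA: "finite ?A" using Au finite_unu finite_subset by blast
  have u: "?u \<in> V" using q by auto
  have B: "onc e ?u - {0} \<subseteq> onc e ?u" by auto
  have tt: "touch (idx v a) \<subseteq> ?R" if "a \<in> far e us fs - {}" for a using far_touch[OF Q h] that by simp
  note fc = family_count[OF Q _ onc_spread[OF Q h] B, of "{}", OF _ tt]
  have n: "(r = t \<and> ?l = t \<and> 4 \<le> t \<and> card ?R = 0 \<and> 1 \<le> card ?A \<and> card (badf us fs) = ?l - 1) \<or> (r = t \<and> ?l = 2 \<and> card ?A = 1) \<or>
     (card ?A = 0 \<and> (r = t \<or> (t = 4 \<and> r = 3 \<and> ?l = 2)))"
  proof (rule numeric_end[OF r3 rt d(3) ln(2,3) card_range_ends, where q = "card (onc e ?u)"])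
    show "card ?A \<le> (?l - 1 + card (dbl v ?A) choose (r - 1)) + card (priv v ?A)" using fc(1) by simp
    show "2 * card (dbl v ?A) + card (priv v ?A) * (1 + max 1 (r - 1 - (?l - 1 + card (dbl v ?A)))) + card (onc e ?u - {0}) \<le> card ?R"
      using fc(2) by simp
    show "card (onc e ?u) \<le> card (onc e ?u - {0}) + 1" by (rule card_minus_one[OF onc_I(2)])
    show "card (badf us fs) \<le> ?l - 1" "r = 3 \<Longrightarrow> card (badf us fs) \<le> 1" using badf_le[OF d(2)] by auto
    show "(t choose (r - 1)) + 1 \<le> card ?A + card (onc e ?u) + card (badf us fs)"
      using deg_ge[OF d(1) u] fc(7) by simp
    show "2 \<le> card ?A" if "0 < card (dbl v ?A)" using fc(3) that by fastforce
  qed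
  \<comment> \<open>No cycle edge is available, so a far edge is the whole vertex set of the path.
    It can replace the last path edge, which becomes a far edge of the new path and should also stay
    on the path, although it belongs to \<open>badf\<close>.\<close>
  have n1: "\<not> (r = t \<and> ?l = t \<and> 4 \<le> t \<and> card ?R = 0 \<and> 1 \<le> card ?A \<and> card (badf us fs) = ?l - 1)"
  proof
    assume a: "r = t \<and> ?l = t \<and> 4 \<le> t \<and> card ?R = 0 \<and> 1 \<le> card ?A \<and> card (badf us fs) = ?l - 1"
    then have R0: "?R = {}" by (metis card_0_eq finite_atLeastAtMost_int)
    have touch0: "M = {}" if "touch M \<subseteq> {}" for M using that unfolding touch_def by auto
    have inus: "x \<subseteq> set us" if Q': "qlong v e us fs'" and x: "x \<in> far e us fs'" for x fs'
    proof -
      have "idx v x = {}" using touch0 far_touch[OF Q' h x] R0 by metis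
      then have "x \<inter> range v = {}" using idx_image[OF d(1), of x] by simp
      then show ?thesis using far_sub(1)[OF Q' x] by blast
    qed
    have "card (badf us fs) = card (set fs)" using a distinct_card[OF q(5)] q(8) by simp
    moreover have "badf us fs \<subseteq> set fs" unfolding badf_def by auto
    ultimately have bad: "badf us fs = set fs" by (intro card_subset_eq) auto
    then have "goodf us fs = {}" unfolding goodf_def badf_def by blast
    then obtain x where x: "x \<in> far e us fs" using a by fastforce
    note fx = far_sub[OF Q x]
    have "x = set us" using inus[OF Q x] unif[OF fx(2)] a distinct_card[OF q(2)] by (intro card_subset_eq) auto
    have i: "?l - 2 < length fs" "Suc (?l - 2) = ?l - 1" using q(8) d(3) by auto
    let ?fs = "fs[?l - 2 := x]"
    have "us ! (?l - 2) \<in> x" "us ! Suc (?l - 2) \<in> x" unfolding \<open>x = set us\<close> using d(3) by auto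
    then have b: "bp us ?fs" by (rule bp_update[OF q(1)])
    have "insert x (set fs) \<subseteq> E - range e" using q(6,7) fx(2,3) by blast
    then have "set ?fs \<subseteq> E - range e" using set_update_subset_insert[of fs "?l - 2" x] by blast
    moreover have "distinct ?fs" using update_distinct_edges[OF q(5), of x] fx(4) by blast
    ultimately have "qpath v e us ?fs" unfolding qpath_def using b q(2,3,4) by blast
    then have Q': "qlong v e us ?fs" using Q unfolding qlong_def by simp
    have y: "fs ! (?l - 2) \<in> set fs" using i by simp
    have yb: "fs ! (?l - 2) \<in> badf us fs" unfolding bad by (rule y)
    have "fs ! (?l - 2) \<in> E" "fs ! (?l - 2) \<notin> range e" using y q(6,7) by blast+
    moreover have "?u \<in> fs ! (?l - 2)" using yb unfolding badf_def by simp
    ultimately have "fs ! (?l - 2) \<in> unu e ?u" unfolding unu_def by simp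
    moreover have "fs ! (?l - 2) \<notin> set ?fs"
    proof -
      have "fs ! (?l - 2) \<noteq> x" using fx(4) y by metis
      then show ?thesis unfolding update_set_edges[OF q(5) i(1)] by simp
    qed
    ultimately have "fs ! (?l - 2) \<in> far e us ?fs" unfolding far_def by simp
    then have "fs ! (?l - 2) \<subseteq> set us" by (rule inus[OF Q'])
    then show False using yb unfolding badf_def by simp
  qed
  then have "(r = t \<and> ?l = 2 \<and> card ?A = 1) \<or> (card ?A = 0 \<and> (r = t \<or> (t = 4 \<and> r = 3 \<and> ?l = 2)))"
    using n by meson
  then consider "r = t" "?l = 2" "card ?A = 1" | "card ?A = 0" "r = t \<or> (t = 4 \<and> r = 3 \<and> ?l = 2)" by meson
  then show ?thesis
  proof cases
    case 1
    have "goodf us fs = {}"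
    proof -
      have False if "f \<in> goodf us fs" for f
      proof -
        have "card f \<le> card (set us)" using that unfolding goodf_def by (intro card_mono) auto
        then show False using that unif[of f] q(6) r3 distinct_card[OF q(2)] 1 unfolding goodf_def by auto
      qed
      then show ?thesis by blast
    qed
    then show ?thesis using 1 by simp
  next
    case 2
    then have "?A = {}" using finA by (metis card_0_eq)
    then show ?thesis using 2 by simp
  qed
qed

lemma end_cases:
  assumes Q: "qlong v e us fs" and h: "onc e (hd us) \<noteq> {}"
  shows "(r = t \<and> length us = 2 \<and> card (far e us fs) = 1) \<or>
     (far e us fs = {} \<and> (r = t \<or> (t = 4 \<and> r = 3 \<and> length us = 2)))"
proof -
  obtain s where "hd us \<in> e s" using h unfolding onc_def by auto
  then show ?thesis using end_cases_aux[OF qlong_shift[OF Q, of s]] unfolding far_shift by simp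
qed

lemma unu_last_le:
  assumes Q: "qlong v e us fs"
  shows "card (unu e (last us)) \<le> card (far e us fs) + (length us - 1)"
proof -
  note q = qpathD[OF qlongD(2)[OF Q]]
  have "card (unu e (last us)) \<le> card (far e us fs \<union> set fs)"
    unfolding far_def using finite_unu by (intro card_mono) auto
  also have "\<dots> \<le> card (far e us fs) + card (set fs)" by (rule card_Un_le)
  finally show ?thesis using distinct_card[OF q(5)] q(8) by simp
qed

lemma onc_last_ge:
  assumes Q: "qlong v e us fs"
  shows "(t choose (r - 1)) + 2 \<le> card (far e us fs) + length us + card (onc e (last us))"
proof -
  note d = qlongD[OF Q] and q = qpathD[OF qlongD(2)[OF Q]]
  have "last us \<in> V" using q by auto
  then show ?thesis using deg_ge[OF d(1), of "last us"] unu_last_le[OF Q] d(3) by linarith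
qed

lemma prv_cases: "x \<in> I \<Longrightarrow> prv x = x - 1 \<or> (x = 0 \<and> prv x = int c - 1)"
proof -
  assume x: "x \<in> I"
  show ?thesis
  proof (cases "x = 0")
    case True
    have "(- 1) mod int c = int c - 1" using c5 by (intro zmod_minus1) simp
    then show ?thesis unfolding prv_def using True by simp
  next
    case False
    then show ?thesis unfolding prv_def using x by (simp add: mod_pos_pos_trivial)
  qed
qed

text \<open>Both ends may lie on the same cycle edge, but not on consecutive ones, since the
  distance of different positions is at least 2. The shift by one turns this into
  disjointness.\<close>

lemma onc_two_disjoint:
  assumes Q: "qlong v e us fs"
  shows "onc e (hd us) \<inter> plus (onc e (last us)) = {}"
proof -
  note d = qlongD[OF Q]
  have False if x: "x \<in> onc e (hd us)" "prv x \<in> onc e (last us)" for x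
  proof -
    have xI: "x \<in> I" using x onc_I by blast
    have ne: "x \<noteq> prv x" using prv_cases[OF xI] c5 by auto
    have "int (length us) \<le> \<bar>x - prv x\<bar>" "\<bar>x - prv x\<bar> \<le> int c - int (length us)"
      using bridge_EE_I[OF d(1,2) x ne] by auto
    then show False using prv_cases[OF xI] d(3) by auto
  qed
  then show ?thesis unfolding plus_def by blast
qed

lemma onc_two_sum:
  assumes Q: "qlong v e us fs"
  shows "card (onc e (hd us)) + card (onc e (last us)) \<le> c"
    "j \<in> I \<Longrightarrow> j \<notin> onc e (hd us) \<Longrightarrow> prv j \<notin> onc e (last us) \<Longrightarrow> card (onc e (hd us)) + card (onc e (last us)) + 1 \<le> c"
proof -
  let ?S = "onc e (hd us) \<union> plus (onc e (last us))"
  have S: "card ?S = card (onc e (hd us)) + card (onc e (last us))"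
    using onc_two_disjoint[OF Q] onc_I plus_I card_plus[OF onc_I(1)] by (simp add: card_Un_disjoint)
  have SI: "?S \<subseteq> I" using onc_I plus_I by blast
  show "card (onc e (hd us)) + card (onc e (last us)) \<le> c" using card_mono[OF _ SI] S by simp
  assume j: "j \<in> I" "j \<notin> onc e (hd us)" "prv j \<notin> onc e (last us)"
  then have "?S \<subseteq> I - {j}" using SI unfolding plus_def by blast
  then have "card ?S \<le> card (I - {j})" by (intro card_mono) auto
  then show "card (onc e (hd us)) + card (onc e (last us)) + 1 \<le> c" using S j(1) c5 by simp
qed

lemma rev_simps:
  assumes "qlong v e us fs"
  shows "hd (rev us) = last us" "last (rev us) = hd us" "length (rev us) = length us"
  using qpathD(10)[OF qlongD(2)[OF assms]] by (auto simp: hd_rev last_rev)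

text \<open>The cycle vertices of \<open>a\<close> touch at least one cycle edge more than their
  number, and the last vertex lies on at least \<open>t - 1\<close> cycle edges, one of which may be
  at 0. The available \<open>c - 3 \<le> 2 * t - 3\<close> positions hold both only with equality
  and with the head in \<open>a\<close>.\<close>

lemma pair_facts_aux:
  assumes Q: "qlong v e us fs" and h: "hd us \<in> e 0" and l: "length us = 2" and rt': "r = t"
    and a: "far e us fs = {a}"
  shows "hd us \<in> a" "card (a \<inter> range v) = t - 2" "c = 2 * t" "t - 1 \<le> card (onc e (last us))"
proof -
  note d = qlongD[OF Q] and q = qpathD[OF qlongD(2)[OF Q]] and ln = qlong_len[OF Q]
  have aF: "a \<in> far e us fs" using a by simp
  note f = far_sub[OF Q aF]
  let ?R = "{int (length us)..int c - int (length us)}" and ?Y = "onc e (last us)" and ?J = "idx v a"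
  have cJ: "card ?J = card (a \<inter> range v)"
    using idx_image[OF d(1), of a] cyc_inj(1)[OF d(1)] idx_I by (metis card_image inj_on_subset)
  have us2: "set us = {hd us, last us}" using l by (cases us; cases "tl us") auto
  have a_eq: "a = (a \<inter> {hd us}) \<union> {last us} \<union> (a \<inter> range v)" using f(1,5) us2 by blast
  have "card a \<le> card ((a \<inter> {hd us}) \<union> {last us}) + card (a \<inter> range v)"
    by (subst a_eq) (rule card_Un_le)
  also have "card ((a \<inter> {hd us}) \<union> {last us}) \<le> card (a \<inter> {hd us}) + 1" using card_Un_le[of "a \<inter> {hd us}" "{last us}"] by simp
  finally have ca: "t \<le> card (a \<inter> {hd us}) + 1 + card ?J" using unif[OF f(2)] rt' cJ by simp
  have h1: "card (a \<inter> {hd us}) \<le> 1" by (rule order_trans[OF card_mono[of "{hd us}"]]) auto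
  have J0: "?J \<noteq> {}" using ca h1 c5 by auto
  have J1: "?J \<noteq> I"
  proof
    assume "?J = I"
    then have "card (a \<inter> range v) = c" using cJ by simp
    then have "c \<le> card a" using finite_edge[OF f(2)] by (metis card_mono inf_le1)
    then show False using unif[OF f(2)] rt ct by simp
  qed
  have tJ: "card ?J + 1 \<le> card (touch ?J)" by (rule card_touch[OF idx_I J0 J1])
  have u: "last us \<in> V" "last us \<notin> range v" using q(3,4,10) by auto
  have "a \<in> unu e (last us)" using aF unfolding far_def by simp
  then have dis: "touch ?J \<inter> (?Y - {0}) = {}" using touch_onc[OF d(1) u] by blast
  have "card (touch ?J) + card (?Y - {0}) = card (touch ?J \<union> (?Y - {0}))"
    using dis finite_touch[OF idx_I] onc_I(2) by (intro card_Un_disjoint[symmetric]) auto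
  also have "\<dots> \<le> card ?R" using far_touch[OF Q h aF] onc_spread[OF Q h] by (intro card_mono) auto
  also have "\<dots> = c - 3" unfolding l using c5 by simp
  finally have b: "card (touch ?J) + card (?Y - {0}) \<le> c - 3" .
  have y: "card ?Y \<le> card (?Y - {0}) + 1" by (rule card_minus_one[OF onc_I(2)])
  have ge: "t \<le> card ?Y + 1" using onc_last_ge[OF Q] a l tau_ge by simp
  show "t - 1 \<le> card ?Y" using ge by simp
  have c2: "c \<le> 2 * t" using ln(3) l by simp
  show "c = 2 * t" using b y ge tJ ca h1 c2 c5 by linarith
  have J2: "card ?J + 2 \<le> t" using b y ge tJ c2 c5 by linarith
  then have "card (a \<inter> {hd us}) \<noteq> 0" using ca by linarith
  then show "hd us \<in> a" by (metis Int_insert_right_if0 card.empty inf_bot_right)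
  show "card (a \<inter> range v) = t - 2" using J2 ca h1 cJ by linarith
qed

lemma pair_facts:
  assumes Q: "qlong v e us fs" and h: "onc e (hd us) \<noteq> {}" and l: "length us = 2" and rt': "r = t"
    and a: "far e us fs = {a}"
  shows "hd us \<in> a" "card (a \<inter> range v) = t - 2" "c = 2 * t" "t - 1 \<le> card (onc e (last us))"
proof -
  obtain s where s: "hd us \<in> e s" using h unfolding onc_def by auto
  have s0: "hd us \<in> (\<lambda>i. e (i + s)) 0" using s by simp
  have a': "far (\<lambda>i. e (i + s)) us fs = {a}" using a unfolding far_shift .
  note pf = pair_facts_aux[OF qlong_shift[OF Q, of s] s0 l rt' a', unfolded range_shift card_onc_shift[OF qlongD(1)[OF Q]]]
  show "hd us \<in> a" "card (a \<inter> range v) = t - 2" "c = 2 * t" "t - 1 \<le> card (onc e (last us))" using pf by auto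
qed

lemma far_rev_member:
  assumes Q: "qlong v e us fs" and a: "a \<in> far e us fs" "hd us \<in> a"
  shows "a \<in> far e (rev us) (rev fs)"
  using far_sub[OF Q a(1)] a(2) unfolding far_def unu_def rev_simps(2)[OF Q] by simp

text \<open>The offsets are those that \<open>bridge_EV\<close> excludes for two path vertices: 1
  and 2 forward, 0 and -1 backward.\<close>

lemma edge_far_apart:
  assumes Q: "qlong v e us fs" and l: "length us = 2" and a: "a \<in> E" "a \<notin> range e" "a \<notin> set fs" "last us \<in> a" "v k \<in> a"
    and y: "y \<in> onc e (hd us)" "(k - y) mod int c = dd mod int c" "dd \<in> {-1, 0, 1, 2}"
  shows False
proof -
  note d = qlongD[OF Q]
  have hy: "hd us \<in> e y" using y(1) unfolding onc_def by simp
  have "(y + dd) mod int c = k mod int c" using y(2) by (metis add.commute diff_add_cancel mod_add_cong)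
  then have vy: "v (y + dd) \<in> a" using a(5) cycD(1)[OF d(1)] by metis
  note EV = bridge_EV[OF d(1,2) hy a(1-4) vy]
  show False
  proof (cases "dd \<le> 0")
    case True
    then have "int (length us) \<le> y - (y + dd)" using y(3) c5 by (intro EV(2)) auto
    then show False using l y(3) by auto
  next
    case False
    then have "int (length us) + 1 \<le> (y + dd) - y" using y(3) c5 by (intro EV(1)) auto
    then show False using l y(3) by auto
  qed
qed

text \<open>By symmetry both ends lie on at least \<open>t - 1\<close> cycle edges, none within the
  offsets of \<open>edge_far_apart\<close> from the \<open>t - 2\<close> cycle vertices of
  \<open>a\<close>. \<open>J3\<close> collects the excluded positions; each of the three
  enlargements adds at least one, so the edges of both ends are exactly the \<open>t - 1\<close>
  positions of the complement \<open>K\<close>. As \<open>K\<close> has no two consecutive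
  positions, it embeds into a shift of \<open>idx v a\<close>, which is too small.\<close>

lemma no_common_far:
  assumes Q: "qlong v e us fs" and h: "onc e (hd us) \<noteq> {}" and l: "length us = 2" and rt': "r = t"
    and a: "far e us fs = {a}"
  shows False
proof -
  note d = qlongD[OF Q] and q = qpathD[OF qlongD(2)[OF Q]] and pf = pair_facts[OF Q h l rt' a] and rs = rev_simps[OF Q]
  have aF: "a \<in> far e us fs" using a by simp
  note f = far_sub[OF Q aF]
  let ?X = "onc e (hd us)" and ?Y = "onc e (last us)" and ?J = "idx v a"
  have Y0: "?Y \<noteq> {}" using pf(4) c5 by auto
  have Q': "qlong v e (rev us) (rev fs)" by (rule qlong_rev[OF Q])
  have Y0': "onc e (hd (rev us)) \<noteq> {}" using Y0 unfolding rs .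
  have aF': "a \<in> far e (rev us) (rev fs)" by (rule far_rev_member[OF Q aF pf(1)])
  have l': "length (rev us) = 2" using l by simp
  have "card (far e (rev us) (rev fs)) = 1" using end_cases[OF Q' Y0'] aF' by auto
  then have a': "far e (rev us) (rev fs) = {a}" using aF' by (metis card_1_singletonE singletonD)
  have X1: "t - 1 \<le> card ?X" using pair_facts(4)[OF Q' Y0' l' rt' a'] unfolding rs .
  have cJ: "card ?J = t - 2"
    using idx_image[OF d(1), of a] cyc_inj(1)[OF d(1)] idx_I pf(2) by (metis card_image inj_on_subset)
  define J1 where "J1 = touch ?J"
  define J2 where "J2 = touch (plus J1)"
  define J3 where "J3 = touch J2"
  have JI: "?J \<subseteq> I" "J1 \<subseteq> I" "plus J1 \<subseteq> I" "J2 \<subseteq> I" "J3 \<subseteq> I"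
    unfolding J3_def J2_def J1_def using idx_I plus_I touch_I by meson+
  have J2e: "J2 = J1 \<union> plus J1" unfolding J2_def by (rule touch_plus[OF JI(2)])
  have sh: "(k - prv m) mod int c = (k - m + 1) mod int c" for k m
    unfolding prv_def by (simp add: mod_diff_right_eq algebra_simps)
  have D1: "\<exists>k \<in> ?J. \<exists>dd \<in> {0, 1}. (k - m) mod int c = dd mod int c" if m: "m \<in> J1" for m
  proof -
    consider "m \<in> ?J" | k where "k \<in> ?J" "m = prv k" using m unfolding J1_def touch_def by auto
    then show ?thesis
    proof cases
      case 1
      then have "(m - m) mod int c = 0 mod int c" by simp
      then show ?thesis using 1 by blast
    next
      case 2
      then have "(k - m) mod int c = 1 mod int c" using sh[of k k] by simp
      then show ?thesis using 2 by blast
    qed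
  qed
  have D2: "\<exists>k \<in> ?J. \<exists>dd \<in> {-1, 0, 1}. (k - m) mod int c = dd mod int c" if m: "m \<in> J2" for m
  proof (cases "m \<in> J1")
    case True
    then show ?thesis using D1[OF True] by blast
  next
    case False
    then have "prv m \<in> J1" using m unfolding J2e plus_def by auto
    then obtain k dd where k: "k \<in> ?J" "dd \<in> {0, 1}" "(k - prv m) mod int c = dd mod int c" using D1 by blast
    have "(k - m + 1 - 1) mod int c = (dd - 1) mod int c" using k(3) unfolding sh by (metis mod_diff_cong)
    moreover have "dd - 1 \<in> {-1, 0, 1}" using k(2) by auto
    ultimately show ?thesis using k(1) by (metis add_diff_cancel_right')
  qed
  have D3: "\<exists>k \<in> ?J. \<exists>dd \<in> {-1, 0, 1, 2}. (k - m) mod int c = dd mod int c" if m: "m \<in> J3" for m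
  proof (cases "m \<in> J2")
    case True
    then show ?thesis using D2[OF True] by blast
  next
    case False
    then obtain m' where m': "m' \<in> J2" "m = prv m'" using m unfolding J3_def touch_def by auto
    obtain k dd where k: "k \<in> ?J" "dd \<in> {-1, 0, 1}" "(k - m') mod int c = dd mod int c" using D2[OF m'(1)] by blast
    have "(k - m' + 1) mod int c = (dd + 1) mod int c" using k(3) by (metis mod_add_cong)
    then have "(k - m) mod int c = (dd + 1) mod int c" unfolding m'(2) sh .
    moreover have "dd + 1 \<in> {-1, 0, 1, 2}" using k(2) by auto
    ultimately show ?thesis using k(1) by blast
  qed
  define K where "K = I - J3"
  have XK: "?X \<subseteq> K"
  proof
    fix y assume y: "y \<in> ?X"
    have "y \<notin> J3"
    proof
      assume "y \<in> J3"
      then obtain k dd where "k \<in> ?J" "dd \<in> {-1, 0, 1, 2}" "(k - y) mod int c = dd mod int c" using D3 by blast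
      then show False using edge_far_apart[OF Q l f(2-5) _ y] unfolding idx_def by blast
    qed
    then show "y \<in> K" unfolding K_def using y onc_I by blast
  qed
  have YK: "?Y \<subseteq> K"
  proof
    fix y assume y: "y \<in> ?Y"
    have "y \<notin> J3"
    proof
      assume "y \<in> J3"
      then obtain k dd where k: "k \<in> ?J" "dd \<in> {-1, 0, 1, 2}" "(k - y) mod int c = dd mod int c" using D3 by blast
      have y': "y \<in> onc e (hd (rev us))" using y unfolding rs .
      have la: "last (rev us) \<in> a" using pf(1) unfolding rs .
      have nf: "a \<notin> set (rev fs)" using f(4) by simp
      have vk: "v k \<in> a" using k(1) unfolding idx_def by simp
      show False by (rule edge_far_apart[OF Q' l' f(2,3) nf la vk y' k(3,2)])
    qed
    then show "y \<in> K" unfolding K_def using y onc_I by blast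
  qed
  have K0: "K \<noteq> {}" using YK Y0 by blast
  have nI: "S \<noteq> I" if "S \<subseteq> J3" for S using that K0 unfolding K_def by blast
  have sub3: "J2 \<subseteq> J3" unfolding J3_def touch_def by blast
  have sub2: "J1 \<subseteq> J2" "plus J1 \<subseteq> J2" unfolding J2e by auto
  have sub1: "?J \<subseteq> J1" unfolding J1_def touch_def by blast
  have J0: "?J \<noteq> {}" using cJ c5 by auto
  have c1: "card ?J + 1 \<le> card J1" unfolding J1_def
    using nI[of ?J] sub1 sub2 sub3 by (intro card_touch[OF JI(1) J0]) blast
  have P0: "plus J1 \<noteq> {}" using card_plus[OF JI(2)] c1 by (metis add_is_0 card.empty le_zero_eq one_neq_zero)
  have c2: "card J1 + 1 \<le> card J2" unfolding J2_def card_plus[OF JI(2), symmetric]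
    using nI[of "plus J1"] sub2 sub3 by (intro card_touch[OF JI(3) P0]) blast
  have J20: "J2 \<noteq> {}" using P0 sub2 by blast
  have c3: "card J2 + 1 \<le> card J3" unfolding J3_def
    using nI[of J2] sub3 by (intro card_touch[OF JI(4) J20]) blast
  have cK: "card K + card J3 = c"
    unfolding K_def using JI(5) finite_I[OF JI(5)] card_mono[OF _ JI(5)] by (subst card_Diff_subset) auto
  have K1: "card K \<le> t - 1" using cK c1 c2 c3 cJ pf(3) c5 by linarith
  have fK: "finite K" unfolding K_def by simp
  have XE: "?X = K" using XK K1 X1 fK by (intro card_seteq) auto
  have YE: "?Y = K" using YK K1 pf(4) fK by (intro card_seteq) auto
  \<comment> \<open>The successor of an element of \<open>K\<close> starts a run of
    \<open>J3\<close>, so it lies two places before a vertex of \<open>a\<close>.\<close>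
  have "K \<subseteq> prv ` prv ` prv ` ?J"
  proof
    fix k assume k: "k \<in> K"
    then have kI: "k \<in> I" unfolding K_def by simp
    define k' where "k' = (k + 1) mod int c"
    have k'I: "k' \<in> I" unfolding k'_def by (rule mod_in_I)
    have pk: "prv k' = k" unfolding k'_def prv_def using kI by (simp add: mod_diff_left_eq)
    have "k' \<notin> K"
    proof
      assume "k' \<in> K"
      then have "k' \<in> ?X \<inter> plus ?Y" unfolding XE YE plus_def using k k'I pk by simp
      then show False using onc_two_disjoint[OF Q] by blast
    qed
    then have k3: "k' \<in> J3" using k'I unfolding K_def by simp
    have kn: "k \<notin> J3" using k unfolding K_def by simp
    have "k' \<notin> J2" using kn pk unfolding J3_def touch_def by auto
    then obtain m where m: "m \<in> J2" "k' = prv m" using k3 unfolding J3_def touch_def by auto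
    have "m \<notin> plus J1" using \<open>k' \<notin> J2\<close> m sub2 unfolding plus_def by auto
    then have "m \<in> J1" using m unfolding J2e by simp
    moreover have "m \<notin> ?J" using \<open>k' \<notin> J2\<close> m sub2 unfolding J1_def touch_def by auto
    ultimately obtain m' where "m' \<in> ?J" "m = prv m'" unfolding J1_def touch_def by auto
    then show "k \<in> prv ` prv ` prv ` ?J" using m(2) pk by blast
  qed
  then have "card K \<le> card (prv ` prv ` prv ` ?J)" using finite_idx by (intro card_mono) auto
  also have "\<dots> \<le> card ?J" using card_image_le finite_idx finite_imageI le_trans by metis
  finally show False using cJ X1[unfolded XE] c5 by linarith
qed

text \<open>No end has far edges, so each lies on at least \<open>t + 2 - l\<close> cycle edges. For
  \<open>l \<ge> 3\<close> this contradicts \<open>two_sets_spread\<close>. For \<open>l = 2\<close>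
  the two sets, one of them shifted, would fill the cycle exactly; but the single path edge has a
  third vertex, on the cycle, and that position is in neither set.\<close>

theorem no_onc_hd:
  assumes Q: "qlong v e us fs"
  shows "onc e (hd us) = {}"
proof (rule ccontr)
  assume h: "onc e (hd us) \<noteq> {}"
  note d = qlongD[OF Q] and q = qpathD[OF qlongD(2)[OF Q]] and ln = qlong_len[OF Q] and rs = rev_simps[OF Q]
  have Q': "qlong v e (rev us) (rev fs)" by (rule qlong_rev[OF Q])
  have nf: "far e ws gs = {} \<and> (r = t \<or> (t = 4 \<and> r = 3 \<and> length ws = 2))"
    if W: "qlong v e ws gs" "onc e (hd ws) \<noteq> {}" for ws gs
  proof (rule ccontr)
    assume "\<not> ?thesis"
    then have w: "r = t" "length ws = 2" "card (far e ws gs) = 1" using end_cases[OF W] by auto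
    obtain a where "far e ws gs = {a}" using w(3) by (rule card_1_singletonE)
    then show False using no_common_far[OF W w(2,1)] by blast
  qed
  have 1: "far e us fs = {}" "r = t \<or> (t = 4 \<and> r = 3 \<and> length us = 2)" using nf[OF Q h] by auto
  have y: "(t choose (r - 1)) + 2 \<le> length us + card (onc e (last us))" using onc_last_ge[OF Q] 1 by simp
  then have y2: "2 \<le> card (onc e (last us))" using tau_ge ln(2) by linarith
  then have "onc e (hd (rev us)) \<noteq> {}" unfolding rs by auto
  then have 2: "far e (rev us) (rev fs) = {}" using nf[OF Q'] by simp
  have x: "(t choose (r - 1)) + 2 \<le> length us + card (onc e (hd us))" using onc_last_ge[OF Q'] 2 unfolding rs by simp
  show False
  proof (cases "length us = 2")
    case False
    then have l3: "3 \<le> length us" using d(3) by simp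
    obtain s where s: "hd us \<in> e s" using h unfolding onc_def by auto
    let ?e = "\<lambda>i. e (i + s)" and ?v = "\<lambda>i. v (i + s)"
    have C': "cyc ?v ?e" by (rule cyc_shift[OF d(1)])
    have Qs: "qpath ?v ?e us fs" using qlongD(2)[OF qlong_shift[OF Q]] .
    have 0: "0 \<in> onc ?e (hd us)" unfolding onc_def using s c5 by simp
    have cY: "2 \<le> card (onc ?e (last us))" using y2 card_onc_shift[OF d(1)] by simp
    obtain y0 where y0: "y0 \<in> onc ?e (last us)" "y0 \<noteq> 0"
    proof -
      have "\<not> onc ?e (last us) \<subseteq> {0}"
      proof
        assume "onc ?e (last us) \<subseteq> {0}"
        then have "card (onc ?e (last us)) \<le> card {0::int}" by (intro card_mono) auto
        then show False using cY by simp
      qed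
      then show ?thesis using that by blast
    qed
    have "int (card (onc ?e (hd us))) + int (card (onc ?e (last us))) + 2 * int (length us) \<le> int c + 4"
    proof (rule two_sets_spread[OF onc_I(1) 0 onc_I(1) y0])
      show "2 \<le> int (length us)" using l3 by simp
      fix x y assume "x \<in> onc ?e (hd us)" "y \<in> onc ?e (last us)" "x \<noteq> y"
      then show "int (length us) \<le> \<bar>x - y\<bar> \<and> \<bar>x - y\<bar> \<le> int c - int (length us)" using bridge_EE_I[OF C' Qs] by blast
    qed
    then have "card (onc e (hd us)) + card (onc e (last us)) + 2 * length us \<le> c + 4"
      using card_onc_shift[OF d(1)] by simp
    then show False using x y tau_ge ln(3) l3 by linarith
  next
    case True
    have sum: "card (onc e (hd us)) + card (onc e (last us)) \<le> c" by (rule onc_two_sum(1)[OF Q])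
    have c2: "c \<le> 2 * t" using ln(3) True by simp
    have rt': "r = t"
    proof (rule ccontr)
      assume "r \<noteq> t"
      then have t4: "t = 4" "r = 3" using 1 by auto
      then have "t choose (r - 1) = 6" by (simp add: choose_two)
      then show False using x y sum c2 True t4 by linarith
    qed
    have c: "c = 2 * t" using x y sum tau_ge c2 True by linarith
    have V: "V = set us \<union> range v"
    proof -
      have "card (set us \<union> range v) = 2 + c"
        using q(4) range_cyc(3,5)[OF d(1)] distinct_card[OF q(2)] True by (simp add: card_Un_disjoint)
      moreover have "set us \<union> range v \<subseteq> V" using q(3) range_cyc(7)[OF d(1)] by auto
      ultimately show ?thesis using nV(2) c finV by (intro card_seteq[symmetric]) auto
    qed
    obtain f where f: "fs = [f]" using q(8) True by (cases fs) auto
    obtain a b where ab: "us = [a, b]" using True by (cases us; cases "tl us") auto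
    have fE: "f \<in> E" "f \<notin> range e" "a \<in> f" "b \<in> f" using q(1,6,7) f ab by auto
    have "\<not> f \<subseteq> set us"
    proof
      assume "f \<subseteq> set us"
      then have "card f \<le> card (set us)" by (intro card_mono) auto
      then show False using unif[OF fE(1)] r3 distinct_card[OF q(2)] True by simp
    qed
    then obtain w where w: "w \<in> f" "w \<notin> set us" by blast
    then have "w \<in> range v" using subV[OF fE(1)] V by blast
    then obtain j where j: "j \<in> I" "w = v j" unfolding range_cyc(1)[OF d(1)] by blast
    have abV: "a \<in> V" "a \<notin> range v" "b \<in> V" "b \<notin> range v" using q(3,4) ab by auto
    have "a \<notin> e j" using insert_used(1)[OF d(1) abV(1,2) fE(1,2,3), of j] w j by blast
    then have j1: "j \<notin> onc e (hd us)" unfolding onc_def ab by simp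
    have "v (prv j + 1) \<in> f" using cyc_prv[OF d(1), of j] w j by simp
    then have "b \<notin> e (prv j)" using insert_used(2)[OF d(1) abV(3,4) fE(1,2,4), of "prv j"] by blast
    then have j2: "prv j \<notin> onc e (last us)" unfolding onc_def ab by simp
    show False using onc_two_sum(2)[OF Q j(1) j1 j2] x y tau_ge c True by linarith
  qed
qed

end

lemma choose_add: "1 \<le> s \<Longrightarrow> s \<le> y + 1 \<Longrightarrow> (y choose s) + p \<le> y + p choose s"
proof (induction p)
  case (Suc p)
  have "Suc (y + p) choose s = (y + p choose (s - 1)) + (y + p choose s)"
    using choose_pascal[of "Suc (y + p)" s] Suc by simp
  moreover have "1 \<le> y + p choose (s - 1)" using Suc by (simp add: Suc_le_eq zero_less_binomial_iff)
  ultimately show ?case using Suc by simp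
qed simp

context ham
begin

section \<open>Ends of the outside path that lie on no cycle edge\<close>

lemma touch_single: "M \<subseteq> {k. k = 0 \<or> (x + 1 \<le> k \<and> k \<le> y)} \<Longrightarrow> 0 \<le> x \<Longrightarrow> y < int c \<Longrightarrow> touch M \<subseteq> {0, int c - 1} \<union> {x..y}"
proof
  fix m assume M: "M \<subseteq> {k. k = 0 \<or> (x + 1 \<le> k \<and> k \<le> y)}" "0 \<le> x" "y < int c" "m \<in> touch M"
  then consider "m \<in> M" | k where "k \<in> M" "m = prv k" unfolding touch_def by auto
  then show "m \<in> {0, int c - 1} \<union> {x..y}"
  proof cases
    case 1
    then show ?thesis using M by force
  next
    case 2
    then have k: "k = 0 \<or> (x + 1 \<le> k \<and> k \<le> y)" using M by blast
    then have "k \<in> I" using M c5 by auto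
    then show ?thesis using prv_cases[of k] prv_I[of k] k 2 M by auto
  qed
qed

text \<open>Path and cycle exhaust \<open>V\<close>, and \<open>c = t + 2\<close>. Extended by
  \<open>v 0\<close>, the path has \<open>t + 1\<close> vertices, so \<open>escape\<close>
  rearranges it with \<open>v 0\<close> still last and an edge leaving it at the new head. That edge
  attaches the head to the cycle, and the bridging distances from \<open>v 0\<close> in both
  directions do not fit into \<open>t + 2\<close>.\<close>

lemma no_far_full_length:
  assumes Q: "qlong v e us fs" and a1: "a1 \<in> far e (rev us) (rev fs)" "v 0 \<in> a1" and lt: "length us = t"
  shows False
proof -
  note d = qlongD[OF Q] and q = qpathD[OF qlongD(2)[OF Q]] and ln = qlong_len[OF Q] and rs = rev_simps[OF Q]
  note f1 = far_sub[OF qlong_rev[OF Q] a1(1), unfolded rs]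
  have c: "c = t + 2" using ln lt ct by simp
  have V: "V = set us \<union> range v"
  proof -
    have "card (set us \<union> range v) = t + c"
      using q(4) range_cyc(3,5)[OF d(1)] distinct_card[OF q(2)] lt by (simp add: card_Un_disjoint)
    moreover have "set us \<union> range v \<subseteq> V" using q(3) range_cyc(7)[OF d(1)] by auto
    ultimately show ?thesis using nV(2) c finV by (intro card_seteq[symmetric]) auto
  qed
  let ?vs = "rev us @ [v 0]" and ?es = "rev fs @ [a1]"
  have b: "bp (rev us @ [v 0]) (rev fs @ a1 # [])"
    using bp_rev[OF q(1)] f1(5) a1(2) rs by (intro bp_append) auto
  have v0: "v 0 \<notin> set us" using q(4) by blast
  have sv: "set ?vs = insert (v 0) (set us)" by auto
  \<comment> \<open>There is no continuation of the path to protect, so \<open>x0\<close> is the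
    empty set, which is not an edge.\<close>
  have "\<exists>ws gs g. bp ws gs \<and> distinct ws \<and> set ws = set ?vs \<and> last ws = last ?vs \<and> distinct gs \<and>
     set gs \<subseteq> E \<and> {} \<notin> set gs \<and> set gs \<subseteq> set ?es \<union> Pow (set ?vs) \<and>
     g \<in> E \<and> g \<notin> set gs \<and> g \<noteq> {} \<and> hd ws \<in> g \<and> \<not> g \<subseteq> set ?vs"
  proof (rule escape[where m = t and r = r])
    show "(t choose (r - 1)) + 1 \<le> card {e \<in> E. x \<in> e}" if "x \<in> set ?vs" for x
      using that deg q(3) cycD(3)[OF d(1)] unfolding sv by auto
    show "{} \<notin> set ?es" using q(6) f1(2) unif r3 by force
    show "length ?vs = Suc t" using lt by simp
    show "distinct ?vs" using q(2) v0 by simp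
    show "distinct ?es" using q(5) f1(4) by simp
    show "set ?es \<subseteq> E" using q(6) f1(2) by auto
    show "bp ?vs ?es" using b by simp
  qed (use finE unif r3 rt in auto)
  then obtain ws gs g where w: "bp ws gs" "distinct ws" "set ws = insert (v 0) (set us)" "last ws = v 0" "distinct gs"
    "set gs \<subseteq> E" "set gs \<subseteq> set ?es \<union> Pow (insert (v 0) (set us))" "g \<in> E" "g \<notin> set gs" "hd ws \<in> g" "\<not> g \<subseteq> insert (v 0) (set us)"
    unfolding sv by auto
  have lw: "length ws = Suc t"
    using distinct_card[OF w(2)] w(3) v0 distinct_card[OF q(2)] lt by simp
  then have lg: "length gs = t" using bp_length[OF w(1)] by simp
  have t0: "0 < t" using c5 by simp
  \<comment> \<open>\<open>escape\<close> may bring in any edges inside the vertex set, but this set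
    has only one cycle vertex, while a cycle edge contains two.\<close>
  have nr: "x \<notin> range e" if "x \<in> set gs" for x
  proof
    assume "x \<in> range e"
    then obtain k where k: "x = e k" by blast
    have "x \<in> set ?es \<or> x \<subseteq> insert (v 0) (set us)" using w(7) that by blast
    moreover have "x \<notin> set ?es" using \<open>x \<in> range e\<close> q(7) f1(3) by auto
    ultimately have "e k \<subseteq> insert (v 0) (set us)" using k by blast
    then have "v k = v 0" "v (k + 1) = v 0" using cycD(5,6)[OF d(1), of k] q(4) by blast+
    then have "v k = v (k + 1)" by simp
    then show False using cycD(1)[OF d(1)] mod_neq[of k "k + 1"] c5 by auto
  qed
  define xs where "xs = take t ws"
  define hs where "hs = take (t - 1) gs"
  define h where "h = gs ! (t - 1)"
  have ws: "ws = xs @ [v 0]"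
  proof -
    have "ws = take t ws @ [ws ! t]" using lw take_Suc_conv_app_nth[of t ws] by simp
    moreover have "ws ! t = v 0" using w(4) lw by (metis Suc_eq_plus1 diff_Suc_1 last_conv_nth length_0_conv nat.distinct(1))
    ultimately show ?thesis unfolding xs_def by simp
  qed
  have bx: "bp xs hs" unfolding xs_def hs_def using bp_take[OF w(1), of "t - 1"] lg t0 by simp
  have hx: "last xs \<in> h" "v 0 \<in> h"
  proof -
    have n: "ws ! (t - 1) \<in> h" "ws ! Suc (t - 1) \<in> h" unfolding h_def using bp_nth[OF w(1), of "t - 1"] lg t0 by auto
    have "last xs = xs ! (t - 1)" unfolding xs_def using lw t0 by (subst last_conv_nth) auto
    then show "last xs \<in> h" using n(1) t0 unfolding xs_def by simp
    have "ws ! t = v 0" unfolding ws using ws lw by (simp add: nth_append)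
    then show "v 0 \<in> h" using n(2) t0 by simp
  qed
  have xs_ne: "xs \<noteq> []" using bp_not_Nil[OF bx] .
  have dx: "distinct xs" "v 0 \<notin> set xs" using w(2) unfolding ws by auto
  have "insert (v 0) (set xs) = insert (v 0) (set us)" using w(3) unfolding ws by simp
  then have sx: "set xs = set us" using insert_ident[OF dx(2) v0] by simp
  have hE: "h \<in> set gs" unfolding h_def using lg t0 by simp
  have hh: "h \<notin> set hs"
  proof
    assume "h \<in> set hs"
    then obtain i where "i < t - 1" "gs ! i = gs ! (t - 1)" unfolding hs_def h_def using lg by (auto simp: in_set_conv_nth)
    then show False using w(5) lg t0 by (simp add: nth_eq_iff_index_eq)
  qed
  have sh: "set hs \<subseteq> set gs" unfolding hs_def by (rule set_take_subset)
  have Qx: "qpath v e xs hs" unfolding qpath_def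
  proof (intro conjI)
    show "set xs \<subseteq> V - range v" unfolding sx using q(3,4) by blast
    show "set hs \<subseteq> E - range e" using sh w(6) nr by blast
    show "distinct hs" unfolding hs_def using w(5) by simp
  qed (use bx dx in auto)
  have lx: "length xs = t" unfolding xs_def using lw by simp
  have hg: "hd xs \<in> g" using w(10) xs_ne unfolding ws by simp
  have gh: "g \<notin> set hs" "g \<noteq> h" using w(9) sh hE by auto
  have hU: "h \<in> E" "h \<notin> range e" using hE w(6) nr by auto
  show False
  proof (cases "g \<in> range e")
    case True
    then obtain k where k: "k \<in> I" "g = e k" using range_cyc(2)[OF d(1)] by blast
    have hk: "hd xs \<in> e k" using hg k by simp
    have "v (int c) \<in> h" using hx(2) cyc_period(1)[OF d(1), of 0] by simp
    then have "int (length xs) + 1 \<le> int c - k"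
      using k(1) by (intro bridge_EV(1)[OF d(1) Qx hk hU hh hx(1)]) auto
    moreover have "int (length xs) \<le> k - 0" using k(1) by (intro bridge_EV(2)[OF d(1) Qx hk hU hh hx]) auto
    ultimately show False using lx c c5 by simp
  next
    case False
    obtain y where y: "y \<in> g" "y \<notin> insert (v 0) (set us)" using w(11) by blast
    then have "y \<in> range v" using subV[OF w(8)] V by blast
    then obtain j where j: "j \<in> I" "y = v j" using range_cyc(1)[OF d(1)] by blast
    have j0: "j \<noteq> 0" using j y by auto
    have vj: "v j \<in> g" using y j by simp
    have rx: "hd (rev xs) = last xs" "last (rev xs) = hd xs" using xs_ne by (auto simp: hd_rev last_rev)
    have "int (length (rev xs)) + 1 \<le> j - 0"
      using j j0 hU hh hx hg gh False w(8) vj rx by (intro bridge_VV[OF d(1) qpath_rev[OF Qx], of 0 j h g]) auto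
    moreover have "v (int c) \<in> h" using hx(2) cyc_period(1)[OF d(1), of 0] by simp
    then have "int (length xs) + 1 \<le> int c - j"
      using j j0 hU hh hx hg gh False w(8) vj by (intro bridge_VV[OF d(1) Qx, of j "int c" g h]) auto
    ultimately show False using lx c c5 by simp
  qed
qed

text \<open>\<open>a1\<close> attaches the head at \<open>v 0\<close>, so every other far edge of
  the last vertex is attached at \<open>v 0\<close> or at distance more than \<open>l\<close> from
  it. The last vertex has no cycle edges, and counting leaves \<open>l = 2\<close>,
  \<open>c = 2 * t\<close> and a nearly complete star, where two far edges bridge a distance that is
  too short.\<close>

lemma no_qlong_aux:
  assumes Q: "qlong v e us fs" and a1: "a1 \<in> far e (rev us) (rev fs)" "v 0 \<in> a1"
  shows False
proof -
  note d = qlongD[OF Q] and q = qpathD[OF qlongD(2)[OF Q]] and ln = qlong_len[OF Q] and rs = rev_simps[OF Q]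
  note f1 = far_sub[OF qlong_rev[OF Q] a1(1), unfolded rs]
  have f1': "a1 \<notin> set fs" using f1(4) by simp
  let ?l = "length us" and ?u = "last us"
  have u: "?u \<in> V" "?u \<notin> range v" using q(3,4,10) by auto
  have on0: "onc e ?u = {}" using no_onc_hd[OF qlong_rev[OF Q]] unfolding rs .
  have pos: "k = 0 \<or> (int ?l + 1 \<le> k \<and> k \<le> int c - int ?l - 1)" if a: "a \<in> far e us fs - {a1}" and k: "k \<in> idx v a" for a k
  proof (cases "k = 0")
    case False
    have kI: "0 < k" "k < int c" "v k \<in> a" using k False unfolding idx_def by auto
    have aF: "a \<in> far e us fs" "a1 \<noteq> a" using a by auto
    note f = far_sub[OF Q aF(1)]
    have 1: "int ?l + 1 \<le> k - 0"
      using kI by (intro bridge_VV[OF d(1,2) _ _ f1(2,3) f1' f1(5) a1(2) f(2-5) kI(3) aF(2)]) auto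
    have vc: "v (int c) \<in> a1" using a1(2) cyc_period(1)[OF d(1), of 0] by simp
    have "int (length (rev us)) + 1 \<le> int c - k"
      using kI f f1 f1' aF vc rs by (intro bridge_VV[OF d(1) qpath_rev[OF d(2)], of k "int c" a a1]) auto
    then show ?thesis using 1 by simp
  qed simp
  \<comment> \<open>The cycle edges at position 0, and those at positions from \<open>l + 1\<close>
    to \<open>c - l - 1\<close>.\<close>
  let ?Av = "{0, int c - 1} \<union> {int ?l..int c - int ?l - 1}"
  have tt: "touch (idx v a) \<subseteq> ?Av" if "a \<in> far e us fs - {a1}" for a
    using pos[OF that] by (intro touch_single) auto
  define A where "A = (far e us fs - {a1}) \<union> goodf us fs"
  have fA: "finite ?Av" "{} \<subseteq> ?Av" "{} \<subseteq> onc e ?u" by auto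
  let ?x = "card (dbl v A)" and ?p = "card (priv v A)"
  have fc1: "card A \<le> (?l - 1 + ?x choose (r - 1)) + ?p"
    unfolding A_def by (rule family_count(1)[OF Q fA]) (erule tt)
  have fc2: "2 * ?x + ?p * (1 + max 1 (r - 1 - (?l - 1 + ?x))) + card ({} :: int set) \<le> card ?Av"
    unfolding A_def by (rule family_count(2)[OF Q fA]) (erule tt)
  have fc4: "a \<subseteq> set us \<union> v ` dbl v A" if "priv v A = {}" "a \<in> A" for a
    using that unfolding A_def by (intro family_count(4)[OF Q fA]) (erule tt)
  have fc5: "card (touch (dbl v A)) = 2 * ?x" unfolding A_def by (rule family_count(5)[OF Q fA]) (erule tt)
  have fc6: "touch (dbl v A) \<subseteq> ?Av" unfolding A_def by (rule family_count(6)[OF Q fA]) (erule tt)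
  have fc7: "card (unu e ?u) \<le> card A + card (badf us fs) + card ({a1} \<inter> unu e ?u)"
    unfolding A_def by (rule family_count(7)[OF Q fA]) (erule tt)
  have cAv: "card ?Av \<le> 2 + (c - 2 * ?l)"
  proof -
    have "card ?Av \<le> card {0, int c - 1} + card {int ?l..int c - int ?l - 1}" by (rule card_Un_le)
    moreover have "card {0, int c - 1} \<le> 2" by (simp add: card_insert_if)
    moreover have "card {int ?l..int c - int ?l - 1} = c - 2 * ?l" by simp
    ultimately show ?thesis by linarith
  qed
  note cA = fc1
  have cap0: "2 * ?x + ?p * (1 + max 1 (r - 1 - (?l - 1 + ?x))) \<le> 2 + (c - 2 * ?l)" using fc2 cAv by simp
  moreover have "2 * ?p \<le> ?p * (1 + max 1 (r - 1 - (?l - 1 + ?x)))" by simp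
  ultimately have cap: "2 * ?x + 2 * ?p \<le> 2 + (c - 2 * ?l)" by linarith
  have un: "card (unu e ?u) \<le> card A + card (badf us fs) + 1"
  proof -
    have "card ({a1} \<inter> unu e ?u) \<le> card {a1}" by (intro card_mono) auto
    then show ?thesis using fc7 by simp
  qed
  have bf: "card (badf us fs) + 1 \<le> ?l" using badf_le(1)[OF d(2)] d(3) by linarith
  have dg: "(t choose (r - 1)) + 1 \<le> card (unu e ?u)" using deg_ge[OF d(1) u(1)] on0 by simp
  have dA: "(t choose (r - 1)) + 1 \<le> card A + ?l" using dg un bf by linarith
  have lt: "?l < t" using no_far_full_length[OF Q a1] ln(2) by fastforce
  have pas: "t choose (r - 1) = (t - 1 choose (r - 2)) + (t - 1 choose (r - 1))"
    using choose_pascal[of t "r - 1"] r3 c5 by (simp add: numeral_2_eq_2)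
  have sl: "t - 1 \<le> t - 1 choose (r - 2)" using r3 rt by (intro choose_ge_self) auto
  \<comment> \<open>By \<open>choose_add\<close>, a private edge contributes no more than an
    additional point of the star would, so with fewer than \<open>t\<close> points in all the degree
    is not reached.\<close>
  have Mt: "t \<le> ?l - 1 + ?x + ?p"
  proof (rule ccontr)
    assume n: "\<not> t \<le> ?l - 1 + ?x + ?p"
    show False
    proof (cases "r - 1 \<le> ?l - 1 + ?x + 1")
      case True
      have "(?l - 1 + ?x choose (r - 1)) + ?p \<le> ?l - 1 + ?x + ?p choose (r - 1)"
        using True r3 by (intro choose_add) auto
      also have "\<dots> \<le> t - 1 choose (r - 1)" using n by (intro binomial_right_mono) linarith
      finally show False using cA dA pas sl lt by linarith
    next
      case False
      then have "?l - 1 + ?x choose (r - 1) = 0" by (intro binomial_eq_0) linarith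
      then show False using cA dA n tau_ge d(3) by linarith
    qed
  qed
  have l2: "?l = 2" and c2: "c = 2 * t" and xp: "?x + ?p = t - 1"
  proof -
    have "2 * ?l \<le> c"
    proof (rule ccontr)
      assume "\<not> 2 * ?l \<le> c"
      then have "?x + ?p \<le> 1" using cap by linarith
      then show False using Mt lt d(3) by linarith
    qed
    then have 1: "2 * ?x + 2 * ?p + 2 * ?l \<le> c + 2" using cap by linarith
    have 2: "t + 1 \<le> ?l + (?x + ?p)" using Mt d(3) by linarith
    have 3: "2 * t \<le> c" using 1 2 by linarith
    show l: "?l = 2" using 3 ln(3) nV d(3) by linarith
    show "c = 2 * t" using 3 ln(3) nV l by linarith
    then show "?x + ?p = t - 1" using 1 2 l by linarith
  qed
  obtain w1 w2 where us: "us = [w1, w2]" using l2 by (cases us; cases "tl us") auto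
  have wne: "w1 \<noteq> w2" using q(2) us by simp
  have gf: "goodf us fs = {}"
  proof -
    have False if "f \<in> goodf us fs" for f
    proof -
      have "card f \<le> card (set us)" using that unfolding goodf_def by (intro card_mono) auto
      then show False using that unif[of f] q(6) r3 distinct_card[OF q(2)] l2 unfolding goodf_def by auto
    qed
    then show ?thesis by blast
  qed
  have AE: "A = far e us fs - {a1}" unfolding A_def using gf by simp
  have A1: "(t choose (r - 1)) \<le> card A + 1" using dA l2 by linarith
  have w: "w1 \<in> V" "w1 \<notin> range v" "w2 \<in> V" "w2 \<notin> range v" using q(3,4) us by auto
  show False
  proof (cases "t = 3")
    case True
    \<comment> \<open>For \<open>t = 3\<close>, all triples of \<open>{w1, w2, v 0, v 3}\<close>
      through \<open>w2\<close> must be far edges. With \<open>{w1, w2, v 0}\<close> as path edge,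
      the old path edge \<open>f\<close> and \<open>{w1, w2, v 3}\<close> bridge from position 3 to
      another vertex of \<open>f\<close>, at distance at most 2.\<close>
    have r3': "r = 3" and c6: "c = 6" using True rt r3 c2 by auto
    have tau3: "t choose (r - 1) = 3" using True r3' by (simp add: choose_two)
    have kpos: "k = 0 \<or> k = 3" if "a \<in> far e us fs - {a1}" "k \<in> idx v a" for a k using pos[OF that] l2 c6 by auto
    have sub: "a \<subseteq> {w1, w2, v 0, v 3}" if a: "a \<in> far e us fs" for a
    proof (cases "a = a1")
      case False
      have "a \<inter> range v \<subseteq> {v 0, v 3}" using idx_image[OF d(1), of a] kpos[of a] a False by blast
      then show ?thesis using far_sub(1)[OF Q a] us by auto
    next
      case True
      have "w1 \<in> a" "w2 \<in> a" "v 0 \<in> a" using f1(5) a1(2) True far_sub(5)[OF Q a] us by auto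
      then have s: "{w1, w2, v 0} \<subseteq> a" by simp
      have "w1 \<noteq> v 0" "w2 \<noteq> v 0" using w by auto
      then have "card {w1, w2, v 0} = 3" using wne by simp
      then have "{w1, w2, v 0} = a" using s unif[OF far_sub(2)[OF Q a]] finite_edge[OF far_sub(2)[OF Q a]] r3' by (intro card_subset_eq) auto
      then show ?thesis by blast
    qed
    let ?S = "{b. b \<subseteq> {w1, w2, v 0, v 3} \<and> w2 \<in> b \<and> card b = r}"
    have v03: "v 0 \<noteq> v 3" using cycD(1)[OF d(1), of 0 3] c6 by simp
    have ne: "w1 \<noteq> v 0" "w1 \<noteq> v 3" "w2 \<noteq> v 0" "w2 \<noteq> v 3" using w by auto
    have c4: "card {w1, w2, v 0, v 3} = 4" using ne wne v03 by simp
    have cS: "card ?S = 3"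
      using card_subsets_containing[of "{w1, w2, v 0, v 3}" w2 r] c4 r3' by (simp add: choose_two)
    have fS: "finite ?S" by simp
    have farS: "far e us fs \<subseteq> ?S" using sub far_sub(2,5)[OF Q] unif us by auto
    have "3 \<le> card (far e us fs)"
      using dg unu_last_le[OF Q] tau3 l2 by linarith
    then have all: "far e us fs = ?S" using cS farS fS by (intro card_seteq) auto
    have T0: "{w1, w2, v 0} \<in> far e us fs" and T3: "{w1, w2, v 3} \<in> far e us fs"
      unfolding all using ne wne r3' by auto
    obtain f where f: "fs = [f]" using q(8) l2 by (cases fs) auto
    have fE: "f \<in> E" "f \<notin> range e" "w1 \<in> f" "w2 \<in> f" using q(1,6,7) f us by auto
    have fn: "f \<notin> far e us fs" unfolding far_def using f by simp
    have V: "V = set us \<union> range v"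
    proof -
      have "card (set us \<union> range v) = 2 + c"
        using q(4) range_cyc(3,5)[OF d(1)] distinct_card[OF q(2)] l2 by (simp add: card_Un_disjoint)
      moreover have "set us \<union> range v \<subseteq> V" using q(3) range_cyc(7)[OF d(1)] by auto
      ultimately show ?thesis using nV(2) c2 finV by (intro card_seteq[symmetric]) auto
    qed
    have "\<not> f \<subseteq> {w1, w2, v 0, v 3}" using fn fE unif[OF fE(1)] unfolding all by blast
    then obtain y where y: "y \<in> f" "y \<notin> {w1, w2, v 0, v 3}" by blast
    then have "y \<in> range v" using subV[OF fE(1)] V us by auto
    then obtain j where j: "j \<in> I" "y = v j" using range_cyc(1)[OF d(1)] by blast
    have j03: "j \<noteq> 0" "j \<noteq> 3" "0 \<le> j" "j < 6" using j y c6 by auto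
    note F0 = far_sub[OF Q T0] and F3 = far_sub[OF Q T3]
    have T03: "{w1, w2, v 0} \<noteq> {w1, w2, v 3}" using v03 ne by auto
    have Qn: "qpath v e [w1, w2] [{w1, w2, v 0}]" unfolding qpath_def using F0(2,3) w wne by simp
    have f0: "f \<noteq> {w1, w2, v 0}" "f \<noteq> {w1, w2, v 3}" using fn T0 T3 by auto
    have vj: "v j \<in> f" using y j by simp
    show False
    proof (cases "3 < j")
      case True
      have "int (length [w1, w2]) + 1 \<le> j - 3"
        using True j03 c6 F3(2,3) fE T03 f0 vj by (intro bridge_VV[OF d(1) Qn, of 3 j "{w1, w2, v 3}" f]) auto
      then show False using j03 by simp
    next
      case False
      have "int (length (rev [w1, w2])) + 1 \<le> 3 - j"
        using False j03 c6 F3(2,3) fE T03 f0 vj by (intro bridge_VV[OF d(1) qpath_rev[OF Qn], of j 3 f "{w1, w2, v 3}"]) auto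
      then show False using j03 by simp
    qed
  next
    case False
    then have t4: "4 \<le> t" using c5 by simp
    have p0: "?p = 0"
    proof (rule ccontr)
      assume p: "?p \<noteq> 0"
      show False
      proof (cases "r - 1 \<le> ?l - 1 + ?x + 1")
        case True
        have "(?l - 1 + ?x choose (r - 1)) + (?p - 1) \<le> ?l - 1 + ?x + (?p - 1) choose (r - 1)"
          using True r3 by (intro choose_add) auto
        also have "?l - 1 + ?x + (?p - 1) = t - 1" using xp l2 p by linarith
        finally have "card A \<le> (t - 1 choose (r - 1)) + 1" using cA p by linarith
        then show False using A1 pas sl t4 by linarith
      next
        case False
        then have "?l - 1 + ?x choose (r - 1) = 0" by (intro binomial_eq_0) linarith
        then have pt: "t - 1 \<le> ?p" using cA A1 tau_ge by linarith
        then have x0: "?x = 0" "?p = t - 1" using xp by linarith+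
        have "?p * 3 \<le> ?p * (1 + max 1 (r - 1 - (?l - 1 + ?x)))" using False x0 l2 by (intro mult_left_mono) auto
        then have "?p * 3 \<le> 2 + (c - 2 * ?l)" using cap0 by linarith
        then show False using c2 l2 t4 x0 by linarith
      qed
    qed
    then have pe: "priv v A = {}"
    proof -
      have "finite A" unfolding A_def far_def goodf_def using finite_unu by simp
      then have "finite (priv v A)" unfolding priv_def by simp
      then show ?thesis using p0 by simp
    qed
    have x: "?x = t - 1" using xp p0 by simp
    let ?N = "dbl v A"
    have NI: "?N \<subseteq> I" by (rule dbl_I)
    have Npos: "k = 0 \<or> (3 \<le> k \<and> k \<le> int c - 3)" if k: "k \<in> ?N" for k
    proof -
      obtain a where "a \<in> A" "v k \<in> a" "k \<in> I" using k unfolding dbl_def by blast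
      then show ?thesis using pos[of a k] l2 AE unfolding idx_def by auto
    qed
    have "card ?Av \<le> card (touch ?N)" using fc5 x cAv c2 l2 t4 by linarith
    then have tN: "touch ?N = ?Av" using fc6 fA(1) by (intro card_seteq) auto
    have Nn: "k + 1 \<notin> ?N" if k: "k \<in> ?N" for k
    proof
      assume k1: "k + 1 \<in> ?N"
      obtain a where a: "a \<in> A" "v k \<in> a" using k unfolding dbl_def by blast
      obtain b where b: "b \<in> A" "b \<noteq> a" "v (k + 1) \<in> b" using k1 unfolding dbl_def by blast
      have "a \<in> unu e ?u" "b \<in> unu e ?u" using a(1) b(1) AE unfolding far_def by auto
      then show False using unu_rule[OF d(1) u _ _ b(2)[symmetric] a(2)] b(3) by blast
    qed
    \<comment> \<open>Every cycle edge in \<open>?Av\<close> is touched by a position of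
      \<open>N\<close>; as \<open>N\<close> has no consecutive positions, it contains 3 and then
      5.\<close>
    have step: "m + 1 \<in> ?N" if m: "m \<in> ?Av" "m \<notin> ?N" "0 \<le> m" "m + 1 < int c" for m
    proof -
      have "m \<in> touch ?N" using m tN by simp
      then obtain k where k: "k \<in> ?N" "m = prv k" using m(2) unfolding touch_def by auto
      have "k \<in> I" using k NI by blast
      then have "k = m + 1" using prv_cases[of k] k m by auto
      then show ?thesis using k by simp
    qed
    have N3: "3 \<in> ?N"
    proof -
      have "2 \<notin> ?N" using Npos[of 2] by auto
      then show ?thesis using step[of 2] l2 c2 t4 by simp
    qed
    have N5: "5 \<in> ?N"
    proof -
      have "4 \<notin> ?N" using Nn[OF N3] by simp
      then show ?thesis using step[of 4] l2 c2 t4 by simp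
    qed
    let ?W = "insert w1 (v ` ?N)"
    have inj: "inj_on v ?N" using cyc_inj(1)[OF d(1)] NI by (rule inj_on_subset)
    have fW: "finite ?W" using dbl_I(2) by simp
    have w1N: "w1 \<notin> v ` ?N" using w by auto
    have w2W: "w2 \<notin> ?W" using w wne by auto
    have cW: "card ?W = t" using w1N card_image[OF inj] x dbl_I(2) c5 by simp
    let ?S = "{b. b \<subseteq> insert w2 ?W \<and> w2 \<in> b \<and> card b = r}"
    have cS: "card ?S = t choose (r - 1)"
      using card_subsets_containing[of "insert w2 ?W" w2 r] fW w2W cW r3 by simp
    have fS: "finite ?S" using fW by simp
    have AS: "A \<subseteq> ?S"
    proof
      fix a assume a: "a \<in> A"
      then have aF: "a \<in> far e us fs" using AE by simp
      have "a \<subseteq> set us \<union> v ` ?N" using fc4[OF pe a] .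
      then show "a \<in> ?S" using far_sub(2,5)[OF Q aF] unif us by auto
    qed
    have v35: "v 3 \<noteq> v 5" using cycD(1)[OF d(1)] mod_neq[of 3 5] c5 by auto
    have ex: "\<exists>S \<in> ?S. w1 \<in> S \<and> x \<in> S \<and> y \<notin> S" if xy: "x \<in> v ` ?N" "y \<in> v ` ?N" "x \<noteq> y" for x y
    proof -
      have s: "{w2, w1, x} \<subseteq> insert w2 ?W - {y}" using xy w1N w2W by auto
      moreover have "card {w2, w1, x} = 3"
      proof -
        have "x \<noteq> w1" "x \<noteq> w2" using xy(1) w1N w2W by blast+
        then show ?thesis using wne by simp
      qed
      moreover have "card (insert w2 ?W - {y}) = t"
      proof -
        have "y \<in> insert w2 ?W" using xy(2) by blast
        then have "card (insert w2 ?W - {y}) = card (insert w2 ?W) - 1" by simp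
        also have "card (insert w2 ?W) = Suc t" using card_insert_disjoint[OF fW w2W] cW by simp
        finally show ?thesis by simp
      qed
      ultimately obtain S where S: "{w2, w1, x} \<subseteq> S" "S \<subseteq> insert w2 ?W - {y}" "card S = r"
        using exists_subset_between[of "{w2, w1, x}" r "insert w2 ?W - {y}"] r3 rt fW by (metis finite_Diff finite_insert)
      then show ?thesis by (intro bexI[of _ S]) auto
    qed
    have vN: "v 3 \<in> v ` ?N" "v 5 \<in> v ` ?N" using N3 N5 by auto
    obtain S3 where S3: "S3 \<in> ?S" "w1 \<in> S3" "v 3 \<in> S3" "v 5 \<notin> S3" using ex[OF vN v35] by blast
    obtain S5 where S5: "S5 \<in> ?S" "w1 \<in> S5" "v 5 \<in> S5" "v 3 \<notin> S5" using ex[OF vN(2,1) v35[symmetric]] by blast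
    \<comment> \<open>\<open>A\<close> misses at most one set of the star. Whichever of
      \<open>S3\<close> and \<open>S5\<close> is present contains the head \<open>w1\<close>; a
      second far edge at the other of \<open>v 3\<close> and \<open>v 5\<close> completes a bridge
      over distance 2 with two path vertices.\<close>
    have "S3 \<in> A \<or> S5 \<in> A"
    proof (rule ccontr)
      assume "\<not> ?thesis"
      then have "A \<subseteq> ?S - {S3, S5}" using AS by blast
      then have "card A \<le> card (?S - {S3, S5})" using fS by (intro card_mono) auto
      also have "\<dots> = (t choose (r - 1)) - 2"
      proof -
        have "S3 \<noteq> S5" using S3 S5 by blast
        then show ?thesis using cS S3(1) S5(1) fS by (subst card_Diff_subset) auto
      qed
      finally show False using A1 tau_ge t4 by linarith
    qed
    moreover have "hd us = w1" "last us = w2" using us by auto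
    ultimately consider "S3 \<in> A" | "S5 \<in> A" by blast
    then show False
    proof cases
      case 1
      then have F: "S3 \<in> far e us fs" using AE by simp
      obtain b where b: "b \<in> A" "b \<noteq> S3" "v 5 \<in> b" using N5 unfolding dbl_def by blast
      then have bF: "b \<in> far e us fs" using AE by simp
      note f = far_sub[OF Q F] and g = far_sub[OF Q bF]
      have "int (length us) + 1 \<le> 5 - 3"
        using f g b S3 c5 us by (intro bridge_VV[OF d(1,2), of 3 5 S3 b]) auto
      then show False using l2 by simp
    next
      case 2
      then have F: "S5 \<in> far e us fs" using AE by simp
      obtain b where b: "b \<in> A" "b \<noteq> S5" "v 3 \<in> b" using N3 unfolding dbl_def by blast
      then have bF: "b \<in> far e us fs" using AE by simp
      note f = far_sub[OF Q F] and g = far_sub[OF Q bF]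
      have "int (length (rev us)) + 1 \<le> 5 - 3"
        using f g b S5 c5 us by (intro bridge_VV[OF d(1) qpath_rev[OF d(2)], of 3 5 b S5]) auto
      then show False using l2 by simp
    qed
  qed
qed

text \<open>If no far edge at the head met the cycle, the head would have at most
  \<open>t - 1 choose (r - 1)\<close> edges inside the path and \<open>t - 1\<close> path edges,
  fewer than its degree. A shift moves an attachment to position 0.\<close>

lemma no_qlong: "\<not> qlong v e us fs"
proof
  assume Q: "qlong v e us fs"
  note d = qlongD[OF Q] and q = qpathD[OF qlongD(2)[OF Q]] and ln = qlong_len[OF Q] and rs = rev_simps[OF Q]
  have Q': "qlong v e (rev us) (rev fs)" by (rule qlong_rev[OF Q])
  have on0: "onc e (hd us) = {}" by (rule no_onc_hd[OF Q])
  have hV: "hd us \<in> V" using q by auto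
  have "\<exists>a \<in> far e (rev us) (rev fs). a \<inter> range v \<noteq> {}"
  proof (rule ccontr)
    assume n: "\<not> ?thesis"
    have sub: "far e (rev us) (rev fs) \<subseteq> {a. a \<subseteq> set us \<and> hd us \<in> a \<and> card a = r}"
    proof
      fix a assume a: "a \<in> far e (rev us) (rev fs)"
      note f = far_sub[OF Q' a, unfolded rs]
      have "a \<inter> range v = {}" using n a by blast
      then have "a \<subseteq> set us" using f(1) by auto
      then show "a \<in> {a. a \<subseteq> set us \<and> hd us \<in> a \<and> card a = r}" using f(5) unif[OF f(2)] by simp
    qed
    then have "card (far e (rev us) (rev fs)) \<le> card {a. a \<subseteq> set us \<and> hd us \<in> a \<and> card a = r}" by (intro card_mono) auto
    also have "\<dots> = length us - 1 choose (r - 1)"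
      using card_subsets_containing[of "set us" "hd us" r] q(9) distinct_card[OF q(2)] r3 by simp
    also have "\<dots> \<le> t - 1 choose (r - 1)" using ln(2) by (intro binomial_right_mono) auto
    finally have "card (unu e (hd us)) \<le> (t - 1 choose (r - 1)) + (length us - 1)"
      using unu_last_le[OF Q'] unfolding rs by linarith
    moreover have "(t choose (r - 1)) + 1 \<le> card (unu e (hd us))" using deg_ge[OF d(1) hV] on0 by simp
    moreover have "t choose (r - 1) = (t - 1 choose (r - 2)) + (t - 1 choose (r - 1))"
      using choose_pascal[of t "r - 1"] r3 c5 by (simp add: numeral_2_eq_2)
    moreover have "t - 1 \<le> t - 1 choose (r - 2)" using r3 rt by (intro choose_ge_self) auto
    ultimately show False using ln(2) by linarith
  qed
  then obtain a s where a: "a \<in> far e (rev us) (rev fs)" "v s \<in> a" by blast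
  show False
  proof (rule no_qlong_aux[OF qlong_shift[OF Q, of s], of a])
    show "a \<in> far (\<lambda>i. e (i + s)) (rev us) (rev fs)" unfolding far_shift by (rule a(1))
    show "v (0 + s) \<in> a" using a(2) by simp
  qed
qed

lemma no_cyc: "\<not> cyc v e"
  using ex_qlong no_qlong by blast

end

theorem theorem1p7:
  fixes n k r t :: nat and V :: "'a set" and E :: "'a set set"
  assumes t: "t = (n - 1) div 2"
    and nk: "n \<ge> k" "k \<ge> 3"
    and tr: "t \<ge> r" "r \<ge> 3"
    and H: "hypergraph V E" "card V = n" "uniform r E"
    and cases:
      "(k \<le> r + 1 \<and> min_degree V E \<ge> k - 1) \<or>
       (r + 2 \<le> k \<and> k < t + 2 \<and> min_degree V E \<ge> ((k - 2) choose (r - 1)) + 1) \<or>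
       (k \<ge> t + 2 \<and> min_degree V E \<ge> (t choose (r - 1)) + 1)"
  shows "\<exists>vs es. berge_cycle V E vs es \<and> length vs \<ge> k"
proof -
  interpret hyper V E r
    by unfold_locales (use H tr in \<open>auto simp: hypergraph_def uniform_def\<close>)
  have Vne: "V \<noteq> {}" using nk H by auto
  have md: "min_degree V E \<le> card {e \<in> E. x \<in> e}" if "x \<in> V" for x
  proof -
    have "min_degree V E \<le> degree E x" unfolding min_degree_def using that finV by (intro Min_le) auto
    then show ?thesis unfolding degree_def .
  qed
  have fin: ?thesis if s: "\<not> short_cycles (k - 1)"
  proof -
    obtain vs es where "berge_cycle V E vs es" "\<not> length vs \<le> k - 1" using s unfolding short_cycles_def by blast
    then have "berge_cycle V E vs es \<and> k \<le> length vs" by simp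
    then show ?thesis by blast
  qed
  consider (a) "k \<le> r + 1" "k - 1 \<le> min_degree V E"
    | (b) "r + 2 \<le> k" "(k - 2 choose (r - 1)) + 1 \<le> min_degree V E"
    | (c) "k \<ge> t + 2" "(t choose (r - 1)) + 1 \<le> min_degree V E" using cases by blast
  then show ?thesis
  proof cases
    case a
    have "k - 1 \<le> card {e \<in> E. x \<in> e}" if "x \<in> V" for x using md[OF that] a(2) by simp
    then show ?thesis using fin long_cycle_small[OF Vne nk(2) a(1)] by blast
  next
    case b
    have "(k - 2 choose (r - 1)) + 1 \<le> card {e \<in> E. x \<in> e}" if "x \<in> V" for x using md[OF that] b(2) by simp
    then show ?thesis using fin long_cycle[OF Vne b(1)] by blast
  next
    case c
    have dg: "(t choose (r - 1)) + 1 \<le> card {e \<in> E. x \<in> e}" if "x \<in> V" for x using md[OF that] c(2) by simp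
    \<comment> \<open>For \<open>k = t + 2\<close> the bound in \<open>long_cycle\<close> becomes
      \<open>t choose (r - 1)\<close>.\<close>
    have "\<not> short_cycles (t + 1)"
      using long_cycle[OF Vne, of "t + 2"] dg tr by simp
    then obtain vs0 es0 where c0: "berge_cycle V E vs0 es0" "t + 2 \<le> length vs0"
      unfolding short_cycles_def by (metis Suc_eq_plus1 add_2_eq_Suc' not_less_eq_eq)
    have "length vs \<le> card V" if "berge_cycle V E vs es" for vs es
      using that finV unfolding berge_cycle_def by (metis card_mono distinct_card)
    then have bd: "\<forall>vs. (\<exists>es. berge_cycle V E vs es) \<longrightarrow> length vs < Suc (card V)" by (auto simp: less_Suc_eq_le)
    have "\<exists>es. berge_cycle V E vs0 es" using c0 by blast
    then have "\<exists>vs. (\<exists>es. berge_cycle V E vs es) \<and> (\<forall>us. (\<exists>es. berge_cycle V E us es) \<longrightarrow> length us \<le> length vs)"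
      using bd by (rule ex_has_greatest_nat)
    then obtain vs es where m: "berge_cycle V E vs es" "\<forall>us. (\<exists>es. berge_cycle V E us es) \<longrightarrow> length us \<le> length vs" by blast
    show ?thesis
    proof (cases "length vs < card V")
      case False
      then have "k \<le> length vs" using nk H by simp
      then show ?thesis using m(1) by blast
    next
      case True
      \<comment> \<open>A longest cycle that misses a vertex meets all assumptions of the locale, in
        which no cycle exists.\<close>
      interpret ham V E r t "length vs"
      proof
        show "2 * t + 1 \<le> card V" "card V \<le> 2 * t + 2" using t H nk by auto
        show "short_cycles (length vs)" unfolding short_cycles_def using m(2) by blast
        show "t + 2 \<le> length vs" using m(2) c0 le_trans by blast
      qed (use tr dg True in auto)
      show ?thesis using ex_cyc[OF m(1) refl] no_cyc by blast
    qed
  qed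
qed

end
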